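(* For every prime power $q$, there are at least four pairwise non-isomorphic strongly regular configurations with parameters $(v_k;\lambda,\mu)$ where $$v=(q^2+1)(q^4+q^3+q^2+q+1),\quad k=q^2+q+1,\quad \lambda=q^3+2q^2+q-1,\quad \mu=(q+1)^2.$$ One of them is the semipartial geometry $LP(4,q)$, and the others are not semipartial geometries.
   Context: A symmetric $(v_k)$ configuration is a finite incidence structure of $v$ points and $v$ lines such that every line has exactly $k$ points, every point lies on exactly $k$ lines, and two distinct points lie on at most one common line. Its point graph has the points as vertices, two distinct points adjacent iff they lie on a common line. A strongly regular configuration with parameters $(v_k;\lambda,\mu)$ is a symmetric $(v_k)$ configuration whose point graph is a strongly regular graph $SRG(v,k(k-1),\lambda,\mu)$. A semipartial geometry is a configuration for which there are constants $\alpha,\mu$ such that for every non-incident point–line pair $(P,\ell)$ the number of points on $\ell$ collinear with $P$ is $0$ or $\alpha$, and every two non-collinear points have exactly $\mu$ common collinear points. $LP(4,q)$ is the incidence structure whose points are the lines of the projective space $PG(4,q)$, whose lines are the planes of $PG(4,q)$, with incidence being inclusion. *)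

theory Defs
  imports
    "HOL-Number_Theory.Prime_Powers"
    "Jordan_Normal_Form.Missing_VectorSpace"
begin

section \<open>Incidence structures\<close>

text \<open>Only the values of \<open>incident\<close> on points and lines of the structure are relevant.\<close>

record ('p, 'l) incidence_structure =
  points :: "'p set"
  lines :: "'l set"
  incident :: "'p \<Rightarrow> 'l \<Rightarrow> bool"

definition isomorphic ::
    "('p, 'l) incidence_structure \<Rightarrow> ('r, 's) incidence_structure \<Rightarrow> bool" where
  "isomorphic S T \<longleftrightarrow>
     (\<exists>f g. bij_betw f (points S) (points T) \<and> bij_betw g (lines S) (lines T) \<and>
        (\<forall>P\<in>points S. \<forall>l\<in>lines S. incident S P l \<longleftrightarrow> incident T (f P) (g l)))"

definition collinear :: "('p, 'l) incidence_structure \<Rightarrow> 'p \<Rightarrow> 'p \<Rightarrow> bool" where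
  "collinear S P Q \<longleftrightarrow> (\<exists>l\<in>lines S. incident S P l \<and> incident S Q l)"

text \<open>The adjacency relation of the point graph, whose vertex set is \<open>points S\<close>.\<close>

definition point_graph_adj :: "('p, 'l) incidence_structure \<Rightarrow> 'p \<Rightarrow> 'p \<Rightarrow> bool" where
  "point_graph_adj S P Q \<longleftrightarrow> P \<in> points S \<and> Q \<in> points S \<and> P \<noteq> Q \<and> collinear S P Q"

definition strongly_regular_graph ::
    "'v set \<Rightarrow> ('v \<Rightarrow> 'v \<Rightarrow> bool) \<Rightarrow> nat \<Rightarrow> nat \<Rightarrow> nat \<Rightarrow> nat \<Rightarrow> bool" where
  "strongly_regular_graph V adj v k lam mu \<longleftrightarrow>
     finite V \<and> card V = v \<and>
     (\<forall>x\<in>V. \<not> adj x x) \<and>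
     (\<forall>x\<in>V. \<forall>y\<in>V. adj x y \<longrightarrow> adj y x) \<and>
     (\<forall>x\<in>V. card {z\<in>V. adj x z} = k) \<and>
     (\<forall>x\<in>V. \<forall>y\<in>V. adj x y \<longrightarrow> card {z\<in>V. adj x z \<and> adj y z} = lam) \<and>
     (\<forall>x\<in>V. \<forall>y\<in>V. x \<noteq> y \<and> \<not> adj x y \<longrightarrow> card {z\<in>V. adj x z \<and> adj y z} = mu)"

text \<open>A $(v_r, b_k)$ configuration: $v$ points and $b$ lines, with $r$ lines through every point
  and $k$ points on every line.\<close>

definition configuration ::
    "('p, 'l) incidence_structure \<Rightarrow> nat \<Rightarrow> nat \<Rightarrow> nat \<Rightarrow> nat \<Rightarrow> bool" where
  "configuration S v r b k \<longleftrightarrow>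
     finite (points S) \<and> card (points S) = v \<and>
     finite (lines S) \<and> card (lines S) = b \<and>
     (\<forall>l\<in>lines S. card {P\<in>points S. incident S P l} = k) \<and>
     (\<forall>P\<in>points S. card {l\<in>lines S. incident S P l} = r) \<and>
     (\<forall>P\<in>points S. \<forall>Q\<in>points S. P \<noteq> Q \<longrightarrow>
        (\<forall>l\<in>lines S. \<forall>m\<in>lines S.
           incident S P l \<and> incident S Q l \<and> incident S P m \<and> incident S Q m \<longrightarrow> l = m))"

abbreviation symmetric_configuration ::
    "('p, 'l) incidence_structure \<Rightarrow> nat \<Rightarrow> nat \<Rightarrow> bool" where
  "symmetric_configuration S v k \<equiv> configuration S v k v k"

definition strongly_regular_configuration ::
    "('p, 'l) incidence_structure \<Rightarrow> nat \<Rightarrow> nat \<Rightarrow> nat \<Rightarrow> nat \<Rightarrow> bool" where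
  "strongly_regular_configuration S v k lam mu \<longleftrightarrow>
     symmetric_configuration S v k \<and>
     strongly_regular_graph (points S) (point_graph_adj S) v (k * (k - 1)) lam mu"

definition semipartial_geometry :: "('p, 'l) incidence_structure \<Rightarrow> bool" where
  "semipartial_geometry S \<longleftrightarrow>
     (\<exists>v r b k. configuration S v r b k) \<and>
     (\<exists>\<alpha>. \<forall>P\<in>points S. \<forall>l\<in>lines S. \<not> incident S P l \<longrightarrow>
        card {Q\<in>points S. incident S Q l \<and> collinear S P Q} \<in> {0, \<alpha>}) \<and>
     (\<exists>\<mu>. \<forall>P\<in>points S. \<forall>Q\<in>points S. P \<noteq> Q \<and> \<not> collinear S P Q \<longrightarrow>
        card {R\<in>points S. R \<noteq> P \<and> R \<noteq> Q \<and> collinear S P R \<and> collinear S Q R} = \<mu>)"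


section \<open>Projective spaces and \<open>LP(n, q)\<close>\<close>

text \<open>The subspaces of projective dimension \<open>d\<close> of $PG(n, F)$, represented by the linear subspaces
  of dimension \<open>d + 1\<close> of the coordinate space $F^{n+1}$.\<close>

definition PG_subspaces ::
    "nat \<Rightarrow> ('a, 'm) ring_scheme \<Rightarrow> nat \<Rightarrow> (nat \<Rightarrow> 'a) set set" where
  "PG_subspaces n F d =
     (let V = ring.func_space F {..n} in
      {W. VectorSpace.subspace F W V \<and> vectorspace.dim F (V\<lparr>carrier := W\<rparr>) = d + 1})"

definition LP ::
    "nat \<Rightarrow> ('a, 'm) ring_scheme \<Rightarrow> ((nat \<Rightarrow> 'a) set, (nat \<Rightarrow> 'a) set) incidence_structure" where
  "LP n F = \<lparr>points = PG_subspaces n F 1, lines = PG_subspaces n F 2, incident = (\<subseteq>)\<rparr>"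

end

theory Submission
  imports Defs "Jordan_Normal_Form.Determinant" "HOL-Algebra.Algebraic_Closure"
    "HOL-Number_Theory.Residues"
begin

text \<open>
  Let \<open>P0\<close> be a point and \<open>H\<close> a hyperplane of $PG(4,q)$ with $P_0 \notin H$. In $LP(4,q)$ the planes inside
  \<open>H\<close> may be replaced by the points of \<open>H\<close>, a point being incident with the lines of \<open>H\<close> through it: two
  lines of \<open>H\<close> are coplanar iff they meet, so the point graph does not change. In the dual of the
  resulting configuration the lines through \<open>P0\<close> may be replaced by the solids through \<open>P0\<close> in the same
  way. The dual of a strongly regular configuration is strongly regular with the same parameters,
  because the incidence matrix \<open>N\<close> is invertible and conjugates $N N^T$ into $N^T N$.

  The four configurations are distinguished by the antiflags \<open>(P, l)\<close> for which \<open>P\<close> is collinear with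
  all points of \<open>l\<close>: there are none in $LP(4,q)$; in the second configuration the lines involved in
  them meet pairwise; in the third one this fails, but the points involved are pairwise collinear; in
  the fourth one both fail.
\<close>

text \<open>Both replacements rest on the same facts about PG(3,q): it has as many points as planes,
  and a line has as many points on it as planes through it. \<open>H\<close> is a PG(3,q), and so is
  the quotient at \<open>P0\<close>, whose points, lines and planes are the lines, planes and solids
  through \<open>P0\<close>. That \<open>P0\<close> lies off \<open>H\<close> keeps the two
  operations apart: a line through \<open>P0\<close> is never inside \<open>H\<close>, so the first
  replacement leaves the planes through it untouched. Invertibility of N is a matter of parameters:
  it follows from k (lam + 1) \<noteq> (k - 1) mu, which here amounts to k \<noteq> q + 1. The
  geometry takes place in an abstract modular lattice of rank 5 with prescribed atom counts;
  coordinates enter only when this lattice is interpreted. Points and lines of all four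
  configurations are sets of vectors, so duals and mixtures of points and planes fit into one family
  of a single type. A field of order q is constructed separately, as the q solutions of x^q = x in
  an algebraic closure of the prime field; it shows that the statement about all fields of order q
  has instances.\<close>

hide_const (open) Polynomial.order Divisibility.prime

section \<open>Configurations\<close>

lemma configuration_unique_line:
  assumes "configuration S v r b k" "P \<in> points S" "Q \<in> points S" "P \<noteq> Q"
    "l \<in> lines S" "m \<in> lines S" "incident S P l" "incident S Q l" "incident S P m" "incident S Q m"
  shows "l = m"
  using assms unfolding configuration_def by blast

lemma configuration_degree:
  assumes S: "configuration S v r b k" and P: "P \<in> points S"
  shows "card {Q\<in>points S. point_graph_adj S P Q} = r * (k - 1)"
proof -
  let ?L = "{l\<in>lines S. incident S P l}"
  let ?N = "\<lambda>l. {Q\<in>points S. incident S Q l} - {P}"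
  have fin: "finite (points S)" "finite ?L"
    using S by (auto simp: configuration_def)
  have "{Q\<in>points S. point_graph_adj S P Q} = (\<Union>l\<in>?L. ?N l)"
    using P by (auto simp: point_graph_adj_def collinear_def)
  also have "card \<dots> = (\<Sum>l\<in>?L. card (?N l))"
    using fin P by (intro card_UN_disjoint) (auto dest: configuration_unique_line[OF S])
  also have "\<dots> = (\<Sum>l\<in>?L. k - 1)"
    using S P fin by (intro sum.cong) (auto simp: configuration_def)
  also have "\<dots> = r * (k - 1)"
    using S P by (simp add: configuration_def)
  finally show ?thesis .
qed

text \<open>With N the incidence matrix, these numbers are the entries of N N^T, which is therefore
  r I + A, where A is the adjacency matrix of the point graph.\<close>

lemma configuration_common_lines:
  assumes S: "configuration S v r b k" and P: "P \<in> points S" and Q: "Q \<in> points S"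
  shows "card {l\<in>lines S. incident S P l \<and> incident S Q l} =
    (if P = Q then r else of_bool (point_graph_adj S P Q))"
proof (cases "P = Q")
  case True
  then show ?thesis using S P by (simp add: configuration_def)
next
  case False
  show ?thesis
  proof (cases "point_graph_adj S P Q")
    case True
    then obtain l where l: "l \<in> lines S" "incident S P l" "incident S Q l"
      by (auto simp: point_graph_adj_def collinear_def)
    then have "{l\<in>lines S. incident S P l \<and> incident S Q l} = {l}"
      using configuration_unique_line[OF S P Q False] by blast
    then show ?thesis using False True by simp
  next
    case nadj: False
    then have "{l\<in>lines S. incident S P l \<and> incident S Q l} = {}"
      using P Q False by (auto simp: point_graph_adj_def collinear_def)
    then show ?thesis using False nadj by (simp only: card.empty) simp
  qed
qed

section \<open>Duality\<close>

definition dual :: "('p, 'l) incidence_structure \<Rightarrow> ('l, 'p) incidence_structure" where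
  "dual S = \<lparr>points = lines S, lines = points S, incident = (\<lambda>l P. incident S P l)\<rparr>"

lemma dual_simps [simp]:
  "points (dual S) = lines S" "lines (dual S) = points S" "incident (dual S) l P = incident S P l"
  by (simp_all add: dual_def)

lemma configuration_dual:
  "configuration S v r b k \<Longrightarrow> configuration (dual S) b k v r"
  unfolding configuration_def by simp blast

text \<open>The entries are rational because the duality theorem inverts this matrix;
  \<open>f\<close> and \<open>g\<close> enumerate points and lines.\<close>

definition incidence_mat ::
    "('p, 'l) incidence_structure \<Rightarrow> nat \<Rightarrow> (nat \<Rightarrow> 'p) \<Rightarrow> (nat \<Rightarrow> 'l) \<Rightarrow> rat mat" where
  "incidence_mat S v f g = mat v v (\<lambda>(i, j). of_bool (incident S (f i) (g j)))"

lemma incidence_mat_carrier [simp]: "incidence_mat S v f g \<in> carrier_mat v v"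
  by (simp add: incidence_mat_def)

lemma incidence_mat_dual:
  "incidence_mat (dual S) v g f = transpose_mat (incidence_mat S v f g)"
  by (rule eq_matI) (auto simp: incidence_mat_def)

lemma incidence_mat_gram:
  fixes S :: "('p, 'l) incidence_structure" and f :: "nat \<Rightarrow> 'p" and g :: "nat \<Rightarrow> 'l" and v :: nat
  defines "N \<equiv> incidence_mat S v f g"
  assumes S: "symmetric_configuration S v k"
    and f: "bij_betw f {..<v} (points S)" and g: "bij_betw g {..<v} (lines S)"
    and ij: "i < v" "j < v"
  shows "(N * transpose_mat N) $$ (i, j) =
    (if i = j then of_nat k else of_bool (point_graph_adj S (f i) (f j)))"
proof -
  have fij: "f i \<in> points S" "f j \<in> points S" "f i = f j \<longleftrightarrow> i = j"
    using bij_betwE[OF f] bij_betw_imp_inj_on[OF f] ij by (auto dest: inj_onD)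
  have "(N * transpose_mat N) $$ (i, j) =
      (\<Sum>t<v. of_bool (incident S (f i) (g t) \<and> incident S (f j) (g t)))"
    using ij by (auto simp: N_def incidence_mat_def scalar_prod_def atLeast0LessThan
        of_bool_conj intro!: sum.cong)
  also have "\<dots> = (\<Sum>l\<in>lines S. of_bool (incident S (f i) l \<and> incident S (f j) l))"
    by (rule sum.reindex_bij_betw[OF g])
  also have "\<dots> = of_nat (card {l\<in>lines S. incident S (f i) l \<and> incident S (f j) l})"
    using S by (simp add: configuration_def of_bool_def sum.If_cases Int_def)
  also have "\<dots> = (if i = j then of_nat k else of_bool (point_graph_adj S (f i) (f j)))"
    using configuration_common_lines[OF S fij(1,2)] fij(3) by simp
  finally show ?thesis .
qed

abbreviation ones_mat :: "nat \<Rightarrow> rat mat" where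
  "ones_mat v \<equiv> mat v v (\<lambda>_. 1)"

text \<open>Strong regularity reads A^2 = k (k - 1) I + lam A + mu (J - I - A). Substituting A = M -
  k I gives the coefficients \<open>a\<close> and \<open>b\<close>. The forward direction serves a
  configuration, the backward one its dual, where M is replaced by N^T N.\<close>

lemma strongly_regular_iff_gram_quadratic:
  fixes S :: "('p, 'l) incidence_structure" and f :: "nat \<Rightarrow> 'p" and g :: "nat \<Rightarrow> 'l" and v k lam mu :: nat
  defines "N \<equiv> incidence_mat S v f g"
  defines "M \<equiv> N * transpose_mat N"
  defines "a \<equiv> 2 * of_nat k + of_nat lam - of_nat mu"
  defines "b \<equiv> of_nat mu * (of_nat k - 1) - of_nat k * (1 + of_nat lam)"
  assumes S: "symmetric_configuration S v k"
    and f: "bij_betw f {..<v} (points S)" and g: "bij_betw g {..<v} (lines S)"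
  shows "strongly_regular_graph (points S) (point_graph_adj S) v (k * (k - 1)) lam mu \<longleftrightarrow>
    M * M = a \<cdot>\<^sub>m M + b \<cdot>\<^sub>m 1\<^sub>m v + of_nat mu \<cdot>\<^sub>m ones_mat v"
proof -
  let ?adj = "point_graph_adj S"
  let ?c = "\<lambda>x y. card {z\<in>points S. ?adj x z \<and> ?adj y z}"
  have M: "M \<in> carrier_mat v v"
    unfolding M_def N_def by (rule mult_carrier_mat[where n = v]) (simp_all add: transpose_carrier_mat)
  note M_entry = incidence_mat_gram[OF S f g, folded N_def, folded M_def]
  have fv: "\<And>i. i < v \<Longrightarrow> f i \<in> points S" and finj: "\<And>i j. i < v \<Longrightarrow> j < v \<Longrightarrow> f i = f j \<longleftrightarrow> i = j"
    using bij_betwE[OF f] bij_betw_imp_inj_on[OF f] by (auto dest: inj_onD)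
  have sym: "?adj x y \<longleftrightarrow> ?adj y x" for x y
    by (auto simp: point_graph_adj_def collinear_def)
  have irr: "\<not> ?adj x x" for x by (simp add: point_graph_adj_def)
  have fin: "finite (points S)" and card_v: "card (points S) = v"
    using S by (auto simp: configuration_def)
  have pts: "points S = f ` {..<v}" using f by (simp add: bij_betw_def)
  \<comment> \<open>This is (k I + A)^2 = k^2 I + 2 k A + A^2; the entries of A^2 count common
    neighbours.\<close>
  have sq: "(M * M) $$ (i, j) = (of_nat k)\<^sup>2 * of_bool (i = j)
      + 2 * of_nat k * of_bool (?adj (f i) (f j)) + of_nat (?c (f i) (f j))"
    if ij: "i < v" "j < v" for i j
  proof -
    let ?A = "\<lambda>s t. of_bool (?adj (f s) (f t)) :: rat"
    have "(M * M) $$ (i, j) = (\<Sum>t<v. M $$ (i, t) * M $$ (t, j))"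
      using ij M by (auto simp: scalar_prod_def atLeast0LessThan intro!: sum.cong)
    also have "\<dots> = (\<Sum>t<v. (of_nat k)\<^sup>2 * (of_bool (t = i) * of_bool (i = j))
        + of_nat k * (of_bool (t = i) * ?A t j) + of_nat k * (of_bool (t = j) * ?A i t)
        + of_bool (?adj (f i) (f t) \<and> ?adj (f j) (f t)))"
      using ij sym irr by (intro sum.cong) (auto simp: M_entry power2_eq_square)
    also have "\<dots> = (of_nat k)\<^sup>2 * of_bool (i = j) + of_nat k * ?A i j + of_nat k * ?A i j
        + (\<Sum>t<v. of_bool (?adj (f i) (f t) \<and> ?adj (f j) (f t)))"
    proof -
      have "(\<Sum>t<v. of_bool (t = i) * of_bool (i = j)) = (of_bool (i = j) :: rat)"
        using ij by (simp add: of_bool_def if_distrib[of "\<lambda>x. x * _"] cong: if_cong)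
      moreover have "(\<Sum>t<v. of_bool (t = i) * ?A t j) = ?A i j"
        using ij by (simp add: of_bool_def if_distrib[of "\<lambda>x. x * _"] cong: if_cong)
      moreover have "(\<Sum>t<v. of_bool (t = j) * ?A i t) = ?A i j"
        using ij by (simp add: of_bool_def if_distrib[of "\<lambda>x. x * _"] cong: if_cong)
      ultimately show ?thesis
        by (simp only: sum.distrib sum_distrib_left[symmetric])
    qed
    also have "(\<Sum>t<v. of_bool (?adj (f i) (f t) \<and> ?adj (f j) (f t))) =
        (\<Sum>z\<in>points S. of_bool (?adj (f i) z \<and> ?adj (f j) z) :: rat)"
      by (rule sum.reindex_bij_betw[OF f])
    also have "\<dots> = of_nat (?c (f i) (f j))"
      using fin by (simp add: of_bool_def sum.If_cases Int_def)
    finally show ?thesis by simp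
  qed
  have diag: "?c x x = k * (k - 1)" if "x \<in> points S" for x
    using configuration_degree[OF S that] by simp
  have rhs: "(a \<cdot>\<^sub>m M + b \<cdot>\<^sub>m 1\<^sub>m v + of_nat mu \<cdot>\<^sub>m ones_mat v) $$ (i, j) =
      a * M $$ (i, j) + b * of_bool (i = j) + of_nat mu" if "i < v" "j < v" for i j
    using that M by simp
  \<comment> \<open>On the diagonal both sides agree in every symmetric configuration, because each
    degree is k (k - 1). Only the entries off the diagonal say something about \<open>lam\<close>
    and \<open>mu\<close>.\<close>
  have entry: "(M * M) $$ (i, j) = (a \<cdot>\<^sub>m M + b \<cdot>\<^sub>m 1\<^sub>m v + of_nat mu \<cdot>\<^sub>m ones_mat v) $$ (i, j)
      \<longleftrightarrow> i = j \<or> ?c (f i) (f j) = (if ?adj (f i) (f j) then lam else mu)"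
    if ij: "i < v" "j < v" for i j
  proof (cases "i = j")
    case True
    have "of_nat (k * (k - 1)) + of_nat k = (of_nat k * of_nat k :: rat)"
      by (cases k) (auto simp: algebra_simps)
    then show ?thesis
      unfolding rhs[OF ij] sq[OF ij] using True ij
      by (simp add: M_entry irr diag[OF fv, simplified] a_def b_def algebra_simps power2_eq_square
          del: of_nat_mult)
  next
    case False
    show ?thesis
      unfolding rhs[OF ij] sq[OF ij] using False ij
      by (auto simp: M_entry a_def simp flip: of_nat_add)
  qed
  have "M * M = a \<cdot>\<^sub>m M + b \<cdot>\<^sub>m 1\<^sub>m v + of_nat mu \<cdot>\<^sub>m ones_mat v \<longleftrightarrow>
    (\<forall>i<v. \<forall>j<v. (M * M) $$ (i, j) = (a \<cdot>\<^sub>m M + b \<cdot>\<^sub>m 1\<^sub>m v + of_nat mu \<cdot>\<^sub>m ones_mat v) $$ (i, j))"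
    (is "?L = ?R \<longleftrightarrow> _")
  proof
    assume *: "\<forall>i<v. \<forall>j<v. ?L $$ (i, j) = ?R $$ (i, j)"
    have "?L \<in> carrier_mat v v" "?R \<in> carrier_mat v v"
      using M by auto
    then show "?L = ?R"
      using * by (intro eq_matI) (auto simp only: carrier_matD)
  qed simp
  also have "\<dots> \<longleftrightarrow> (\<forall>i<v. \<forall>j<v. i = j \<or> ?c (f i) (f j) = (if ?adj (f i) (f j) then lam else mu))"
    using entry by simp
  also have "\<dots> \<longleftrightarrow> (\<forall>x\<in>points S. \<forall>y\<in>points S. x = y \<or> ?c x y = (if ?adj x y then lam else mu))"
    unfolding pts using finj by auto
  also have "\<dots> \<longleftrightarrow> strongly_regular_graph (points S) (point_graph_adj S) v (k * (k - 1)) lam mu"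
  proof -
    have "(x = y \<or> ?c x y = (if ?adj x y then lam else mu)) \<longleftrightarrow>
        (?adj x y \<longrightarrow> ?c x y = lam) \<and> (x \<noteq> y \<and> \<not> ?adj x y \<longrightarrow> ?c x y = mu)" for x y
      using irr by (cases "x = y") auto
    then show ?thesis
      unfolding strongly_regular_graph_def
      using fin card_v sym irr configuration_degree[OF S] by (simp add: ball_conj_distrib)
  qed
  finally show ?thesis by simp
qed

lemma row_sums_ones_mat:
  assumes "N \<in> carrier_mat v v" "\<And>i. i < v \<Longrightarrow> (\<Sum>j<v. N $$ (i, j)) = s"
  shows "N * ones_mat v = s \<cdot>\<^sub>m ones_mat v"
proof (rule eq_matI)
  fix i j assume "i < dim_row (s \<cdot>\<^sub>m ones_mat v)" "j < dim_col (s \<cdot>\<^sub>m ones_mat v)"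
  then have "i < v" "j < v" by simp_all
  moreover from this have "(N * ones_mat v) $$ (i, j) = (\<Sum>t<v. N $$ (i, t))"
    using assms(1) by (auto simp: scalar_prod_def atLeast0LessThan intro!: sum.cong)
  ultimately show "(N * ones_mat v) $$ (i, j) = (s \<cdot>\<^sub>m ones_mat v) $$ (i, j)"
    using assms by simp
qed (use assms in auto)

lemma incidence_mat_ones:
  assumes S: "symmetric_configuration S v k"
    and f: "bij_betw f {..<v} (points S)" and g: "bij_betw g {..<v} (lines S)"
  shows "incidence_mat S v f g * ones_mat v = of_nat k \<cdot>\<^sub>m ones_mat v"
proof (rule row_sums_ones_mat)
  fix i assume i: "i < v"
  then have fi: "f i \<in> points S" using bij_betwE[OF f] by auto
  have "(\<Sum>j<v. incidence_mat S v f g $$ (i, j)) = (\<Sum>j<v. of_bool (incident S (f i) (g j)))"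
    using i by (simp add: incidence_mat_def)
  also have "\<dots> = (\<Sum>l\<in>lines S. of_bool (incident S (f i) l))"
    by (rule sum.reindex_bij_betw[OF g])
  also have "\<dots> = of_nat k"
    using S fi by (simp add: configuration_def of_bool_def sum.If_cases Int_def)
  finally show "(\<Sum>j<v. incidence_mat S v f g $$ (i, j)) = of_nat k" .
qed simp

text \<open>The hypothesis \<open>nz\<close> says that the constant term \<open>b\<close> of the
  quadratic equation for N N^T is nonzero, so this equation can be solved for an inverse. The
  all-ones matrix J passes through N unchanged up to the factor k, since all row and column sums of
  N are k.\<close>

theorem strongly_regular_configuration_dual:
  assumes S: "strongly_regular_configuration S v k lam mu"
    and k: "k > 0" and nz: "k * (lam + 1) \<noteq> (k - 1) * mu"
  shows "strongly_regular_configuration (dual S) v k lam mu"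
proof -
  have conf: "symmetric_configuration S v k"
    and srg: "strongly_regular_graph (points S) (point_graph_adj S) v (k * (k - 1)) lam mu"
    using S by (auto simp: strongly_regular_configuration_def)
  have dconf: "symmetric_configuration (dual S) v k"
    by (rule configuration_dual[OF conf])
  obtain f where f: "bij_betw f {..<v} (points S)"
    using conf ex_bij_betw_nat_finite[of "points S"]
    by (auto simp: configuration_def atLeast0LessThan)
  obtain g where g: "bij_betw g {..<v} (lines S)"
    using conf ex_bij_betw_nat_finite[of "lines S"]
    by (auto simp: configuration_def atLeast0LessThan)
  define N where "N = incidence_mat S v f g"
  define M where "M = N * transpose_mat N"
  define M' where "M' = transpose_mat N * N"
  define J where "J = ones_mat v"
  define a b c \<kappa> :: rat where "a = 2 * of_nat k + of_nat lam - of_nat mu"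
    and "b = of_nat mu * (of_nat k - 1) - of_nat k * (1 + of_nat lam)"
    and "c = of_nat mu" and "\<kappa> = of_nat k"
  have N [simp]: "N \<in> carrier_mat v v" and J [simp]: "J \<in> carrier_mat v v"
    by (simp_all add: N_def J_def)
  have NT [simp]: "transpose_mat N \<in> carrier_mat v v" by simp
  have M [simp]: "M \<in> carrier_mat v v" unfolding M_def by (rule mult_carrier_mat[OF N NT])
  have M' [simp]: "M' \<in> carrier_mat v v" unfolding M'_def by (rule mult_carrier_mat[OF NT N])
  have "\<kappa> \<noteq> 0" using k by (simp add: \<kappa>_def)
  have "b \<noteq> 0"
  proof
    assume "b = 0"
    then have "of_nat ((k - 1) * mu) = (of_nat (k * (lam + 1)) :: rat)"
      using k by (simp add: b_def of_nat_diff algebra_simps)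
    with nz show False by (simp only: of_nat_eq_iff)
  qed
  have NJ: "N * J = \<kappa> \<cdot>\<^sub>m J"
    unfolding N_def J_def \<kappa>_def by (rule incidence_mat_ones[OF conf f g])
  have NTJ: "transpose_mat N * J = \<kappa> \<cdot>\<^sub>m J"
    unfolding N_def J_def \<kappa>_def incidence_mat_dual[symmetric]
    by (rule incidence_mat_ones[OF dconf]) (simp_all add: f g)
  have "transpose_mat (J * N) = transpose_mat N * transpose_mat J"
    by (rule transpose_mult[OF J N])
  also have "transpose_mat J = J" by (auto simp: J_def)
  finally have "transpose_mat (J * N) = transpose_mat (\<kappa> \<cdot>\<^sub>m J)"
    unfolding NTJ by (auto simp: J_def)
  then have JN: "J * N = \<kappa> \<cdot>\<^sub>m J"
    by (simp only: transpose_mat_eq)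
  have quad: "M * M = a \<cdot>\<^sub>m M + b \<cdot>\<^sub>m 1\<^sub>m v + c \<cdot>\<^sub>m J"
    using srg unfolding strongly_regular_iff_gram_quadratic[OF conf f g]
    by (simp only: M_def N_def a_def b_def c_def J_def)
  have smult_smult: "x \<cdot>\<^sub>m (y \<cdot>\<^sub>m A) = (x * y) \<cdot>\<^sub>m A" for x y :: rat and A
    by auto
  have MJ: "M * J = \<kappa>\<^sup>2 \<cdot>\<^sub>m J"
    by (simp add: M_def assoc_mult_mat[OF N NT J] NTJ mult_smult_distrib[OF N J] NJ
        smult_smult power2_eq_square)
  \<comment> \<open>From M^2 - a M - c J = b I and M J = \<kappa>^2 J, the matrix M can be factored
    out on the left; \<open>Y\<close> is the remaining factor.\<close>
  define Y where "Y = M + ((- a) \<cdot>\<^sub>m 1\<^sub>m v + (- c / \<kappa>\<^sup>2) \<cdot>\<^sub>m J)"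
  have Y [simp]: "Y \<in> carrier_mat v v" by (simp add: Y_def)
  have "M * Y = M * M + ((- a) \<cdot>\<^sub>m M + (- c) \<cdot>\<^sub>m J)"
    unfolding Y_def using \<open>\<kappa> \<noteq> 0\<close>
    by (simp add: mult_add_distrib_mat[where nr = v and n = v and nc = v]
        mult_smult_distrib[where nr = v and n = v and nc = v] MJ smult_smult
        right_mult_one_mat[OF M])
  also have "\<dots> = b \<cdot>\<^sub>m 1\<^sub>m v"
    unfolding quad using carrier_matD[OF M] carrier_matD[OF J] by (intro eq_matI) auto
  finally have MY: "M * Y = b \<cdot>\<^sub>m 1\<^sub>m v" .
  define Ninv where "Ninv = inverse b \<cdot>\<^sub>m (transpose_mat N * Y)"
  have NTY [simp]: "transpose_mat N * Y \<in> carrier_mat v v" by (rule mult_carrier_mat[OF NT Y])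
  have Ninv [simp]: "Ninv \<in> carrier_mat v v" by (simp add: Ninv_def)
  have "N * Ninv = 1\<^sub>m v"
    using \<open>b \<noteq> 0\<close> MY
    unfolding Ninv_def mult_smult_distrib[OF N NTY] assoc_mult_mat[OF N NT Y, symmetric]
      M_def[symmetric] by (auto simp: smult_smult)
  then have Ninv_N: "Ninv * N = 1\<^sub>m v"
    by (rule mat_mult_left_right_inverse[OF N Ninv])
  define W where "W = a \<cdot>\<^sub>m M' + b \<cdot>\<^sub>m 1\<^sub>m v + c \<cdot>\<^sub>m J"
  have W [simp]: "W \<in> carrier_mat v v" by (simp add: W_def)
  have NM': "N * M' = M * N"
    unfolding M_def M'_def by (rule assoc_mult_mat[OF N NT N, symmetric])
  have M'M' [simp]: "M' * M' \<in> carrier_mat v v" by (rule mult_carrier_mat[OF M' M'])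
  have MN [simp]: "M * N \<in> carrier_mat v v" by (rule mult_carrier_mat[OF M N])
  \<comment> \<open>Moving N through the quadratic equation for \<open>M\<close> yields the one for
    \<open>M'\<close> with N in front; \<open>Ninv\<close> then cancels it.\<close>
  have "N * (M' * M') = (M * M) * N"
    unfolding assoc_mult_mat[OF N M' M', symmetric] NM' assoc_mult_mat[OF M N M']
    by (rule assoc_mult_mat[OF M M N, symmetric])
  also have "\<dots> = a \<cdot>\<^sub>m (M * N) + b \<cdot>\<^sub>m N + c \<cdot>\<^sub>m (J * N)"
    unfolding quad
    by (simp add: add_mult_distrib_mat[where nr = v and n = v and nc = v]
        mult_smult_assoc_mat[where nr = v and n = v and nc = v] left_mult_one_mat[OF N])
  also have "\<dots> = N * W"
    unfolding W_def
    by (simp add: mult_add_distrib_mat[where nr = v and n = v and nc = v]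
        mult_smult_distrib[where nr = v and n = v and nc = v] NM' NJ JN
        right_mult_one_mat[OF N])
  finally have "Ninv * (N * (M' * M')) = Ninv * (N * W)" by simp
  then have "M' * M' = W"
    unfolding assoc_mult_mat[OF Ninv N M'M', symmetric] assoc_mult_mat[OF Ninv N W, symmetric] Ninv_N
      left_mult_one_mat[OF M'M'] left_mult_one_mat[OF W] .
  then have "strongly_regular_graph (points (dual S)) (point_graph_adj (dual S)) v (k * (k - 1)) lam mu"
    using strongly_regular_iff_gram_quadratic[OF dconf, of g f lam mu] f g
    by (simp add: incidence_mat_dual N_def[symmetric] M'_def[symmetric] W_def J_def
        a_def b_def c_def)
  then show ?thesis
    using dconf by (simp add: strongly_regular_configuration_def)
qed

section \<open>Replacing a set of lines\<close>

text \<open>By \<open>joined\<close> the point graph stays the same, so strong regularity is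
  inherited; the other conditions keep the structure a symmetric configuration. The new lines may be
  objects of another kind, since incidence is compared only through these counts.\<close>

lemma strongly_regular_configuration_replace_lines:
  assumes S: "strongly_regular_configuration S v k lam mu"
    and pts: "points T = points S"
    and lines: "lines S = K \<union> R" "lines T = K \<union> R'" "K \<inter> R = {}" "K \<inter> R' = {}"
    and card_eq: "card R' = card R" and fin: "finite R'"
    and same: "\<And>P l. P \<in> points S \<Longrightarrow> l \<in> K \<Longrightarrow> incident T P l \<longleftrightarrow> incident S P l"
    and line: "\<And>l. l \<in> R' \<Longrightarrow> card {P\<in>points S. incident T P l} = k"
    and pencil: "\<And>P. P \<in> points S \<Longrightarrow>
      card {l\<in>R'. incident T P l} = card {l\<in>R. incident S P l}"
    and joined: "\<And>P Q. P \<in> points S \<Longrightarrow> Q \<in> points S \<Longrightarrow> P \<noteq> Q \<Longrightarrow>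
      (\<exists>l\<in>R'. incident T P l \<and> incident T Q l) \<longleftrightarrow> (\<exists>l\<in>R. incident S P l \<and> incident S Q l)"
    and unique: "\<And>P Q l m. P \<in> points S \<Longrightarrow> Q \<in> points S \<Longrightarrow> P \<noteq> Q \<Longrightarrow> l \<in> R' \<Longrightarrow> m \<in> R' \<Longrightarrow>
      incident T P l \<Longrightarrow> incident T Q l \<Longrightarrow> incident T P m \<Longrightarrow> incident T Q m \<Longrightarrow> l = m"
  shows "strongly_regular_configuration T v k lam mu"
    and "\<And>P Q. P \<in> points S \<Longrightarrow> Q \<in> points S \<Longrightarrow> P \<noteq> Q \<Longrightarrow> collinear T P Q \<longleftrightarrow> collinear S P Q"
proof -
  have conf: "symmetric_configuration S v k"
    using S by (simp add: strongly_regular_configuration_def)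
  have finKR: "finite K" "finite R" and cardL: "card (lines S) = v"
    using conf lines(1) by (auto simp: configuration_def)
  show col: "collinear T P Q \<longleftrightarrow> collinear S P Q"
    if "P \<in> points S" "Q \<in> points S" "P \<noteq> Q" for P Q
    using joined[OF that] same that(1,2) lines(1,2) unfolding collinear_def by (metis UnE UnI1 UnI2)
  then have adj: "point_graph_adj T = point_graph_adj S"
    by (intro ext) (auto simp: point_graph_adj_def pts)
  have "card (lines T) = v"
    using cardL lines card_eq fin finKR by (simp add: card_Un_disjoint)
  moreover have "card {P\<in>points T. incident T P l} = k" if "l \<in> lines T" for l
  proof (cases "l \<in> R'")
    case True
    then show ?thesis using line pts by simp
  next
    case False
    then have "{P\<in>points T. incident T P l} = {P\<in>points S. incident S P l}"
      using that lines(2) same pts by auto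
    moreover have "l \<in> lines S" using False that lines by auto
    ultimately show ?thesis using conf by (simp add: configuration_def)
  qed
  moreover have "card {l\<in>lines T. incident T P l} = k" if "P \<in> points T" for P
  proof -
    have P: "P \<in> points S" using that pts by simp
    have "{l\<in>lines T. incident T P l} = {l\<in>K. incident S P l} \<union> {l\<in>R'. incident T P l}"
      using same[OF P] lines(2) by auto
    also have "card \<dots> = card {l\<in>K. incident S P l} + card {l\<in>R'. incident T P l}"
      using fin finKR lines(4) by (intro card_Un_disjoint) auto
    also have "\<dots> = card {l\<in>K. incident S P l} + card {l\<in>R. incident S P l}"
      using pencil[OF P] by simp
    also have "\<dots> = card ({l\<in>K. incident S P l} \<union> {l\<in>R. incident S P l})"
      using finKR lines(3) by (intro card_Un_disjoint[symmetric]) auto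
    also have "{l\<in>K. incident S P l} \<union> {l\<in>R. incident S P l} = {l\<in>lines S. incident S P l}"
      using lines(1) by auto
    also have "card \<dots> = k" using conf P by (simp add: configuration_def)
    finally show ?thesis .
  qed
  moreover have "l = m"
    if PQ: "P \<in> points T" "Q \<in> points T" "P \<noteq> Q" and lm: "l \<in> lines T" "m \<in> lines T"
      and inc: "incident T P l \<and> incident T Q l \<and> incident T P m \<and> incident T Q m" for P Q l m
  proof -
    have PS: "P \<in> points S" "Q \<in> points S" using PQ pts by auto
    note uniq = configuration_unique_line[OF conf PS PQ(3)]
    \<comment> \<open>A pair of points on a new line was already joined by some line of
      \<open>R\<close>. A kept line through the same pair would be a second line of \<open>S\<close>
      joining it.\<close>
    have mixed: False if xy: "x \<in> K" "y \<in> R'" "incident T P x" "incident T Q x"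
      "incident T P y" "incident T Q y" for x y
    proof -
      obtain z where "z \<in> R" "incident S P z" "incident S Q z"
        using joined[OF PS PQ(3)] xy by blast
      moreover from this have "x = z"
        using xy same PS lines(1) by (intro uniq) auto
      ultimately show False using xy(1) lines(3) by auto
    qed
    consider "l \<in> K" "m \<in> K" | "l \<in> K" "m \<in> R'" | "l \<in> R'" "m \<in> K" | "l \<in> R'" "m \<in> R'"
      using lm lines(2) by auto
    then show ?thesis
    proof cases
      case 1
      then show ?thesis using inc same PS lines(1) by (intro uniq) auto
    next
      case 4
      then show ?thesis using inc unique[OF PS PQ(3)] by blast
    qed (use mixed inc in blast)+
  qed
  moreover have "finite (points T) \<and> card (points T) = v" "finite (lines T)"
    using conf finKR fin lines pts by (auto simp: configuration_def)
  ultimately have "symmetric_configuration T v k"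
    unfolding configuration_def by simp
  then show "strongly_regular_configuration T v k lam mu"
    using S by (simp add: strongly_regular_configuration_def adj pts)
qed

section \<open>Isomorphism invariants\<close>

lemma isomorphic_sym:
  assumes "isomorphic S T"
  shows "isomorphic T S"
proof -
  obtain f g where f: "bij_betw f (points S) (points T)" and g: "bij_betw g (lines S) (lines T)"
    and inc: "\<forall>P\<in>points S. \<forall>l\<in>lines S. incident S P l \<longleftrightarrow> incident T (f P) (g l)"
    using assms by (auto simp: isomorphic_def)
  let ?f = "inv_into (points S) f" and ?g = "inv_into (lines S) g"
  have "incident T Q m \<longleftrightarrow> incident S (?f Q) (?g m)" if "Q \<in> points T" "m \<in> lines T" for Q m
    using inc that bij_betwE[OF bij_betw_inv_into[OF f]] bij_betwE[OF bij_betw_inv_into[OF g]]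
      bij_betw_inv_into_right[OF f] bij_betw_inv_into_right[OF g] by metis
  then show ?thesis
    using bij_betw_inv_into[OF f] bij_betw_inv_into[OF g] unfolding isomorphic_def by blast
qed

text \<open>The extreme case of the number occurring in the definition of a semipartial geometry.\<close>

definition full :: "('p, 'l) incidence_structure \<Rightarrow> 'p \<Rightarrow> 'l \<Rightarrow> bool" where
  "full S P l \<longleftrightarrow> P \<in> points S \<and> l \<in> lines S \<and> \<not> incident S P l \<and>
     (\<forall>Q\<in>points S. incident S Q l \<longrightarrow> collinear S P Q)"

definition full_lines_meet :: "('p, 'l) incidence_structure \<Rightarrow> bool" where
  "full_lines_meet S \<longleftrightarrow> (\<forall>P l Q m. full S P l \<and> full S Q m \<longrightarrow>
     (\<exists>R\<in>points S. incident S R l \<and> incident S R m))"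

definition full_points_collinear :: "('p, 'l) incidence_structure \<Rightarrow> bool" where
  "full_points_collinear S \<longleftrightarrow> (\<forall>P l Q m. full S P l \<and> full S Q m \<longrightarrow> collinear S P Q)"

lemma isomorphic_full_invariants:
  assumes "isomorphic S T"
  shows "(\<exists>P l. full S P l) \<longleftrightarrow> (\<exists>P l. full T P l)"
    and "full_lines_meet S \<longleftrightarrow> full_lines_meet T"
    and "full_points_collinear S \<longleftrightarrow> full_points_collinear T"
proof -
  \<comment> \<open>Only one direction of each equivalence, but for arbitrary structures: it is
    applied to the isomorphism and to its inverse.\<close>
  have *: "((\<exists>P l. full S P l) \<longrightarrow> (\<exists>P l. full T P l)) \<and>
      (full_lines_meet T \<longrightarrow> full_lines_meet S) \<and>
      (full_points_collinear T \<longrightarrow> full_points_collinear S)"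
    if iso: "isomorphic S T" for S :: "('p, 'l) incidence_structure"
      and T :: "('r, 's) incidence_structure"
  proof -
    obtain f g where f: "bij_betw f (points S) (points T)" and g: "bij_betw g (lines S) (lines T)"
      and inc: "\<And>P l. P \<in> points S \<Longrightarrow> l \<in> lines S \<Longrightarrow> incident S P l \<longleftrightarrow> incident T (f P) (g l)"
      using iso by (auto simp: isomorphic_def)
    have pT: "points T = f ` points S" and lT: "lines T = g ` lines S"
      using f g by (auto simp: bij_betw_def)
    have col: "collinear T (f P) (f Q) \<longleftrightarrow> collinear S P Q"
      if "P \<in> points S" "Q \<in> points S" for P Q
      using inc that by (auto simp: collinear_def lT)
    have full: "full T (f P) (g l)" if "full S P l" for P l
      using that inc col by (auto simp: full_def pT lT)
    have "full_lines_meet S" if meet: "full_lines_meet T"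
      unfolding full_lines_meet_def
    proof (intro allI impI, elim conjE)
      fix P l Q m assume PlQm: "full S P l" "full S Q m"
      then obtain R where "R \<in> points T" "incident T R (g l)" "incident T R (g m)"
        using meet full unfolding full_lines_meet_def by blast
      then show "\<exists>R\<in>points S. incident S R l \<and> incident S R m"
        using PlQm inc by (auto simp: pT full_def)
    qed
    moreover have "full_points_collinear S" if "full_points_collinear T"
      unfolding full_points_collinear_def
      using that full col unfolding full_points_collinear_def by (meson full_def)
    ultimately show ?thesis using full by blast
  qed
  show "(\<exists>P l. full S P l) \<longleftrightarrow> (\<exists>P l. full T P l)"
    and "full_lines_meet S \<longleftrightarrow> full_lines_meet T"
    and "full_points_collinear S \<longleftrightarrow> full_points_collinear T"
    using *[OF assms] *[OF isomorphic_sym[OF assms]] by blast+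
qed

text \<open>The full antiflag forces \<alpha> = k and the antiflag \<open>(Q, m)\<close> forces
  \<alpha> = 1.\<close>

lemma full_not_semipartial_geometry:
  assumes S: "symmetric_configuration S v k" and k: "k > 1"
    and full: "full S P l"
    and one: "Q \<in> points S" "m \<in> lines S" "\<not> incident S Q m"
      "card {R\<in>points S. incident S R m \<and> collinear S Q R} = 1"
  shows "\<not> semipartial_geometry S"
proof
  assume "semipartial_geometry S"
  then obtain \<alpha> where \<alpha>: "\<forall>P\<in>points S. \<forall>l\<in>lines S. \<not> incident S P l \<longrightarrow>
      card {Q\<in>points S. incident S Q l \<and> collinear S P Q} \<in> {0, \<alpha>}"
    by (auto simp: semipartial_geometry_def)
  have "{Q\<in>points S. incident S Q l \<and> collinear S P Q} = {Q\<in>points S. incident S Q l}"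
    using full by (auto simp: full_def)
  moreover have "card {Q\<in>points S. incident S Q l} = k"
    using S full by (simp add: configuration_def full_def)
  ultimately have "k \<in> {0, \<alpha>}"
    using bspec[OF bspec[OF \<alpha>], of P l] full by (simp add: full_def)
  moreover have "1 \<in> {0, \<alpha>}"
    using bspec[OF bspec[OF \<alpha>], of Q m] one by simp
  ultimately show False using k by simp
qed

section \<open>Lattices of subspaces\<close>

text \<open>The q-analogue of n, which is the number of points of PG(n-1,q). As a sum it avoids the
  division in (q^n - 1) / (q - 1).\<close>

definition gauss :: "nat \<Rightarrow> nat \<Rightarrow> nat" where
  "gauss q n = (\<Sum>i<n. q ^ i)"

lemma gauss_0 [simp]: "gauss q 0 = 0" and gauss_Suc: "gauss q (Suc n) = gauss q n + q ^ n"
  by (simp_all add: gauss_def)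

lemma gauss_numeral:
  "gauss q 1 = 1" "gauss q 2 = q + 1" "gauss q 3 = q\<^sup>2 + q + 1"
  "gauss q 4 = q ^ 3 + q\<^sup>2 + q + 1" "gauss q 5 = q ^ 4 + q ^ 3 + q\<^sup>2 + q + 1"
  by (simp_all add: gauss_def eval_nat_numeral)

lemma gauss_pos: "n > 0 \<Longrightarrow> gauss q n > 0"
  by (cases n) (simp_all add: gauss_def sum.lessThan_Suc_shift del: sum.lessThan_Suc)

lemma gauss_strict_mono: "q > 0 \<Longrightarrow> m < n \<Longrightarrow> gauss q m < gauss q n"
  by (induction n) (auto simp: gauss_Suc less_Suc_eq intro: trans_less_add1)

lemma double_counting:
  assumes "finite A" "finite B"
    and A: "\<And>a. a \<in> A \<Longrightarrow> card {b\<in>B. R a b} = m"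
    and B: "\<And>b. b \<in> B \<Longrightarrow> card {a\<in>A. R a b} = n"
  shows "card A * m = card B * n"
proof -
  have "card A * m = (\<Sum>a\<in>A. card {b\<in>B. R a b})"
    using A by simp
  also have "\<dots> = (\<Sum>b\<in>B. card {a\<in>A. R a b})"
    using sum_multicount_gen[of A B "\<lambda>a b. R a b" "\<lambda>b. card {a\<in>A. R a b}"] assms by simp
  also have "\<dots> = card B * n"
    using B by simp
  finally show ?thesis .
qed

text \<open>Models the linear subspaces of a 5-dimensional space over a field of order q. The rank
  is the linear dimension, so points, lines, planes and solids of PG(4,q) have ranks 1, 2, 3 and 4.
  Besides the modular law, only the number of covers of an element in an interval is assumed; all
  further counts follow from it by double counting.\<close>

locale subspace_lattice =
  fixes Sub :: "'v set set" and rk :: "'v set \<Rightarrow> nat"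
    and join :: "'v set \<Rightarrow> 'v set \<Rightarrow> 'v set"  (infixl "\<curlyvee>" 65)
    and Z E :: "'v set" and q :: nat
  assumes finite_Sub: "finite Sub" and q_ge_2: "2 \<le> q"
    and inter_Sub [simp]: "U \<in> Sub \<Longrightarrow> W \<in> Sub \<Longrightarrow> U \<inter> W \<in> Sub"
    and join_Sub [simp]: "U \<in> Sub \<Longrightarrow> W \<in> Sub \<Longrightarrow> U \<curlyvee> W \<in> Sub"
    and join_upper1: "U \<in> Sub \<Longrightarrow> W \<in> Sub \<Longrightarrow> U \<subseteq> U \<curlyvee> W"
    and join_upper2: "U \<in> Sub \<Longrightarrow> W \<in> Sub \<Longrightarrow> W \<subseteq> U \<curlyvee> W"
    and join_least: "U \<in> Sub \<Longrightarrow> W \<in> Sub \<Longrightarrow> S \<in> Sub \<Longrightarrow> U \<subseteq> S \<Longrightarrow> W \<subseteq> S \<Longrightarrow> U \<curlyvee> W \<subseteq> S"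
    and modular: "U \<in> Sub \<Longrightarrow> W \<in> Sub \<Longrightarrow> rk (U \<curlyvee> W) + rk (U \<inter> W) = rk U + rk W"
    and Z_Sub [simp]: "Z \<in> Sub" and Z_least: "U \<in> Sub \<Longrightarrow> Z \<subseteq> U" and rk_Z [simp]: "rk Z = 0"
    and E_Sub [simp]: "E \<in> Sub" and E_greatest: "U \<in> Sub \<Longrightarrow> U \<subseteq> E" and rk_E [simp]: "rk E = 5"
    and rk_mono: "U \<in> Sub \<Longrightarrow> W \<in> Sub \<Longrightarrow> U \<subseteq> W \<Longrightarrow> rk U \<le> rk W"
    and rk_eq: "U \<in> Sub \<Longrightarrow> W \<in> Sub \<Longrightarrow> U \<subseteq> W \<Longrightarrow> rk W \<le> rk U \<Longrightarrow> U = W"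
    and card_atoms: "U \<in> Sub \<Longrightarrow> W \<in> Sub \<Longrightarrow> U \<subseteq> W \<Longrightarrow>
      card {S\<in>Sub. U \<subseteq> S \<and> S \<subseteq> W \<and> rk S = Suc (rk U)} = gauss q (rk W - rk U)"
begin

definition G :: "nat \<Rightarrow> 'v set set" where
  "G d = {U\<in>Sub. rk U = d}"

lemma G_iff: "U \<in> G d \<longleftrightarrow> U \<in> Sub \<and> rk U = d"
  by (simp add: G_def)

lemma G_Sub: "U \<in> G d \<Longrightarrow> U \<in> Sub" and G_rk: "U \<in> G d \<Longrightarrow> rk U = d"
  by (simp_all add: G_def)

lemma finite_G [simp]: "finite (G d)"
  by (simp add: G_def finite_Sub)

lemma rk_le_5: "U \<in> Sub \<Longrightarrow> rk U \<le> 5"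
  using rk_mono[of U E] E_greatest[of U] by simp

lemma join_le_iff:
  "U \<in> Sub \<Longrightarrow> W \<in> Sub \<Longrightarrow> S \<in> Sub \<Longrightarrow> U \<curlyvee> W \<subseteq> S \<longleftrightarrow> U \<subseteq> S \<and> W \<subseteq> S"
  using join_upper1[of U W] join_upper2[of U W] join_least[of U W S] by blast

lemma rk_inter_le: "U \<in> Sub \<Longrightarrow> W \<in> Sub \<Longrightarrow> rk (U \<inter> W) \<le> rk U"
  by (rule rk_mono) auto

lemma rk_inter_less: "U \<in> Sub \<Longrightarrow> W \<in> Sub \<Longrightarrow> \<not> U \<subseteq> W \<Longrightarrow> rk (U \<inter> W) < rk U"
  using rk_inter_le[of U W] rk_eq[of "U \<inter> W" U] by force

lemma rk_join_greater: "U \<in> Sub \<Longrightarrow> W \<in> Sub \<Longrightarrow> \<not> W \<subseteq> U \<Longrightarrow> rk U < rk (U \<curlyvee> W)"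
  using modular[of U W] rk_inter_less[of W U] by (simp add: Int_commute)

lemma rk_inter_distinct:
  "U \<in> Sub \<Longrightarrow> W \<in> Sub \<Longrightarrow> rk U = rk W \<Longrightarrow> U \<noteq> W \<Longrightarrow> rk (U \<inter> W) < rk U"
  using rk_inter_less[of U W] rk_eq[of U W] by auto

lemma rk_join_atom: "U \<in> Sub \<Longrightarrow> a \<in> G 1 \<Longrightarrow> \<not> a \<subseteq> U \<Longrightarrow> rk (U \<curlyvee> a) = Suc (rk U)"
  using modular[of U a] rk_inter_less[of a U] by (simp add: Int_commute G_iff)

text \<open>The exchange property: one of the two joins contains the other and both have rank one
  more than \<open>U\<close>, so they coincide.\<close>

lemma atom_join_exchange:
  assumes U: "U \<in> Sub" and a: "a \<in> G 1" and b: "b \<in> G 1" "\<not> b \<subseteq> U" "b \<subseteq> U \<curlyvee> a"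
  shows "a \<subseteq> U \<curlyvee> b"
proof -
  have "\<not> a \<subseteq> U" using b U a join_least[of U a U] by (auto simp: G_iff)
  then have "rk (U \<curlyvee> a) = rk (U \<curlyvee> b)" using rk_join_atom U a b by simp
  moreover have "U \<curlyvee> b \<subseteq> U \<curlyvee> a"
    using U a b join_upper1[of U a] by (intro join_least) (auto simp: G_iff)
  ultimately have "U \<curlyvee> b = U \<curlyvee> a"
    using U a b by (intro rk_eq) (auto simp: G_iff)
  then show ?thesis using join_upper2[of U a] U a by (auto simp: G_iff)
qed

lemma ex_between:
  assumes "U \<in> Sub" "W \<in> Sub" "U \<subseteq> W" "rk U \<le> d" "d \<le> rk W"
  shows "\<exists>S\<in>G d. U \<subseteq> S \<and> S \<subseteq> W"
  using assms(4,5)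
proof (induction d rule: dec_induct)
  case base
  then show ?case using assms by (auto simp: G_iff)
next
  case (step n)
  then obtain S where S: "S \<in> Sub" "rk S = n" "U \<subseteq> S" "S \<subseteq> W"
    by (auto simp: G_iff)
  have "card {T\<in>Sub. S \<subseteq> T \<and> T \<subseteq> W \<and> rk T = Suc (rk S)} \<noteq> 0"
    using card_atoms[OF S(1) assms(2) S(4)] gauss_pos[of "rk W - rk S" q] S(2) step.prems by simp
  then obtain T where "T \<in> Sub" "S \<subseteq> T" "T \<subseteq> W" "rk T = Suc (rk S)"
    by (metis (mono_tags, lifting) card.empty empty_Collect_eq)
  then show ?case using S by (intro bexI[of _ T]) (auto simp: G_iff)
qed

lemma card_points_in: "U \<in> Sub \<Longrightarrow> card {a\<in>G 1. a \<subseteq> U} = gauss q (rk U)"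
  using card_atoms[of Z U] Z_least by (simp add: G_def conj_commute conj_left_commute cong: conj_cong)

lemma card_above:
  "U \<in> G d \<Longrightarrow> W \<in> Sub \<Longrightarrow> U \<subseteq> W \<Longrightarrow>
    card {S\<in>G (Suc d). U \<subseteq> S \<and> S \<subseteq> W} = gauss q (rk W - d)"
  using card_atoms[of U W] by (simp add: G_def conj_commute conj_left_commute cong: conj_cong)

text \<open>The axiom counts only the covers of \<open>U\<close>; this is the dual count. In the
  induction step the pairs of a cover \<open>a\<close> of \<open>U\<close> and a hyperplane
  \<open>S\<close> of \<open>W\<close> with \<open>a \<subseteq> S\<close> are counted twice. Each
  \<open>a\<close> lies in \<open>gauss q (d - rk U)\<close> such \<open>S\<close> by the induction
  hypothesis, and each \<open>S\<close> contains equally many \<open>a\<close> by the axiom.\<close>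

lemma card_below:
  assumes "U \<in> Sub" "W \<in> G (Suc d)" "U \<subseteq> W" "rk U \<le> d"
  shows "card {S\<in>G d. U \<subseteq> S \<and> S \<subseteq> W} = gauss q (Suc d - rk U)"
  using assms
proof (induction "d - rk U" arbitrary: U)
  case 0
  then have "S = U" if "S \<in> G d" "U \<subseteq> S" for S
    using rk_eq[of U S] that by (simp add: G_iff)
  then have "{S\<in>G d. U \<subseteq> S \<and> S \<subseteq> W} = {U}"
    using 0 by (auto simp: G_iff)
  moreover have "Suc d - rk U = 1" using 0 by simp
  ultimately show ?case by (simp add: gauss_numeral(1)[unfolded One_nat_def])
next
  case (Suc n)
  have W: "W \<in> Sub" "rk W = Suc d" using Suc.prems by (auto simp: G_iff)
  let ?A = "{a\<in>Sub. U \<subseteq> a \<and> a \<subseteq> W \<and> rk a = Suc (rk U)}"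
  let ?B = "{S\<in>G d. U \<subseteq> S \<and> S \<subseteq> W}"
  have "card ?A * gauss q (Suc n) = card ?B * gauss q (Suc n)"
  proof (rule double_counting)
    fix a assume a: "a \<in> ?A"
    then have "{S\<in>?B. a \<subseteq> S} = {S\<in>G d. a \<subseteq> S \<and> S \<subseteq> W}" by auto
    moreover have "Suc d - rk a = Suc n" using a Suc.hyps(2) Suc.prems by simp
    ultimately show "card {S\<in>?B. a \<subseteq> S} = gauss q (Suc n)"
      using Suc.hyps(1)[of a] Suc.prems a Suc.hyps(2) by simp
  next
    fix S assume S: "S \<in> ?B"
    then have "{a\<in>?A. a \<subseteq> S} = {a\<in>Sub. U \<subseteq> a \<and> a \<subseteq> S \<and> rk a = Suc (rk U)}" by auto
    moreover have "rk S - rk U = Suc n" using S Suc.hyps(2) by (simp add: G_iff)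
    ultimately show "card {a\<in>?A. a \<subseteq> S} = gauss q (Suc n)"
      using card_atoms[of U S] Suc.prems S by (simp add: G_iff)
  qed (use finite_Sub in auto)
  then have "card ?B = card ?A" using gauss_pos[of "Suc n" q] by simp
  then show ?case using card_atoms[OF Suc.prems(1) W(1) Suc.prems(3)] W(2) by simp
qed

lemma ex_point_avoiding:
  assumes S: "S \<in> Sub" and U: "U \<in> Sub" "\<not> S \<subseteq> U"
  shows "\<exists>a\<in>G 1. a \<subseteq> S \<and> \<not> a \<subseteq> U"
proof (rule ccontr)
  assume "\<not> ?thesis"
  then have "{a\<in>G 1. a \<subseteq> S} = {a\<in>G 1. a \<subseteq> S \<inter> U}" by auto
  then have "gauss q (rk S) = gauss q (rk (S \<inter> U))"
    using card_points_in[of S] card_points_in[of "S \<inter> U"] S U by simp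
  then show False
    using gauss_strict_mono[of q "rk (S \<inter> U)" "rk S"] rk_inter_less[OF S U] q_ge_2 by simp
qed

text \<open>No subspace is a union of two proper subspaces: if a point outside \<open>U\<close> lies
  in \<open>W\<close> and a point outside \<open>W\<close> lies in \<open>U\<close>, a third point
  of the line joining them avoids both. It exists because a line has q + 1 \<ge> 3 points.\<close>

lemma ex_point_avoiding2:
  assumes S: "S \<in> Sub" and U: "U \<in> Sub" "\<not> S \<subseteq> U" and W: "W \<in> Sub" "\<not> S \<subseteq> W"
  shows "\<exists>a\<in>G 1. a \<subseteq> S \<and> \<not> a \<subseteq> U \<and> \<not> a \<subseteq> W"
proof (rule ccontr)
  assume no: "\<not> ?thesis"
  obtain a where a: "a \<in> G 1" "a \<subseteq> S" "\<not> a \<subseteq> U" using ex_point_avoiding[OF S U] by blast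
  obtain b where b: "b \<in> G 1" "b \<subseteq> S" "\<not> b \<subseteq> W" using ex_point_avoiding[OF S W] by blast
  have "a \<subseteq> W" "b \<subseteq> U" using no a b by blast+
  have "\<not> b \<subseteq> a" using b \<open>a \<subseteq> W\<close> by blast
  then have "rk (a \<curlyvee> b) = 2" using rk_join_atom[of a b] a b by (simp add: G_iff)
  then have "card {c\<in>G 1. c \<subseteq> a \<curlyvee> b} = q + 1"
    using card_points_in[of "a \<curlyvee> b"] a b by (simp add: G_iff gauss_numeral)
  then have "\<not> {c\<in>G 1. c \<subseteq> a \<curlyvee> b} \<subseteq> {a, b}"
    using card_mono[of "{a, b}" "{c\<in>G 1. c \<subseteq> a \<curlyvee> b}"] card_insert_le_m1[of 2 "{b}" a] q_ge_2 by force
  then obtain c where c: "c \<in> G 1" "c \<subseteq> a \<curlyvee> b" "c \<noteq> a" "c \<noteq> b" by blast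
  have sub: "a \<in> Sub" "b \<in> Sub" "c \<in> Sub" using a b c by (auto simp: G_iff)
  have "c \<subseteq> S" using c(2) join_least[OF sub(1,2) S a(2) b(2)] by blast
  have "\<not> c \<subseteq> a" "\<not> c \<subseteq> b" using c a b rk_eq[of c a] rk_eq[of c b] by (auto simp: G_iff)
  then have "b \<subseteq> a \<curlyvee> c" "a \<subseteq> b \<curlyvee> c"
    using atom_join_exchange[of a b c] atom_join_exchange[of b a c] a b c sub
      join_least[of a b "b \<curlyvee> a"] join_upper1[of b a] join_upper2[of b a] by auto
  then have "\<not> c \<subseteq> W" "\<not> c \<subseteq> U"
    using \<open>a \<subseteq> W\<close> \<open>b \<subseteq> U\<close> join_least[of a c W] join_least[of b c U] sub U W a b by blast+
  then show False using no c \<open>c \<subseteq> S\<close> by blast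
qed

text \<open>Flags of a point and a line give the number of lines, after cancelling q + 1. For flags
  of a line and a plane both multiplicities are \<open>gauss q 3\<close>, so there are as many
  planes as lines.\<close>

lemma card_lines_planes:
  "card (G 2) = (q\<^sup>2 + 1) * (q ^ 4 + q ^ 3 + q\<^sup>2 + q + 1)" "card (G 3) = card (G 2)"
proof -
  have "card (G 1) * gauss q 4 = card (G 2) * gauss q 2"
  proof (rule double_counting)
    fix a assume "a \<in> G 1"
    then show "card {l\<in>G 2. a \<subseteq> l} = gauss q 4"
      using card_above[of a 1 E] E_greatest by (simp add: numeral_2_eq_2 G_Sub cong: conj_cong)
  next
    fix l assume "l \<in> G 2"
    then show "card {a\<in>G 1. a \<subseteq> l} = gauss q 2"
      using card_points_in[of l] by (simp add: G_iff)
  qed auto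
  moreover have "card (G 1) = gauss q 5"
    using card_points_in[of E] E_greatest by (simp add: G_Sub cong: conj_cong)
  ultimately have "card (G 2) * (q + 1) = (q ^ 4 + q ^ 3 + q\<^sup>2 + q + 1) * (q ^ 3 + q\<^sup>2 + q + 1)"
    by (simp add: gauss_numeral)
  also have "q ^ 3 + q\<^sup>2 + q + 1 = (q\<^sup>2 + 1) * (q + 1)"
    by (simp add: algebra_simps power2_eq_square power3_eq_cube)
  finally have "card (G 2) * (q + 1) =
      ((q\<^sup>2 + 1) * (q ^ 4 + q ^ 3 + q\<^sup>2 + q + 1)) * (q + 1)"
    by (simp only: ac_simps)
  then show "card (G 2) = (q\<^sup>2 + 1) * (q ^ 4 + q ^ 3 + q\<^sup>2 + q + 1)"
    by (simp only: mult_cancel2) simp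
  have "card (G 2) * gauss q 3 = card (G 3) * gauss q 3"
  proof (rule double_counting)
    fix l assume "l \<in> G 2"
    then show "card {p\<in>G 3. l \<subseteq> p} = gauss q 3"
      using card_above[of l 2 E] E_greatest by (simp add: numeral_3_eq_3 numeral_2_eq_2 G_Sub cong: conj_cong)
  next
    fix p assume "p \<in> G 3"
    then show "card {l\<in>G 2. l \<subseteq> p} = gauss q 3"
      using card_below[of Z p 2] Z_least by (simp add: numeral_3_eq_3 G_Sub cong: conj_cong)
  qed auto
  then show "card (G 3) = card (G 2)" using gauss_pos[of 3 q] by simp
qed

end

section \<open>The geometry \<open>LP(4, q)\<close>\<close>

context subspace_lattice
begin

definition C0 :: "('v set, 'v set) incidence_structure" where
  "C0 = \<lparr>points = G 2, lines = G 3, incident = (\<subseteq>)\<rparr>"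

lemma C0_simps [simp]: "points C0 = G 2" "lines C0 = G 3" "incident C0 = (\<subseteq>)"
  by (simp_all add: C0_def)

text \<open>By the modular law the join has rank 4 minus the rank of the intersection, so it fits
  into a plane iff the lines meet.\<close>

lemma C0_collinear_iff:
  assumes "U \<in> G 2" "W \<in> G 2"
  shows "collinear C0 U W \<longleftrightarrow> rk (U \<inter> W) \<ge> 1"
proof -
  have UW: "U \<in> Sub" "W \<in> Sub" "rk U = 2" "rk W = 2" using assms by (auto simp: G_iff)
  have m: "rk (U \<curlyvee> W) + rk (U \<inter> W) = 4" using modular[of U W] UW by simp
  show ?thesis
  proof
    assume "collinear C0 U W"
    then obtain p where p: "p \<in> Sub" "rk p = 3" "U \<subseteq> p" "W \<subseteq> p"
      by (auto simp: collinear_def G_iff)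
    then have "rk (U \<curlyvee> W) \<le> 3" using rk_mono[of "U \<curlyvee> W" p] join_least UW by simp
    then show "rk (U \<inter> W) \<ge> 1" using m by simp
  next
    assume "rk (U \<inter> W) \<ge> 1"
    then have "\<exists>p\<in>G 3. U \<curlyvee> W \<subseteq> p \<and> p \<subseteq> E"
      using m UW E_greatest by (intro ex_between) auto
    then show "collinear C0 U W" using UW by (auto simp: collinear_def join_le_iff G_iff)
  qed
qed

lemma C0_configuration: "symmetric_configuration C0 (card (G 2)) (q\<^sup>2 + q + 1)"
proof -
  have on_line: "card {P\<in>G 2. P \<subseteq> l} = q\<^sup>2 + q + 1" if "l \<in> G 3" for l
    using card_below[of Z l 2] Z_least that
    by (simp add: numeral_3_eq_3[symmetric] G_Sub gauss_numeral cong: conj_cong)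
  have on_point: "card {l\<in>G 3. P \<subseteq> l} = q\<^sup>2 + q + 1" if "P \<in> G 2" for P
    using card_above[of P 2 E] E_greatest that
    by (simp add: numeral_3_eq_3[symmetric] G_Sub gauss_numeral cong: conj_cong)
  have unique: "l = m"
    if "P \<in> G 2" "Q \<in> G 2" "P \<noteq> Q" "l \<in> G 3" "m \<in> G 3" "P \<subseteq> l" "Q \<subseteq> l" "P \<subseteq> m" "Q \<subseteq> m"
    for P Q l m
  proof (rule ccontr)
    assume "l \<noteq> m"
    then have "rk (l \<inter> m) \<le> 2" using rk_inter_distinct[of l m] that by (simp add: G_iff)
    then have "P = l \<inter> m" "Q = l \<inter> m" using that by (intro rk_eq; auto simp: G_iff)+
    then show False using \<open>P \<noteq> Q\<close> by simp
  qed
  show ?thesis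
    unfolding configuration_def C0_simps
    by (intro conjI ballI impI; (elim conjE)?; (rule unique; assumption)?)
      (simp_all add: on_line on_point card_lines_planes(2))
qed

text \<open>A line meets both of two intersecting lines iff it passes through their common point or
  lies in their common plane. There are \<open>gauss q 4\<close> lines of the first kind,
  \<open>gauss q 3\<close> of the second and \<open>gauss q 2\<close> of both; \<open>U\<close> and
  \<open>W\<close> themselves are removed, whence the final -2.\<close>

lemma C0_lambda:
  assumes U: "U \<in> G 2" and W: "W \<in> G 2" and adj: "point_graph_adj C0 U W"
  shows "card {S\<in>G 2. point_graph_adj C0 U S \<and> point_graph_adj C0 W S} = q ^ 3 + 2 * q\<^sup>2 + q - 1"
proof -
  have UW: "U \<in> Sub" "W \<in> Sub" "rk U = 2" "rk W = 2" using U W by (auto simp: G_iff)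
  have ne: "U \<noteq> W" and "rk (U \<inter> W) \<ge> 1"
    using adj C0_collinear_iff[OF U W] by (auto simp: point_graph_adj_def)
  then have y: "rk (U \<inter> W) = 1" using rk_inter_distinct[of U W] UW by simp
  then have p: "rk (U \<curlyvee> W) = 3" using modular[of U W] UW by simp
  let ?A = "{S\<in>G 2. U \<inter> W \<subseteq> S}" and ?B = "{S\<in>G 2. S \<subseteq> U \<curlyvee> W}"
  have "{S\<in>G 2. point_graph_adj C0 U S \<and> point_graph_adj C0 W S} = (?A \<union> ?B) - {U, W}"
  proof (intro equalityI subsetI)
    fix S assume "S \<in> {S\<in>G 2. point_graph_adj C0 U S \<and> point_graph_adj C0 W S}"
    then have S: "S \<in> G 2" "S \<noteq> U" "S \<noteq> W" "rk (U \<inter> S) \<ge> 1" "rk (W \<inter> S) \<ge> 1"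
      using C0_collinear_iff U W by (auto simp: point_graph_adj_def)
    have SS: "S \<in> Sub" "rk S = 2" using S by (auto simp: G_iff)
    \<comment> \<open>Off the common point, \<open>S\<close> meets \<open>U\<close> and
      \<open>W\<close> in two distinct points, which span it.\<close>
    have "S \<subseteq> U \<curlyvee> W" if "\<not> U \<inter> W \<subseteq> S"
    proof -
      have a: "rk (U \<inter> S) = 1" "rk (W \<inter> S) = 1"
        using S rk_inter_distinct[of U S] rk_inter_distinct[of W S] UW SS by auto
      have "\<not> W \<inter> S \<subseteq> U \<inter> S"
      proof
        assume "W \<inter> S \<subseteq> U \<inter> S"
        then have "W \<inter> S = U \<inter> W" using a y UW SS by (intro rk_eq) auto
        then show False using that by blast
      qed
      then have "rk ((U \<inter> S) \<curlyvee> (W \<inter> S)) \<ge> 2"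
        using rk_join_greater[of "U \<inter> S" "W \<inter> S"] a UW SS by simp
      then have "(U \<inter> S) \<curlyvee> (W \<inter> S) = S"
        using UW SS by (intro rk_eq) (auto simp: join_le_iff)
      moreover have "(U \<inter> S) \<curlyvee> (W \<inter> S) \<subseteq> U \<curlyvee> W"
        using UW SS join_upper1[of U W] join_upper2[of U W] by (intro join_least) auto
      ultimately show ?thesis by simp
    qed
    then show "S \<in> (?A \<union> ?B) - {U, W}" using S by blast
  next
    fix S assume S: "S \<in> (?A \<union> ?B) - {U, W}"
    then have SS: "S \<in> Sub" "rk S = 2" "S \<in> G 2" by (auto simp: G_iff)
    have "rk (U \<inter> S) \<ge> 1 \<and> rk (W \<inter> S) \<ge> 1"
    proof (cases "U \<inter> W \<subseteq> S")
      case True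
      then show ?thesis
        using rk_mono[of "U \<inter> W" "U \<inter> S"] rk_mono[of "U \<inter> W" "W \<inter> S"] y UW SS by auto
    next
      case False
      then have "S \<subseteq> U \<curlyvee> W" using S by auto
      then have "rk (U \<curlyvee> S) \<le> 3" "rk (W \<curlyvee> S) \<le> 3"
        using rk_mono[of "U \<curlyvee> S" "U \<curlyvee> W"] rk_mono[of "W \<curlyvee> S" "U \<curlyvee> W"] p UW SS
          join_upper1[of U W] join_upper2[of U W] by (auto simp: join_le_iff)
      then show ?thesis using modular[of U S] modular[of W S] UW SS by simp
    qed
    then show "S \<in> {S\<in>G 2. point_graph_adj C0 U S \<and> point_graph_adj C0 W S}"
      using S SS U W C0_collinear_iff by (auto simp: point_graph_adj_def)
  qed
  moreover have "card (?A \<union> ?B - {U, W}) = card (?A \<union> ?B) - 2"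
    using ne U W UW join_upper1[of U W] join_upper2[of U W] by (subst card_Diff_subset) auto
  moreover have "card (?A \<union> ?B) + card (?A \<inter> ?B) = card ?A + card ?B"
    by (rule card_Un_Int[symmetric]) auto
  moreover have "card ?A = gauss q 4"
    using card_above[of "U \<inter> W" 1 E] y UW E_greatest
    by (simp add: G_iff numeral_2_eq_2[symmetric] G_Sub cong: conj_cong)
  moreover have "card ?B = gauss q 3"
    using card_below[of Z "U \<curlyvee> W" 2] p UW Z_least
    by (simp add: G_iff numeral_3_eq_3[symmetric] cong: conj_cong)
  moreover have "?A \<inter> ?B = {S\<in>G 2. U \<inter> W \<subseteq> S \<and> S \<subseteq> U \<curlyvee> W}" by auto
  moreover have "card {S\<in>G 2. U \<inter> W \<subseteq> S \<and> S \<subseteq> U \<curlyvee> W} = gauss q 2"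
    using card_above[of "U \<inter> W" 1 "U \<curlyvee> W"] y p UW join_upper1[of U W]
    by (auto simp: G_iff numeral_2_eq_2[symmetric])
  ultimately show ?thesis by (simp add: gauss_numeral)
qed

text \<open>The transversals of two skew lines correspond to the pairs of one point on each.\<close>

lemma C0_mu:
  assumes U: "U \<in> G 2" and W: "W \<in> G 2" and "\<not> collinear C0 U W"
  shows "card {S\<in>G 2. point_graph_adj C0 U S \<and> point_graph_adj C0 W S} = (q + 1)\<^sup>2"
proof -
  have UW: "U \<in> Sub" "W \<in> Sub" "rk U = 2" "rk W = 2" using U W by (auto simp: G_iff)
  have r0: "rk (U \<inter> W) = 0" using assms(3) C0_collinear_iff[OF U W] by simp
  let ?A = "{a\<in>G 1. a \<subseteq> U} \<times> {b\<in>G 1. b \<subseteq> W}"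
  have "bij_betw (\<lambda>(a, b). a \<curlyvee> b) ?A
      {S\<in>G 2. point_graph_adj C0 U S \<and> point_graph_adj C0 W S}"
  proof (rule bij_betw_byWitness[where f' = "\<lambda>S. (U \<inter> S, W \<inter> S)"])
    have join: "a \<curlyvee> b \<in> G 2 \<and> U \<inter> (a \<curlyvee> b) = a \<and> W \<inter> (a \<curlyvee> b) = b \<and>
        U \<noteq> a \<curlyvee> b \<and> W \<noteq> a \<curlyvee> b" if "(a, b) \<in> ?A" for a b
    proof -
      have ab: "a \<in> Sub" "b \<in> Sub" "rk a = 1" "rk b = 1" "a \<in> G 1" "b \<in> G 1" "a \<subseteq> U" "b \<subseteq> W"
        using that by (auto simp: G_iff)
      have nU: "\<not> b \<subseteq> U" and nW: "\<not> a \<subseteq> W"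
        using rk_mono[of b "U \<inter> W"] rk_mono[of a "U \<inter> W"] r0 ab UW by auto
      then have "\<not> b \<subseteq> a" using ab by blast
      then have r2: "rk (a \<curlyvee> b) = 2" using rk_join_atom[of a b] ab by simp
      have sub: "a \<subseteq> a \<curlyvee> b" "b \<subseteq> a \<curlyvee> b"
        using join_upper1[of a b] join_upper2[of a b] ab by simp_all
      have ne: "U \<noteq> a \<curlyvee> b" "W \<noteq> a \<curlyvee> b" using nU nW sub by blast+
      have "rk (U \<inter> (a \<curlyvee> b)) \<le> 1" "rk (W \<inter> (a \<curlyvee> b)) \<le> 1"
        using rk_inter_distinct[of U "a \<curlyvee> b"] rk_inter_distinct[of W "a \<curlyvee> b"] ne r2 ab UW
        by auto
      then have "a = U \<inter> (a \<curlyvee> b)" "b = W \<inter> (a \<curlyvee> b)"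
        using ab UW sub by (intro rk_eq; auto)+
      then show ?thesis using r2 ne ab by (auto simp: G_iff)
    qed
    show "\<forall>x\<in>?A. (\<lambda>S. (U \<inter> S, W \<inter> S)) (case x of (a, b) \<Rightarrow> a \<curlyvee> b) = x"
      using join by auto
    show "(\<lambda>(a, b). a \<curlyvee> b) ` ?A \<subseteq> {S\<in>G 2. point_graph_adj C0 U S \<and> point_graph_adj C0 W S}"
    proof (intro subsetI)
      fix S assume "S \<in> (\<lambda>(a, b). a \<curlyvee> b) ` ?A"
      then obtain a b where ab: "(a, b) \<in> ?A" "S = a \<curlyvee> b" by auto
      then show "S \<in> {S\<in>G 2. point_graph_adj C0 U S \<and> point_graph_adj C0 W S}"
        using join[OF ab(1)] U W C0_collinear_iff[of U S] C0_collinear_iff[of W S]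
        by (auto simp: point_graph_adj_def G_rk)
    qed
    have split: "(U \<inter> S, W \<inter> S) \<in> ?A \<and> (U \<inter> S) \<curlyvee> (W \<inter> S) = S"
      if S: "S \<in> G 2" "point_graph_adj C0 U S" "point_graph_adj C0 W S" for S
    proof -
      have SS: "S \<in> Sub" "rk S = 2" using S by (auto simp: G_iff)
      have "rk (U \<inter> S) \<ge> 1" "rk (W \<inter> S) \<ge> 1" "U \<noteq> S" "W \<noteq> S"
        using S U W C0_collinear_iff by (auto simp: point_graph_adj_def)
      then have a: "rk (U \<inter> S) = 1" "rk (W \<inter> S) = 1"
        using rk_inter_distinct[of U S] rk_inter_distinct[of W S] UW SS by auto
      have "\<not> W \<inter> S \<subseteq> U \<inter> S"
        using rk_mono[of "W \<inter> S" "U \<inter> W"] r0 a UW SS by auto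
      then have "rk ((U \<inter> S) \<curlyvee> (W \<inter> S)) \<ge> 2"
        using rk_join_greater[of "U \<inter> S" "W \<inter> S"] a UW SS by simp
      then have "(U \<inter> S) \<curlyvee> (W \<inter> S) = S"
        using UW SS by (intro rk_eq) (auto simp: join_le_iff)
      then show ?thesis using a UW SS by (auto simp: G_iff)
    qed
    show "\<forall>S\<in>{S\<in>G 2. point_graph_adj C0 U S \<and> point_graph_adj C0 W S}.
        (case (U \<inter> S, W \<inter> S) of (a, b) \<Rightarrow> a \<curlyvee> b) = S"
      using split by auto
    show "(\<lambda>S. (U \<inter> S, W \<inter> S)) ` {S\<in>G 2. point_graph_adj C0 U S \<and> point_graph_adj C0 W S} \<subseteq> ?A"
      using split by auto
  qed
  then have "card {S\<in>G 2. point_graph_adj C0 U S \<and> point_graph_adj C0 W S} = card ?A"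
    by (simp only: bij_betw_same_card)
  also have "\<dots> = (q + 1)\<^sup>2"
    using card_points_in[of U] card_points_in[of W] UW
    by (simp add: gauss_numeral power2_eq_square card_cartesian_product)
  finally show ?thesis .
qed

abbreviation "v_par \<equiv> (q\<^sup>2 + 1) * (q ^ 4 + q ^ 3 + q\<^sup>2 + q + 1)"
abbreviation "k_par \<equiv> q\<^sup>2 + q + 1"
abbreviation "lam_par \<equiv> q ^ 3 + 2 * q\<^sup>2 + q - 1"
abbreviation "mu_par \<equiv> (q + 1)\<^sup>2"

lemma C0_strongly_regular: "strongly_regular_configuration C0 v_par k_par lam_par mu_par"
proof -
  have conf: "symmetric_configuration C0 v_par k_par"
    using C0_configuration unfolding card_lines_planes(1) .
  have sym: "point_graph_adj C0 x y \<longleftrightarrow> point_graph_adj C0 y x" for x y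
    by (auto simp: point_graph_adj_def collinear_def)
  have "strongly_regular_graph (G 2) (point_graph_adj C0) v_par (k_par * (k_par - 1)) lam_par mu_par"
    unfolding strongly_regular_graph_def
  proof (intro conjI ballI impI)
    fix x assume "x \<in> G 2"
    then show "card {z\<in>G 2. point_graph_adj C0 x z} = k_par * (k_par - 1)"
      using configuration_degree[OF conf, of x] by simp
    fix y assume "y \<in> G 2" "x \<noteq> y \<and> \<not> point_graph_adj C0 x y"
    with \<open>x \<in> G 2\<close> show "card {z\<in>G 2. point_graph_adj C0 x z \<and> point_graph_adj C0 y z} = mu_par"
      by (intro C0_mu) (auto simp: point_graph_adj_def)
  qed (use sym C0_lambda card_lines_planes(1) in \<open>auto simp: point_graph_adj_def\<close>)
  then show ?thesis using conf by (simp add: strongly_regular_configuration_def)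
qed

text \<open>A line not contained in a plane misses it or meets it in one point. In the second case
  it meets exactly the q + 1 lines of the plane through that point, so \<alpha> = q + 1.\<close>

lemma C0_semipartial_geometry: "semipartial_geometry C0"
proof -
  have "card {Q\<in>G 2. Q \<subseteq> l \<and> collinear C0 P Q} \<in> {0, q + 1}"
    if P: "P \<in> G 2" and l: "l \<in> G 3" and "\<not> P \<subseteq> l" for P l
  proof -
    have PS: "P \<in> Sub" "rk P = 2" "l \<in> Sub" "rk l = 3" using P l by (auto simp: G_iff)
    have "rk (P \<inter> l) \<le> 1" using rk_inter_less[of P l] that PS by simp
    then consider "rk (P \<inter> l) = 0" | "rk (P \<inter> l) = 1" by linarith
    then show ?thesis
    proof cases
      case 1
      have "rk (P \<inter> Q) = 0" if "Q \<in> G 2" "Q \<subseteq> l" for Q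
        using rk_mono[of "P \<inter> Q" "P \<inter> l"] that 1 PS by (auto simp: G_iff)
      then have "{Q\<in>G 2. Q \<subseteq> l \<and> collinear C0 P Q} = {}"
        using C0_collinear_iff[OF P] by fastforce
      then show ?thesis by (simp only: card.empty) simp
    next
      case 2
      have "collinear C0 P Q \<longleftrightarrow> P \<inter> l \<subseteq> Q" if Q: "Q \<in> G 2" "Q \<subseteq> l" for Q
      proof
        have QS: "Q \<in> Sub" using Q by (simp add: G_iff)
        assume "collinear C0 P Q"
        then have "P \<inter> Q = P \<inter> l"
          using C0_collinear_iff[OF P Q(1)] Q 2 PS QS by (intro rk_eq) auto
        then show "P \<inter> l \<subseteq> Q" by blast
      next
        assume "P \<inter> l \<subseteq> Q"
        then have "rk (P \<inter> Q) \<ge> 1"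
          using rk_mono[of "P \<inter> l" "P \<inter> Q"] 2 PS Q by (auto simp: G_iff)
        then show "collinear C0 P Q" using C0_collinear_iff[OF P Q(1)] by simp
      qed
      then have "{Q\<in>G 2. Q \<subseteq> l \<and> collinear C0 P Q} = {Q\<in>G 2. P \<inter> l \<subseteq> Q \<and> Q \<subseteq> l}" by auto
      also have "card \<dots> = q + 1"
        using card_above[of "P \<inter> l" 1 l] 2 PS
        by (simp add: G_iff numeral_2_eq_2[symmetric] gauss_numeral)
      finally show ?thesis by simp
    qed
  qed
  moreover have "card {R\<in>G 2. R \<noteq> P \<and> R \<noteq> Q \<and> collinear C0 P R \<and> collinear C0 Q R} = mu_par"
    if "P \<in> G 2" "Q \<in> G 2" "\<not> collinear C0 P Q" for P Q
  proof -
    have "{R\<in>G 2. R \<noteq> P \<and> R \<noteq> Q \<and> collinear C0 P R \<and> collinear C0 Q R} =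
        {S\<in>G 2. point_graph_adj C0 P S \<and> point_graph_adj C0 Q S}"
      using that by (auto simp: point_graph_adj_def)
    then show ?thesis using C0_mu[OF that] by simp
  qed
  ultimately show ?thesis
    using C0_configuration unfolding semipartial_geometry_def C0_simps by blast
qed

section \<open>Lines of a plane skew to a given line\<close>

lemma ex_line_avoiding:
  assumes p: "p \<in> G 3" and y: "y \<in> Sub" "rk y \<le> 1" "y \<subseteq> p"
  shows "\<exists>m\<in>G 2. m \<subseteq> p \<and> rk (m \<inter> y) = 0"
proof -
  have pS: "p \<in> Sub" "rk p = 3" using p by (auto simp: G_iff)
  obtain a where a: "a \<in> G 1" "a \<subseteq> p" "\<not> a \<subseteq> y"
    using ex_point_avoiding[of p y] rk_mono[of p y] pS y by fastforce
  have aS: "a \<in> Sub" "rk a = 1" using a by (auto simp: G_iff)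
  have rya: "rk (y \<curlyvee> a) = Suc (rk y)" using rk_join_atom[OF y(1) a(1,3)] .
  then obtain b where b: "b \<in> G 1" "b \<subseteq> p" "\<not> b \<subseteq> y \<curlyvee> a"
    using ex_point_avoiding[of p "y \<curlyvee> a"] rk_mono[of p "y \<curlyvee> a"] pS y aS by auto
  have bS: "b \<in> Sub" "rk b = 1" using b by (auto simp: G_iff)
  have "\<not> b \<subseteq> a" using b join_upper2[of y a] y aS by blast
  then have m: "rk (a \<curlyvee> b) = 2" using rk_join_atom[of a b] aS b by simp
  have "rk (y \<curlyvee> a \<curlyvee> b) = Suc (Suc (rk y))" using rk_join_atom[of "y \<curlyvee> a" b] b rya y aS by simp
  moreover have "y \<curlyvee> a \<curlyvee> b \<subseteq> (a \<curlyvee> b) \<curlyvee> y"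
    using y aS bS join_upper1[of "a \<curlyvee> b" y] join_upper2[of "a \<curlyvee> b" y] join_upper1[of a b] join_upper2[of a b]
    by (simp add: join_le_iff)
  ultimately have "rk ((a \<curlyvee> b) \<curlyvee> y) \<ge> Suc (Suc (rk y))"
    using rk_mono[of "y \<curlyvee> a \<curlyvee> b" "(a \<curlyvee> b) \<curlyvee> y"] y aS bS by simp
  then have "rk ((a \<curlyvee> b) \<inter> y) = 0"
    using modular[of "a \<curlyvee> b" y] m y aS bS by simp
  then show ?thesis
    using m a b aS bS pS by (intro bexI[of _ "a \<curlyvee> b"]) (auto simp: G_iff join_le_iff)
qed

text \<open>Excludes full antiflags in \<open>C0\<close>, and in \<open>C1\<close> those whose line
  is a plane of PG(4,q).\<close>

lemma ex_skew_line:
  assumes P: "P \<in> G 2" and l: "l \<in> G 3" and "\<not> P \<subseteq> l"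
  shows "\<exists>Q\<in>G 2. Q \<subseteq> l \<and> \<not> collinear C0 P Q"
proof -
  have PS: "P \<in> Sub" "rk P = 2" "l \<in> Sub" using P l by (auto simp: G_iff)
  obtain m where m: "m \<in> G 2" "m \<subseteq> l" "rk (m \<inter> (P \<inter> l)) = 0"
    using ex_line_avoiding[OF l, of "P \<inter> l"] rk_inter_less[of P l] assms(3) PS by auto
  have "m \<inter> (P \<inter> l) = P \<inter> m" using m by auto
  then show ?thesis using m C0_collinear_iff[OF P m(1)] by auto
qed

lemma C0_not_full: "\<not> full C0 P l"
  using ex_skew_line[of P l] by (auto simp: full_def)

end

section \<open>The three other configurations\<close>

locale subspace_lattice_antiflag = subspace_lattice +
  fixes H P0 :: "'a set"
  assumes H: "H \<in> G 4" and P0: "P0 \<in> G 1" and P0_H: "\<not> P0 \<subseteq> H"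
begin

lemma H_Sub [simp]: "H \<in> Sub" and rk_H [simp]: "rk H = 4"
  and P0_Sub [simp]: "P0 \<in> Sub" and rk_P0 [simp]: "rk P0 = 1"
  using H P0 by (auto simp: G_iff)

lemma P0_not_H: "P0 \<subseteq> U \<Longrightarrow> \<not> U \<subseteq> H"
  using P0_H by blast

lemma rk_inter_H: "U \<in> Sub \<Longrightarrow> \<not> U \<subseteq> H \<Longrightarrow> rk U = Suc (rk (U \<inter> H))"
  using modular[of U H] rk_inter_less[of U H] rk_le_5[of "U \<curlyvee> H"] by simp

lemma not_subset_rk: "U \<in> Sub \<Longrightarrow> W \<in> Sub \<Longrightarrow> rk W < rk U \<Longrightarrow> \<not> U \<subseteq> W"
  using rk_mono[of U W] by auto

text \<open>The kinds of lines need not be distinguished in \<open>incident\<close>: \<open>P \<subseteq> l\<close> forces \<open>l\<close> to be a plane and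
  \<open>l \<subseteq> P\<close> forces it to be a point. In \<open>C3\<close>, whose points are planes and points of \<open>H\<close>, the first two
  disjuncts describe the dual of \<open>C1\<close> and the third one the solids through \<open>P0\<close>.\<close>

definition C1 :: "('a set, 'a set) incidence_structure" where
  "C1 = \<lparr>points = G 2, lines = {p\<in>G 3. \<not> p \<subseteq> H} \<union> {x\<in>G 1. x \<subseteq> H},
     incident = (\<lambda>P l. P \<subseteq> l \<or> (l \<subseteq> P \<and> P \<subseteq> H))\<rparr>"

definition C3 :: "('a set, 'a set) incidence_structure" where
  "C3 = \<lparr>points = lines C1, lines = {l\<in>G 2. \<not> P0 \<subseteq> l} \<union> {g\<in>G 4. P0 \<subseteq> g},
     incident = (\<lambda>P l. l \<subseteq> P \<or> (P \<subseteq> l \<and> l \<subseteq> H) \<or> (P0 \<subseteq> P \<and> P \<subseteq> l))\<rparr>"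

abbreviation C2 :: "('a set, 'a set) incidence_structure" where
  "C2 \<equiv> dual C1"

lemma C1_simps [simp]:
  "points C1 = G 2" "lines C1 = {p\<in>G 3. \<not> p \<subseteq> H} \<union> {x\<in>G 1. x \<subseteq> H}"
  "incident C1 P l \<longleftrightarrow> P \<subseteq> l \<or> (l \<subseteq> P \<and> P \<subseteq> H)"
  by (simp_all add: C1_def)

lemma C3_simps [simp]:
  "points C3 = {p\<in>G 3. \<not> p \<subseteq> H} \<union> {x\<in>G 1. x \<subseteq> H}"
  "lines C3 = {l\<in>G 2. \<not> P0 \<subseteq> l} \<union> {g\<in>G 4. P0 \<subseteq> g}"
  "incident C3 P l \<longleftrightarrow> l \<subseteq> P \<or> (P \<subseteq> l \<and> l \<subseteq> H) \<or> (P0 \<subseteq> P \<and> P \<subseteq> l)"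
  by (simp_all add: C3_def)

text \<open>Removes the disjuncts of an incidence relation that are impossible for reasons of
  rank.\<close>

lemma rank_not_subset:
  "l \<in> G m \<Longrightarrow> P \<in> G n \<Longrightarrow> n < m \<Longrightarrow> \<not> l \<subseteq> P"
  by (auto simp: G_iff dest: rk_mono)

text \<open>The counts match because \<open>H\<close> is a PG(3,q): it has as many points as planes,
  a line of \<open>H\<close> has q + 1 points and lies in q + 1 planes of \<open>H\<close>, and a
  point of \<open>H\<close> lies on q^2 + q + 1 lines of \<open>H\<close>.\<close>

lemma C1_replaces_C0:
  shows C1_strongly_regular: "strongly_regular_configuration C1 v_par k_par lam_par mu_par"
    and C1_collinear_iff: "P \<in> G 2 \<Longrightarrow> Q \<in> G 2 \<Longrightarrow> P \<noteq> Q \<Longrightarrow> collinear C1 P Q \<longleftrightarrow> collinear C0 P Q"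
proof -
  let ?K = "{p\<in>G 3. \<not> p \<subseteq> H}" and ?R = "{p\<in>G 3. p \<subseteq> H}" and ?R' = "{x\<in>G 1. x \<subseteq> H}"
  have lines: "lines C0 = ?K \<union> ?R" "lines C1 = ?K \<union> ?R'" "?K \<inter> ?R = {}" "?K \<inter> ?R' = {}"
    by (auto simp: G_iff)
  have card_eq: "card ?R' = card ?R"
    using card_points_in[of H] card_below[of Z H 3] Z_least H
    by (simp add: G_Sub cong: conj_cong)
  have same: "incident C1 P l \<longleftrightarrow> incident C0 P l" if "P \<in> points C0" "l \<in> ?K" for P l
    using that rank_not_subset[of l 3 P 2] by auto
  have inc: "incident C1 P x \<longleftrightarrow> x \<subseteq> P \<and> P \<subseteq> H" if "P \<in> points C0" "x \<in> ?R'" for P x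
    using that rank_not_subset[of P 2 x 1] by auto
  have line: "card {P\<in>points C0. incident C1 P x} = k_par" if "x \<in> ?R'" for x
  proof -
    have "{P\<in>points C0. incident C1 P x} = {P\<in>G 2. x \<subseteq> P \<and> P \<subseteq> H}"
      using inc that by auto
    then show ?thesis
      using card_above[of x 1 H] that by (simp add: numeral_2_eq_2[symmetric] gauss_numeral)
  qed
  have pencil: "card {x\<in>?R'. incident C1 P x} = card {p\<in>?R. incident C0 P p}"
    if P: "P \<in> points C0" for P
  proof (cases "P \<subseteq> H")
    case True
    have "{x\<in>?R'. incident C1 P x} = {x\<in>G 1. x \<subseteq> P}"
      using inc[OF P] True by blast
    moreover have "{p\<in>?R. incident C0 P p} = {p\<in>G 3. P \<subseteq> p \<and> p \<subseteq> H}" by auto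
    ultimately show ?thesis
      using card_points_in[of P] card_above[of P 2 H] P True
      by (simp add: G_iff numeral_3_eq_3[symmetric])
  next
    case False
    then have "{x\<in>?R'. incident C1 P x} = {}" "{p\<in>?R. incident C0 P p} = {}"
      using inc[OF P] by auto
    then show ?thesis by (simp only: card.empty)
  qed
  have joined: "(\<exists>x\<in>?R'. incident C1 P x \<and> incident C1 Q x) \<longleftrightarrow>
      (\<exists>p\<in>?R. incident C0 P p \<and> incident C0 Q p)"
    if PQ: "P \<in> points C0" "Q \<in> points C0" "P \<noteq> Q" for P Q
  proof
    have S: "P \<in> Sub" "Q \<in> Sub" "rk P = 2" "rk Q = 2" using PQ by (auto simp: G_iff)
    {
      assume "\<exists>x\<in>?R'. incident C1 P x \<and> incident C1 Q x"
      then obtain x where x: "x \<in> G 1" "x \<subseteq> P" "x \<subseteq> Q" and PQH: "P \<subseteq> H" "Q \<subseteq> H"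
        using inc PQ by blast
      then have "rk (P \<inter> Q) \<ge> 1" using rk_mono[of x "P \<inter> Q"] S by (auto simp: G_iff)
      then have "\<exists>p\<in>G 3. P \<curlyvee> Q \<subseteq> p \<and> p \<subseteq> H"
        using modular[of P Q] S PQH by (intro ex_between) (auto simp: join_le_iff)
      then show "\<exists>p\<in>?R. incident C0 P p \<and> incident C0 Q p"
        using S by (auto simp: join_le_iff G_iff)
    next
      assume "\<exists>p\<in>?R. incident C0 P p \<and> incident C0 Q p"
      then have PQH: "P \<subseteq> H" "Q \<subseteq> H" and "collinear C0 P Q"
        by (auto simp: collinear_def)
      then have "rk (P \<inter> Q) \<ge> 1" using C0_collinear_iff PQ by auto
      then have "\<exists>x\<in>G 1. Z \<subseteq> x \<and> x \<subseteq> P \<inter> Q"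
        using S Z_least by (intro ex_between) auto
      then show "\<exists>x\<in>?R'. incident C1 P x \<and> incident C1 Q x"
        using PQH by fastforce
    }
  qed
  have unique: "x = y"
    if "P \<in> points C0" "Q \<in> points C0" "P \<noteq> Q" "x \<in> ?R'" "y \<in> ?R'"
      "incident C1 P x" "incident C1 Q x" "incident C1 P y" "incident C1 Q y" for P Q x y
  proof -
    have xy: "x \<subseteq> P \<inter> Q" "y \<subseteq> P \<inter> Q" using inc that by auto
    have S: "P \<in> Sub" "Q \<in> Sub" "x \<in> Sub" "y \<in> Sub" "rk x = 1" "rk y = 1"
      using that by (auto simp: G_iff)
    have "rk (P \<inter> Q) \<le> 1" using rk_inter_distinct[of P Q] that by (auto simp: G_iff)
    then have "x = P \<inter> Q" "y = P \<inter> Q" using xy S by (intro rk_eq; simp)+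
    then show ?thesis by simp
  qed
  note replace = strongly_regular_configuration_replace_lines[OF C0_strongly_regular _ lines card_eq
      _ same line pencil joined unique]
  show "strongly_regular_configuration C1 v_par k_par lam_par mu_par"
    by (rule replace(1); (assumption | simp))
  show "P \<in> G 2 \<Longrightarrow> Q \<in> G 2 \<Longrightarrow> P \<noteq> Q \<Longrightarrow> collinear C1 P Q \<longleftrightarrow> collinear C0 P Q" for P Q
    by (rule replace(2); (assumption | simp))
qed

lemma k_par_gt_1: "1 < k_par"
  using q_ge_2 by simp

lemma C2_strongly_regular: "strongly_regular_configuration C2 v_par k_par lam_par mu_par"
proof (rule strongly_regular_configuration_dual[OF C1_strongly_regular])
  \<comment> \<open>Hence lam + 1 = q mu and k - 1 = q (q + 1), and the inequality required for
    duality reduces to k \<noteq> q + 1.\<close>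
  have "lam_par + 1 = q * (q + 1)\<^sup>2"
    using q_ge_2 by (simp add: algebra_simps power2_eq_square power3_eq_cube)
  moreover have "k_par - 1 = q * (q + 1)"
    by (simp add: algebra_simps power2_eq_square)
  moreover have "k_par * (q * (q + 1)\<^sup>2) \<noteq> (q * (q + 1)) * (q + 1)\<^sup>2"
  proof
    assume "k_par * (q * (q + 1)\<^sup>2) = (q * (q + 1)) * (q + 1)\<^sup>2"
    then have "k_par * (q * (q + 1)\<^sup>2) = (q + 1) * (q * (q + 1)\<^sup>2)" by (simp only: ac_simps)
    then show False using q_ge_2 by simp
  qed
  ultimately show "k_par * (lam_par + 1) \<noteq> (k_par - 1) * mu_par" by (simp only:) simp
qed simp

lemma C2_collinear_planes:
  assumes P: "P \<in> G 3" and Q: "Q \<in> G 3" and col: "collinear C2 P Q"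
  shows "rk (P \<inter> Q) \<ge> 2"
proof -
  obtain l where "l \<in> G 2" "l \<subseteq> P" "l \<subseteq> Q"
    using col P Q rank_not_subset[of P 3 _ 2] rank_not_subset[of Q 3 _ 2]
    by (auto simp: collinear_def)
  then show ?thesis using rk_mono[of l "P \<inter> Q"] P Q by (auto simp: G_iff)
qed

text \<open>A line joining \<open>x\<close> to \<open>p\<close> in \<open>C2\<close> has to lie in
  both \<open>H\<close> and \<open>p\<close>, so it can only be \<open>p \<inter> H\<close>.\<close>

lemma C2_collinear_point_plane:
  assumes x: "x \<in> G 1" "x \<subseteq> H" and p: "p \<in> G 3" "\<not> p \<subseteq> H"
  shows "collinear C2 x p \<longleftrightarrow> x \<subseteq> p"
proof
  assume "collinear C2 x p"
  then obtain l where "l \<in> G 2" "l \<subseteq> x \<or> x \<subseteq> l" "l \<subseteq> p \<or> p \<subseteq> l"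
    by (auto simp: collinear_def)
  then show "x \<subseteq> p"
    using rank_not_subset[of l 2 x 1] rank_not_subset[of p 3 l 2] x p by auto
next
  assume "x \<subseteq> p"
  moreover have "p \<inter> H \<in> G 2"
    using rk_inter_H[of p] p by (auto simp: G_iff)
  ultimately show "collinear C2 x p"
    using x p by (auto simp: collinear_def intro!: bexI[of _ "p \<inter> H"])
qed

text \<open>The first claim is also what makes full lines of \<open>C1\<close> meet, since those are
  points of \<open>H\<close> and a line of \<open>H\<close> through both is a point of
  \<open>C1\<close>.\<close>

lemma C2_collinear_points:
  assumes x: "x \<in> G 1" "x \<subseteq> H" and y: "y \<in> G 1" "y \<subseteq> H"
  shows "\<exists>l\<in>G 2. x \<subseteq> l \<and> y \<subseteq> l \<and> l \<subseteq> H" "collinear C2 x y"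
proof -
  have "rk (x \<curlyvee> y) \<le> 2" using modular[of x y] x y by (simp add: G_iff)
  then have "\<exists>l\<in>G 2. x \<curlyvee> y \<subseteq> l \<and> l \<subseteq> H"
    using x y by (intro ex_between) (auto simp: G_iff join_le_iff)
  then show "\<exists>l\<in>G 2. x \<subseteq> l \<and> y \<subseteq> l \<and> l \<subseteq> H"
    using x y by (auto simp: G_iff join_le_iff)
  then show "collinear C2 x y" by (auto simp: collinear_def)
qed

text \<open>In the quotient PG(3,q) at \<open>P0\<close> the roles are dual to those in
  \<open>H\<close>: two planes through \<open>P0\<close> lie in a common solid iff they share a line
  through \<open>P0\<close>, and each such plane contains as many lines through \<open>P0\<close> as
  there are solids containing it.\<close>

lemma C3_replaces_C2:
  shows C3_strongly_regular: "strongly_regular_configuration C3 v_par k_par lam_par mu_par"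
    and C3_collinear_iff: "P \<in> points C3 \<Longrightarrow> Q \<in> points C3 \<Longrightarrow> P \<noteq> Q \<Longrightarrow>
      collinear C3 P Q \<longleftrightarrow> collinear C2 P Q"
    and C3_incident_iff: "P \<in> points C3 \<Longrightarrow> l \<in> G 2 \<Longrightarrow> \<not> P0 \<subseteq> l \<Longrightarrow>
      incident C3 P l \<longleftrightarrow> incident C2 P l"
    and C3_incident_solid_iff: "P \<in> points C3 \<Longrightarrow> g \<in> G 4 \<Longrightarrow> P0 \<subseteq> g \<Longrightarrow>
      incident C3 P g \<longleftrightarrow> P \<in> G 3 \<and> P0 \<subseteq> P \<and> P \<subseteq> g"
proof -
  let ?K = "{l\<in>G 2. \<not> P0 \<subseteq> l}" and ?R = "{l\<in>G 2. P0 \<subseteq> l}" and ?R' = "{g\<in>G 4. P0 \<subseteq> g}"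
  have pts: "points C3 = points C2" by simp
  have lines: "lines C2 = ?K \<union> ?R" "lines C3 = ?K \<union> ?R'" "?K \<inter> ?R = {}" "?K \<inter> ?R' = {}"
    by auto
  have card_eq: "card ?R' = card ?R"
    using card_above[of P0 1 E] card_below[of P0 E 4] E_greatest P0
    by (simp add: G_iff numeral_2_eq_2[symmetric] cong: conj_cong)
  have same: "incident C3 P l \<longleftrightarrow> incident C2 P l" if "P \<in> points C2" "l \<in> ?K" for P l
    using that rank_not_subset[of P 3 l 2] P0_not_H[of P] by auto
  \<comment> \<open>A line through \<open>P0\<close> is not inside \<open>H\<close>, so in
    \<open>C2\<close> it carries planes only and none of the points of \<open>H\<close>.\<close>
  have incR: "incident C2 P l \<longleftrightarrow> P \<in> G 3 \<and> l \<subseteq> P" if "P \<in> points C2" "l \<in> ?R" for P l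
    using that rank_not_subset[of l 2 P 1] P0_not_H[of l] by auto
  have incR': "incident C3 P g \<longleftrightarrow> P \<in> G 3 \<and> P0 \<subseteq> P \<and> P \<subseteq> g"
    if "P \<in> points C2" "g \<in> ?R'" for P g
    using that rank_not_subset[of g 4 P 1] rank_not_subset[of g 4 P 3] P0_not_H[of g] P0_not_H[of P]
    by auto
  have line: "card {P\<in>points C2. incident C3 P g} = k_par" if g: "g \<in> ?R'" for g
  proof -
    have "{P\<in>points C2. incident C3 P g} = {P\<in>G 3. P0 \<subseteq> P \<and> P \<subseteq> g}"
      using incR'[OF _ g] P0_not_H by auto
    then show ?thesis
      using card_below[of P0 g 3] g by (simp add: gauss_numeral)
  qed
  have pencil: "card {g\<in>?R'. incident C3 P g} = card {l\<in>?R. incident C2 P l}"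
    if P: "P \<in> points C2" for P
  proof (cases "P \<in> G 3 \<and> P0 \<subseteq> P")
    case True
    have "{g\<in>?R'. incident C3 P g} = {g\<in>G 4. P \<subseteq> g \<and> g \<subseteq> E}"
      using incR'[OF P] True E_greatest G_Sub[of _ 4] by blast
    moreover have "{l\<in>?R. incident C2 P l} = {l\<in>G 2. P0 \<subseteq> l \<and> l \<subseteq> P}"
      using incR[OF P] True by auto
    ultimately show ?thesis
      using card_above[of P 3 E] card_above[of P0 1 P] E_greatest P0 True
      by (simp add: G_iff numeral_2_eq_2[symmetric])
  next
    case False
    then have "{g\<in>?R'. incident C3 P g} = {}" "{l\<in>?R. incident C2 P l} = {}"
      using incR[OF P] incR'[OF P] by blast+
    then show ?thesis by (simp only: card.empty)
  qed
  have joined: "(\<exists>g\<in>?R'. incident C3 P g \<and> incident C3 Q g) \<longleftrightarrow>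
      (\<exists>l\<in>?R. incident C2 P l \<and> incident C2 Q l)"
    if PQ: "P \<in> points C2" "Q \<in> points C2" "P \<noteq> Q" for P Q
  proof
    {
      assume "\<exists>g\<in>?R'. incident C3 P g \<and> incident C3 Q g"
      then obtain g where g: "g \<in> G 4" "P \<subseteq> g" "Q \<subseteq> g" "P \<in> G 3" "Q \<in> G 3" "P0 \<subseteq> P" "P0 \<subseteq> Q"
        using incR' PQ by blast
      then have S: "P \<in> Sub" "Q \<in> Sub" "g \<in> Sub" "rk P = 3" "rk Q = 3" "rk g = 4"
        by (auto simp: G_iff)
      have "rk (P \<curlyvee> Q) \<le> 4" using rk_mono[of "P \<curlyvee> Q" g] g S by (simp add: join_le_iff)
      then have "\<exists>l\<in>G 2. P0 \<subseteq> l \<and> l \<subseteq> P \<inter> Q"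
        using modular[of P Q] S g by (intro ex_between) auto
      then show "\<exists>l\<in>?R. incident C2 P l \<and> incident C2 Q l"
        by auto
    next
      assume "\<exists>l\<in>?R. incident C2 P l \<and> incident C2 Q l"
      then obtain l where l: "l \<in> G 2" "l \<subseteq> P" "l \<subseteq> Q" "P \<in> G 3" "Q \<in> G 3" "P0 \<subseteq> l"
        using incR PQ by blast
      then have S: "P \<in> Sub" "Q \<in> Sub" "l \<in> Sub" "rk P = 3" "rk Q = 3" "rk l = 2"
        by (auto simp: G_iff)
      have "rk (P \<inter> Q) \<ge> 2" using rk_mono[of l "P \<inter> Q"] l S by simp
      then have "\<exists>g\<in>G 4. P \<curlyvee> Q \<subseteq> g \<and> g \<subseteq> E"
        using modular[of P Q] S E_greatest by (intro ex_between) auto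
      then obtain g where g: "g \<in> G 4" "P \<curlyvee> Q \<subseteq> g" by auto
      then have "P \<subseteq> g" "Q \<subseteq> g" using S by (auto simp: join_le_iff G_iff)
      then have "incident C3 P g" "incident C3 Q g" "g \<in> ?R'" using g l by auto
      then show "\<exists>g\<in>?R'. incident C3 P g \<and> incident C3 Q g" by blast
    }
  qed
  have unique: "g = h"
    if "P \<in> points C2" "Q \<in> points C2" "P \<noteq> Q" "g \<in> ?R'" "h \<in> ?R'"
      "incident C3 P g" "incident C3 Q g" "incident C3 P h" "incident C3 Q h" for P Q g h
  proof -
    have PQ: "P \<in> G 3" "Q \<in> G 3" "P \<subseteq> g" "Q \<subseteq> g" "P \<subseteq> h" "Q \<subseteq> h"
      using incR' that by blast+
    then have S: "P \<in> Sub" "Q \<in> Sub" "rk P = 3" "rk Q = 3" by (auto simp: G_iff)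
    have gh: "g \<in> Sub" "h \<in> Sub" "rk g = 4" "rk h = 4" using that by (auto simp: G_iff)
    have "rk (P \<curlyvee> Q) \<ge> 4"
      using modular[of P Q] rk_inter_distinct[of P Q] S \<open>P \<noteq> Q\<close> by simp
    then have "P \<curlyvee> Q = g" "P \<curlyvee> Q = h"
      using PQ S gh by (intro rk_eq; simp add: join_le_iff)+
    then show ?thesis by simp
  qed
  note replace = strongly_regular_configuration_replace_lines[OF C2_strongly_regular pts lines card_eq
      _ same line pencil joined unique]
  show "strongly_regular_configuration C3 v_par k_par lam_par mu_par"
    by (rule replace(1); (assumption | simp))
  show "P \<in> points C3 \<Longrightarrow> Q \<in> points C3 \<Longrightarrow> P \<noteq> Q \<Longrightarrow> collinear C3 P Q \<longleftrightarrow> collinear C2 P Q" for P Q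
    by (rule replace(2); (assumption | simp))
  show "P \<in> points C3 \<Longrightarrow> l \<in> G 2 \<Longrightarrow> \<not> P0 \<subseteq> l \<Longrightarrow> incident C3 P l \<longleftrightarrow> incident C2 P l" for P l
    by (rule same; (assumption | simp))
  show "P \<in> points C3 \<Longrightarrow> g \<in> G 4 \<Longrightarrow> P0 \<subseteq> g \<Longrightarrow>
      incident C3 P g \<longleftrightarrow> P \<in> G 3 \<and> P0 \<subseteq> P \<and> P \<subseteq> g" for P g
    by (rule incR'; (assumption | simp))
qed

end

section \<open>Full antiflags of the three new configurations\<close>

context subspace_lattice_antiflag
begin

text \<open>A plane outside \<open>H\<close> has kept its points, and collinearity is that of
  \<open>C0\<close>, where some line of the plane is skew to \<open>P\<close>.\<close>

lemma C1_full_line: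
  assumes "full C1 P l"
  shows "l \<in> G 1" "l \<subseteq> H"
proof -
  have "l \<notin> G 3"
  proof
    assume l: "l \<in> G 3"
    have P: "P \<in> G 2" "\<not> P \<subseteq> l" using assms by (auto simp: full_def)
    obtain Q where Q: "Q \<in> G 2" "Q \<subseteq> l" "\<not> collinear C0 P Q"
      using ex_skew_line[OF P(1) l P(2)] by blast
    then have "collinear C1 P Q" using assms by (auto simp: full_def)
    then show False using C1_collinear_iff[of P Q] P Q by blast
  qed
  then show "l \<in> G 1" "l \<subseteq> H" using assms by (auto simp: full_def)
qed

lemma C1_full_lines_meet: "full_lines_meet C1"
  unfolding full_lines_meet_def
proof (intro allI impI, elim conjE)
  fix P l Q m assume "full C1 P l" "full C1 Q m"
  then obtain R where "R \<in> G 2" "l \<subseteq> R" "m \<subseteq> R" "R \<subseteq> H"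
    using C2_collinear_points(1)[of l m] C1_full_line by blast
  then show "\<exists>R\<in>points C1. incident C1 R l \<and> incident C1 R m"
    by (intro bexI[of _ R]) simp_all
qed

text \<open>The points of \<open>C1\<close> on \<open>P \<inter> H\<close> are the lines of
  \<open>H\<close> through that point, and all of them meet \<open>P\<close> there.\<close>

lemma C1_full:
  assumes P: "P \<in> G 2" "\<not> P \<subseteq> H"
  shows "full C1 P (P \<inter> H)"
proof -
  have x: "P \<inter> H \<in> G 1" using rk_inter_H[of P] P by (auto simp: G_iff)
  have "collinear C1 P Q" if Q: "Q \<in> G 2" "incident C1 Q (P \<inter> H)" for Q
  proof -
    have "P \<inter> H \<subseteq> Q" "Q \<subseteq> H" using Q rank_not_subset[OF Q(1) x] by auto
    then have "rk (P \<inter> Q) \<ge> 1" using rk_mono[of "P \<inter> H" "P \<inter> Q"] x P Q by (auto simp: G_iff)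
    moreover have "P \<noteq> Q" using P \<open>Q \<subseteq> H\<close> by blast
    ultimately show ?thesis using C1_collinear_iff C0_collinear_iff P Q by simp
  qed
  then show ?thesis using P x by (auto simp: full_def)
qed

text \<open>A line of \<open>H\<close> can meet \<open>P\<close> only in
  \<open>P \<inter> H\<close>; together with \<open>x\<close> this point determines the line. This
  supplies the value 1 that is incompatible with a full antiflag.\<close>

lemma C1_one_collinear:
  assumes P: "P \<in> G 2" "\<not> P \<subseteq> H" and x: "x \<in> G 1" "x \<subseteq> H" "\<not> x \<subseteq> P"
  shows "{R\<in>points C1. incident C1 R x \<and> collinear C1 P R} = {(P \<inter> H) \<curlyvee> x}"
proof (intro equalityI subsetI)
  have y: "P \<inter> H \<in> G 1" using rk_inter_H[of P] P by (auto simp: G_iff)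
  have S: "P \<in> Sub" "x \<in> Sub" "rk x = 1" "P \<inter> H \<in> Sub" "rk (P \<inter> H) = 1" using P x y by (auto simp: G_iff)
  have r2: "rk ((P \<inter> H) \<curlyvee> x) = 2" using rk_join_atom[of "P \<inter> H" x] x S by auto
  {
    fix R assume R: "R \<in> {R\<in>points C1. incident C1 R x \<and> collinear C1 P R}"
    then have R2: "R \<in> G 2" "R \<in> Sub" "rk R = 2" by (auto simp: G_iff)
    then have xR: "x \<subseteq> R" "R \<subseteq> H" using R rank_not_subset[of R 2 x 1] x by auto
    then have "P \<noteq> R" using P by blast
    then have "rk (P \<inter> R) \<ge> 1" using R R2 P C1_collinear_iff C0_collinear_iff by simp
    then have "P \<inter> R = P \<inter> H" using xR R2 S by (intro rk_eq) auto
    then have "(P \<inter> H) \<curlyvee> x = R" using xR R2 S r2 by (intro rk_eq) (auto simp: join_le_iff)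
    then show "R \<in> {(P \<inter> H) \<curlyvee> x}" by simp
  next
    fix R assume "R \<in> {(P \<inter> H) \<curlyvee> x}"
    then have R: "R = (P \<inter> H) \<curlyvee> x" by simp
    have R2: "R \<in> G 2" "R \<subseteq> H" "x \<subseteq> R" "P \<inter> H \<subseteq> R"
      using R r2 S x join_upper1[of "P \<inter> H" x] join_upper2[of "P \<inter> H" x]
      by (auto simp: G_iff join_le_iff)
    then have "rk (P \<inter> R) \<ge> 1" using rk_mono[of "P \<inter> H" "P \<inter> R"] S by (simp add: G_iff)
    moreover have "P \<noteq> R" using P R2 by blast
    ultimately show "R \<in> {R\<in>points C1. incident C1 R x \<and> collinear C1 P R}"
      using R2 P C1_collinear_iff C0_collinear_iff by simp
  }
qed

text \<open>The points of \<open>C2\<close> on a line \<open>l\<close> outside \<open>H\<close> are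
  the planes through \<open>l\<close>, and each of them contains \<open>x\<close>.\<close>

lemma C2_full:
  assumes l: "l \<in> G 2" "\<not> l \<subseteq> H" and x: "x \<in> G 1" "x \<subseteq> H" "x \<subseteq> l"
  shows "full C2 x l"
proof -
  have "collinear C2 x Q" if Q: "Q \<in> points C2" "incident C2 Q l" for Q
  proof -
    have "l \<subseteq> Q" using Q l by auto
    then have "Q \<in> G 3" "\<not> Q \<subseteq> H" "x \<subseteq> Q" using Q l x rank_not_subset[of l 2 Q 1] by auto
    then show ?thesis using C2_collinear_point_plane[OF x(1,2)] by simp
  qed
  then show ?thesis using l x rank_not_subset[OF l(1) x(1)] by (auto simp: full_def)
qed

text \<open>Only one plane through \<open>l\<close> contains the point \<open>x\<close> off
  \<open>l\<close>, and it is outside \<open>H\<close> because \<open>l\<close> is.\<close>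

lemma C2_one_collinear:
  assumes l: "l \<in> G 2" "\<not> l \<subseteq> H" and x: "x \<in> G 1" "x \<subseteq> H" "\<not> x \<subseteq> l"
  shows "{R\<in>points C2. incident C2 R l \<and> collinear C2 x R} = {l \<curlyvee> x}"
proof (intro equalityI subsetI)
  have S: "l \<in> Sub" "rk l = 2" "x \<in> Sub" using l x by (auto simp: G_iff)
  have r3: "rk (l \<curlyvee> x) = 3" using rk_join_atom[of l x] S x by simp
  {
    fix R assume R: "R \<in> {R\<in>points C2. incident C2 R l \<and> collinear C2 x R}"
    then have "l \<subseteq> R" using l by auto
    then have R3: "R \<in> G 3" "\<not> R \<subseteq> H" using R l rank_not_subset[of l 2 R 1] by auto
    then have "x \<subseteq> R" using R C2_collinear_point_plane[OF x(1,2)] by simp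
    then have "l \<curlyvee> x = R" using \<open>l \<subseteq> R\<close> R3 S r3 by (intro rk_eq) (auto simp: join_le_iff G_iff)
    then show "R \<in> {l \<curlyvee> x}" by simp
  next
    fix R assume "R \<in> {l \<curlyvee> x}"
    then have R: "R = l \<curlyvee> x" by simp
    have "R \<in> G 3" "l \<subseteq> R" "x \<subseteq> R"
      using R r3 S join_upper1[of l x] join_upper2[of l x] by (auto simp: G_iff)
    moreover from this have "\<not> R \<subseteq> H" using l by blast
    ultimately show "R \<in> {R\<in>points C2. incident C2 R l \<and> collinear C2 x R}"
      using C2_collinear_point_plane[OF x(1,2)] by simp
  }
qed

text \<open>Suppose that \<open>p\<close> is a plane. If \<open>l\<close> is inside
  \<open>H\<close>, it carries its own points, and one of them is off \<open>p\<close> and hence not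
  collinear with it. Otherwise some plane through \<open>l\<close> meets \<open>p\<close> in a
  single point only.\<close>

lemma C2_full_point:
  assumes "full C2 p l"
  shows "p \<in> G 1" "p \<subseteq> H"
proof -
  have "p \<notin> G 3"
  proof
    assume p: "p \<in> G 3"
    have l: "l \<in> G 2" "\<not> l \<subseteq> p" using assms by (auto simp: full_def)
    have pH: "\<not> p \<subseteq> H" using assms p by (auto simp: full_def G_iff)
    have col: "collinear C2 p Q" if "Q \<in> points C2" "incident C2 Q l" for Q
      using assms that by (auto simp: full_def)
    have S: "l \<in> Sub" "rk l = 2" "p \<in> Sub" "rk p = 3" using l p by (auto simp: G_iff)
    show False
    proof (cases "l \<subseteq> H")
      case True
      obtain x where x: "x \<in> G 1" "x \<subseteq> l" "\<not> x \<subseteq> p" using ex_point_avoiding[of l p] S l by blast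
      then have "x \<in> points C2" "incident C2 x l" using True by auto
      then have "collinear C2 p x" by (rule col)
      then have "collinear C2 x p" unfolding collinear_def by blast
      then show False using C2_collinear_point_plane[of x p] x True p pH by auto
    next
      case False
      \<comment> \<open>The plane \<open>l \<curlyvee> w\<close> must span \<open>E\<close> together
        with \<open>p\<close>. If \<open>p\<close> and \<open>l\<close> already do, it is enough
        that \<open>w\<close> is off \<open>l\<close>; otherwise \<open>w\<close> has to be off the
        solid \<open>p \<curlyvee> l\<close>.\<close>
      let ?U = "if p \<curlyvee> l = E then l else p \<curlyvee> l"
      have U: "?U \<in> Sub" "rk ?U < 5" "l \<subseteq> ?U"
        using S join_upper2[of p l] rk_le_5[of "p \<curlyvee> l"] rk_eq[of "p \<curlyvee> l" E] E_greatest[of "p \<curlyvee> l"]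
        by (auto simp: le_less)
      then obtain w where w: "w \<in> G 1" "\<not> w \<subseteq> ?U"
        using ex_point_avoiding[of E ?U] not_subset_rk[of E ?U] by auto
      have wS: "w \<in> Sub" using w by (simp add: G_iff)
      have "\<not> w \<subseteq> l" using w U by blast
      then have Q: "l \<curlyvee> w \<in> G 3" "l \<subseteq> l \<curlyvee> w" "w \<subseteq> l \<curlyvee> w"
        using rk_join_atom[of l w] S w wS join_upper1[of l w] join_upper2[of l w] by (auto simp: G_iff)
      have pl: "p \<curlyvee> l \<subseteq> p \<curlyvee> (l \<curlyvee> w)" and wpl: "w \<subseteq> p \<curlyvee> (l \<curlyvee> w)"
        using S wS Q join_upper1[of p "l \<curlyvee> w"] join_upper2[of p "l \<curlyvee> w"] by (auto simp: join_le_iff)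
      have "rk (p \<curlyvee> (l \<curlyvee> w)) = 5"
      proof (cases "p \<curlyvee> l = E")
        case True
        then show ?thesis using pl E_greatest[of "p \<curlyvee> (l \<curlyvee> w)"] S wS by auto
      next
        case False
        then have "\<not> w \<subseteq> p \<curlyvee> l" using w by simp
        then have "rk (p \<curlyvee> l) < rk (p \<curlyvee> (l \<curlyvee> w))"
          using rk_eq[of "p \<curlyvee> l" "p \<curlyvee> (l \<curlyvee> w)"] pl wpl S wS by (metis join_Sub leI)
        moreover have "rk p < rk (p \<curlyvee> l)" using rk_join_greater[of p l] S l by simp
        ultimately show ?thesis using S rk_le_5[of "p \<curlyvee> (l \<curlyvee> w)"] wS by simp
      qed
      then have "rk (p \<inter> (l \<curlyvee> w)) = 1"
        using modular[of p "l \<curlyvee> w"] S wS Q by (simp add: G_iff)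
      moreover have "l \<curlyvee> w \<in> points C2" "incident C2 (l \<curlyvee> w) l" using Q False by auto
      ultimately show False using col[of "l \<curlyvee> w"] C2_collinear_planes[OF p Q(1)] by simp
    qed
  qed
  then show "p \<in> G 1" "p \<subseteq> H" using assms by (auto simp: full_def)
qed

lemma C2_full_points_collinear: "full_points_collinear C2"
  using C2_full_point C2_collinear_points(2) by (auto simp: full_points_collinear_def)

text \<open>Lines avoiding \<open>P0\<close> survive the second replacement with the same points, so
  full antiflags on them carry over.\<close>

lemma C3_full_line_iff:
  assumes "l \<in> G 2" "\<not> P0 \<subseteq> l"
  shows "full C3 P l \<longleftrightarrow> full C2 P l"
proof -
  have "(\<forall>Q\<in>points C3. incident C3 Q l \<longrightarrow> collinear C3 P Q) \<longleftrightarrow>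
      (\<forall>Q\<in>points C2. incident C2 Q l \<longrightarrow> collinear C2 P Q)"
    if P: "P \<in> points C3" "\<not> incident C3 P l"
  proof -
    \<comment> \<open>Collinearity is known to agree for distinct points only; \<open>P\<close> and
      \<open>Q\<close> are distinct because \<open>Q\<close> is on \<open>l\<close> and
      \<open>P\<close> is not.\<close>
    have "(incident C3 Q l \<longrightarrow> collinear C3 P Q) \<longleftrightarrow> (incident C2 Q l \<longrightarrow> collinear C2 P Q)"
      if Q: "Q \<in> points C3" for Q
      using C3_incident_iff[OF Q assms] C3_collinear_iff[OF P(1) Q] P(2) by blast
    moreover have "points C3 = points C2" by simp
    ultimately show ?thesis by metis
  qed
  then show ?thesis
    unfolding full_def using assms C3_incident_iff[of P l]
    by (simp del: C3_simps(3) dual_simps(3)) blast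
qed

text \<open>Join \<open>x\<close> to a point \<open>y\<close> outside \<open>H\<close> and
  \<open>W\<close>. If \<open>P0\<close> were on this line, \<open>y\<close> would be on the line
  through \<open>x\<close> and \<open>P0\<close>, which is inside \<open>W\<close>.\<close>

lemma ex_transversal_line:
  assumes x: "x \<in> G 1" "x \<subseteq> H" and W: "W \<in> Sub" "x \<subseteq> W" "P0 \<subseteq> W" "rk W \<le> 4"
  shows "\<exists>l\<in>G 2. x \<subseteq> l \<and> \<not> l \<subseteq> H \<and> \<not> P0 \<subseteq> l \<and> \<not> l \<subseteq> W"
proof -
  obtain y where y: "y \<in> G 1" "\<not> y \<subseteq> H" "\<not> y \<subseteq> W"
    using ex_point_avoiding2[of E H W] not_subset_rk[of E H] not_subset_rk[of E W] W by auto
  have S: "x \<in> Sub" "rk x = 1" "y \<in> Sub" using x y by (auto simp: G_iff)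
  have "\<not> y \<subseteq> x" using y W by blast
  then have l: "rk (x \<curlyvee> y) = 2" "x \<subseteq> x \<curlyvee> y" "y \<subseteq> x \<curlyvee> y"
    using rk_join_atom[of x y] S y join_upper1[of x y] join_upper2[of x y] by auto
  have "\<not> P0 \<subseteq> x \<curlyvee> y"
  proof
    assume "P0 \<subseteq> x \<curlyvee> y"
    moreover have "\<not> P0 \<subseteq> x" using x P0_H by blast
    ultimately have "y \<subseteq> x \<curlyvee> P0" using atom_join_exchange[of x y P0] S y P0 by simp
    then show False using y W S join_least[of x P0 W] by auto
  qed
  then show ?thesis using l y S by (intro bexI[of _ "x \<curlyvee> y"]) (auto simp: G_iff)
qed

text \<open>Provides two full antiflags of \<open>C2\<close> that survive in \<open>C3\<close>, on
  skew lines; the join of rank 4 expresses skewness. In addition \<open>x'\<close> is off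
  \<open>l\<close>, as needed for an antiflag with exactly one collinear point.\<close>

lemma ex_skew_transversals:
  obtains x l x' l' where "x \<in> G 1" "x \<subseteq> H" "l \<in> G 2" "x \<subseteq> l" "\<not> l \<subseteq> H" "\<not> P0 \<subseteq> l"
    "x' \<in> G 1" "x' \<subseteq> H" "l' \<in> G 2" "x' \<subseteq> l'" "\<not> l' \<subseteq> H" "\<not> P0 \<subseteq> l'"
    "\<not> x' \<subseteq> l" "rk (l \<curlyvee> l') = 4"
proof -
  obtain x where x: "x \<in> G 1" "x \<subseteq> H" using ex_point_avoiding[of H Z] not_subset_rk[of H Z] by auto
  have xS: "x \<in> Sub" "rk x = 1" using x by (auto simp: G_iff)
  have "\<not> P0 \<subseteq> x" using x P0_H by blast
  then have "rk (x \<curlyvee> P0) = 2" using rk_join_atom[of x P0] xS P0 by simp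
  then obtain l where l: "l \<in> G 2" "x \<subseteq> l" "\<not> l \<subseteq> H" "\<not> P0 \<subseteq> l"
    using ex_transversal_line[OF x, of "x \<curlyvee> P0"] xS join_upper1[of x P0] join_upper2[of x P0] by auto
  have lS: "l \<in> Sub" "rk l = 2" using l by (auto simp: G_iff)
  obtain x' where x': "x' \<in> G 1" "x' \<subseteq> H" "\<not> x' \<subseteq> l"
    using ex_point_avoiding[of H l] not_subset_rk[of H l] lS by auto
  have x'S: "x' \<in> Sub" using x' by (simp add: G_iff)
  have r3: "rk (l \<curlyvee> x') = 3" using rk_join_atom[of l x'] lS x' by simp
  \<comment> \<open>A line \<open>l'\<close> through \<open>x'\<close> that leaves this subspace
    also leaves the plane \<open>l \<curlyvee> x'\<close>, so it cannot meet
    \<open>l\<close>.\<close>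
  let ?W = "(l \<curlyvee> x') \<curlyvee> P0"
  have W: "?W \<in> Sub" "P0 \<subseteq> ?W" "l \<curlyvee> x' \<subseteq> ?W" "rk ?W \<le> 4"
    using lS x'S r3 modular[of "l \<curlyvee> x'" P0] join_upper1[of "l \<curlyvee> x'" P0] join_upper2[of "l \<curlyvee> x'" P0] by auto
  moreover have "x' \<subseteq> ?W" using W(3) join_upper2[of l x'] lS x'S by auto
  ultimately obtain l' where l': "l' \<in> G 2" "x' \<subseteq> l'" "\<not> l' \<subseteq> H" "\<not> P0 \<subseteq> l'" "\<not> l' \<subseteq> ?W"
    using ex_transversal_line[OF x'(1,2), of ?W] by auto
  have l'S: "l' \<in> Sub" "rk l' = 2" using l' by (auto simp: G_iff)
  have "l \<curlyvee> x' \<subseteq> l \<curlyvee> l'"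
    using lS x'S l'S l' join_upper1[of l l'] join_upper2[of l l'] by (auto simp: join_le_iff)
  moreover have "l \<curlyvee> x' \<noteq> l \<curlyvee> l'"
    using l' W(3) join_upper2[of l l'] lS l'S by blast
  ultimately have "rk (l \<curlyvee> l') > 3"
    using rk_eq[of "l \<curlyvee> x'" "l \<curlyvee> l'"] r3 lS l'S x'S by (metis join_Sub leI)
  then have "rk (l \<curlyvee> l') = 4" using modular[of l l'] lS l'S by simp
  then show thesis using that x l x' l' by blast
qed

text \<open>One pair of transversals settles everything. The antiflags \<open>(x, l)\<close> and
  \<open>(x', l')\<close> are full in \<open>C2\<close> and \<open>C3\<close>, and
  \<open>(l, l \<inter> H)\<close> is full in \<open>C1\<close>. The value 1 is attained at
  \<open>(x', l)\<close> in \<open>C2\<close> and \<open>C3\<close>, and at \<open>(l, x')\<close>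
  in \<open>C1\<close>.\<close>

lemma
  shows C2_not_full_lines_meet: "\<not> full_lines_meet C2"
    and C3_not_full_lines_meet: "\<not> full_lines_meet C3"
    and ex_full: "\<exists>P l. full C1 P l" "\<exists>P l. full C2 P l" "\<exists>P l. full C3 P l"
    and not_semipartial_geometry:
      "\<not> semipartial_geometry C1" "\<not> semipartial_geometry C2" "\<not> semipartial_geometry C3"
proof -
  obtain x l x' l' where x: "x \<in> G 1" "x \<subseteq> H" and l: "l \<in> G 2" "x \<subseteq> l" "\<not> l \<subseteq> H" "\<not> P0 \<subseteq> l"
    and x': "x' \<in> G 1" "x' \<subseteq> H" and l': "l' \<in> G 2" "x' \<subseteq> l'" "\<not> l' \<subseteq> H" "\<not> P0 \<subseteq> l'"
    and x'l: "\<not> x' \<subseteq> l" and r4: "rk (l \<curlyvee> l') = 4"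
    by (rule ex_skew_transversals)
  have full: "full C2 x l" "full C2 x' l'" using C2_full x l x' l' by blast+
  then have full3: "full C3 x l" "full C3 x' l'" using C3_full_line_iff l l' by blast+
  show "\<exists>P l. full C2 P l" "\<exists>P l. full C3 P l" using full full3 by blast+
  have full1: "full C1 l (l \<inter> H)" using C1_full l by blast
  then show "\<exists>P l. full C1 P l" by blast
  \<comment> \<open>Neither line is inside \<open>H\<close>, so a common point would be a plane
    containing both of them, but they span a solid.\<close>
  have no: False if R: "R \<in> points C2" "incident C2 R l" "incident C2 R l'" for R
  proof -
    have "l \<subseteq> R" "l' \<subseteq> R" using R l l' by auto
    moreover have "R \<in> Sub" "rk R \<le> 3" using R by (auto simp: G_iff)
    ultimately show False
      using r4 rk_mono[of "l \<curlyvee> l'" R] l l' by (auto simp: G_iff join_le_iff)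
  qed
  then show "\<not> full_lines_meet C2" using full unfolding full_lines_meet_def by blast
  have "\<not> (incident C3 R l \<and> incident C3 R l')" if R: "R \<in> points C3" for R
  proof -
    have "R \<in> points C2" using R by simp
    then show ?thesis
      using no[of R] C3_incident_iff[OF R l(1,4)] C3_incident_iff[OF R l'(1,4)] by blast
  qed
  then show "\<not> full_lines_meet C3" using full3 unfolding full_lines_meet_def by blast
  have conf: "symmetric_configuration C1 v_par k_par" "symmetric_configuration C2 v_par k_par"
    "symmetric_configuration C3 v_par k_par"
    using C1_strongly_regular C2_strongly_regular C3_strongly_regular
    by (simp_all add: strongly_regular_configuration_def)
  have "card {R\<in>points C1. incident C1 R x' \<and> collinear C1 l R} = 1"
    using C1_one_collinear[OF l(1,3) x' x'l] by (simp del: C1_simps)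
  then show "\<not> semipartial_geometry C1"
    using l x' x'l rank_not_subset[OF l(1) x'(1)]
    by (intro full_not_semipartial_geometry[OF conf(1) k_par_gt_1 full1, of l x']) auto
  have one: "{R\<in>points C2. incident C2 R l \<and> collinear C2 x' R} = {l \<curlyvee> x'}"
    by (rule C2_one_collinear[OF l(1,3) x' x'l])
  then have "card {R\<in>points C2. incident C2 R l \<and> collinear C2 x' R} = 1" by simp
  moreover have x'pt: "x' \<in> points C2" "x' \<in> points C3" "\<not> incident C2 x' l"
    using x' x'l l rank_not_subset[OF l(1) x'(1)] by auto
  ultimately show "\<not> semipartial_geometry C2"
    using l by (intro full_not_semipartial_geometry[OF conf(2) k_par_gt_1 full(1), of x' l]) auto
  have ninc: "\<not> incident C3 x' l" using C3_incident_iff[OF x'pt(2) l(1,4)] x'pt by blast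
  have same: "(incident C3 R l \<and> collinear C3 x' R) \<longleftrightarrow> (incident C2 R l \<and> collinear C2 x' R)"
    if R: "R \<in> points C3" for R
    using C3_incident_iff[OF R l(1,4)] C3_collinear_iff[OF x'pt(2) R] x'pt(3) by blast
  have pts: "points C2 = points C3" by simp
  have "{R\<in>points C3. incident C3 R l \<and> collinear C3 x' R} =
      {R\<in>points C2. incident C2 R l \<and> collinear C2 x' R}"
    unfolding pts using same by blast
  then have "{R\<in>points C3. incident C3 R l \<and> collinear C3 x' R} = {l \<curlyvee> x'}"
    using one by (rule trans)
  then have "card {R\<in>points C3. incident C3 R l \<and> collinear C3 x' R} = 1" by simp
  then show "\<not> semipartial_geometry C3"
    using l x'pt ninc
    by (intro full_not_semipartial_geometry[OF conf(3) k_par_gt_1 full3(1), of x' l]) auto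
qed

text \<open>Solids through \<open>P0\<close> create full antiflags whose point is a plane. Take a
  plane \<open>p\<close> off \<open>P0\<close> and the solid g spanned by both. The points of
  \<open>C3\<close> on g are the planes of g through \<open>P0\<close>; each shares with
  \<open>p\<close> a line avoiding \<open>P0\<close>, which is still a line of \<open>C3\<close>. A
  point of \<open>H\<close> off \<open>p\<close> is not collinear with \<open>p\<close>, yet it also
  belongs to a full antiflag.\<close>

lemma C3_not_full_points_collinear: "\<not> full_points_collinear C3"
proof
  assume all: "full_points_collinear C3"
  obtain m where m: "m \<in> G 2" "m \<subseteq> H" using ex_between[of Z H 2] Z_least by auto
  have mS: "m \<in> Sub" "rk m = 2" using m by (auto simp: G_iff)
  have "rk (m \<curlyvee> P0) \<le> 3" using modular[of m P0] mS by simp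
  \<comment> \<open>That \<open>y\<close> is outside \<open>H\<close> keeps the plane
    \<open>m \<curlyvee> y\<close> outside \<open>H\<close>; that it is outside
    \<open>m \<curlyvee> P0\<close> keeps \<open>P0\<close> off this plane, by exchange.\<close>
  then obtain y where y: "y \<in> G 1" "\<not> y \<subseteq> H" "\<not> y \<subseteq> m \<curlyvee> P0"
    using ex_point_avoiding2[of E H "m \<curlyvee> P0"] not_subset_rk[of E H] not_subset_rk[of E "m \<curlyvee> P0"] mS
    by auto
  have yS: "y \<in> Sub" using y by (simp add: G_iff)
  let ?p = "m \<curlyvee> y"
  have "\<not> y \<subseteq> m" using y m by blast
  then have p: "?p \<in> G 3" "?p \<in> Sub" "rk ?p = 3" "m \<subseteq> ?p" "y \<subseteq> ?p" "\<not> ?p \<subseteq> H"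
    using rk_join_atom[of m y] mS y yS join_upper1[of m y] join_upper2[of m y] by (auto simp: G_iff)
  have P0p: "\<not> P0 \<subseteq> ?p"
    using atom_join_exchange[of m y P0] mS y P0 m P0_H by blast
  let ?g = "?p \<curlyvee> P0"
  have g: "?g \<in> G 4" "P0 \<subseteq> ?g" "?p \<subseteq> ?g" "?g \<in> Sub" "rk ?g = 4"
    using rk_join_atom[of ?p P0] p P0p P0 join_upper1[of ?p P0] join_upper2[of ?p P0]
    by (auto simp: G_iff)
  have ppt: "?p \<in> points C3" using p by simp
  have "full C3 ?p ?g"
    unfolding full_def
  proof (intro conjI ballI impI)
    show "\<not> incident C3 ?p ?g" using C3_incident_solid_iff[OF ppt g(1,2)] P0p by blast
    fix Q assume Q: "Q \<in> points C3" "incident C3 Q ?g"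
    then have Q3: "Q \<in> G 3" "P0 \<subseteq> Q" "Q \<subseteq> ?g" using C3_incident_solid_iff[OF Q(1) g(1,2)] by blast+
    then have QS: "Q \<in> Sub" "rk Q = 3" by (auto simp: G_iff)
    have "rk (?p \<curlyvee> Q) \<le> 4" using rk_mono[of "?p \<curlyvee> Q" ?g] p QS Q3 g by (simp add: join_le_iff)
    \<comment> \<open>Two planes of a common solid share a line: 3 + 3 - 4 = 2.\<close>
    then have "\<exists>l\<in>G 2. Z \<subseteq> l \<and> l \<subseteq> ?p \<inter> Q"
      using modular[of ?p Q] p QS Z_least by (intro ex_between) auto
    then obtain l where l: "l \<in> G 2" "l \<subseteq> ?p" "l \<subseteq> Q" by auto
    then have "\<not> P0 \<subseteq> l" using P0p by blast
    then have "l \<in> lines C3" "incident C3 ?p l" "incident C3 Q l" using l by auto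
    then show "collinear C3 ?p Q" unfolding collinear_def by blast
  qed (use p g in auto)
  moreover obtain x where x: "x \<in> G 1" "x \<subseteq> H" "\<not> x \<subseteq> ?p"
    using ex_point_avoiding[of H ?p] not_subset_rk[of H ?p] p by auto
  have xS: "x \<in> Sub" "rk x = 1" using x by (auto simp: G_iff)
  have "rk (x \<curlyvee> P0) \<le> 4" using modular[of x P0] xS by simp
  then obtain l where l: "l \<in> G 2" "x \<subseteq> l" "\<not> l \<subseteq> H" "\<not> P0 \<subseteq> l"
    using ex_transversal_line[OF x(1,2), of "x \<curlyvee> P0"] xS join_upper1[of x P0] join_upper2[of x P0] by auto
  then have "full C3 x l" using C2_full x C3_full_line_iff by blast
  ultimately have "collinear C3 x ?p" using all by (auto simp: full_points_collinear_def)
  moreover have "x \<noteq> ?p" using x by blast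
  ultimately have "collinear C2 x ?p" using C3_collinear_iff[of x ?p] x ppt by simp
  then show False using C2_collinear_point_plane[OF x(1,2) p(1,6)] x by simp
qed

lemma pairwise_non_isomorphic:
  "\<not> isomorphic C0 C1" "\<not> isomorphic C0 C2" "\<not> isomorphic C0 C3"
  "\<not> isomorphic C1 C2" "\<not> isomorphic C1 C3" "\<not> isomorphic C2 C3"
  using isomorphic_full_invariants C0_not_full C2_not_full_lines_meet C3_not_full_lines_meet ex_full C1_full_lines_meet
    C2_full_points_collinear C3_not_full_points_collinear by blast+

end

section \<open>The four configurations together\<close>

context subspace_lattice
begin

theorem four_configurations:
  "\<exists>C. C 0 = C0 \<and>
     (\<forall>i<4. strongly_regular_configuration (C i) v_par k_par lam_par mu_par) \<and>
     (\<forall>i<4. \<forall>j<4. i \<noteq> j \<longrightarrow> \<not> isomorphic (C i) (C j)) \<and>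
     semipartial_geometry (C 0) \<and>
     (\<forall>i\<in>{1..<4::nat}. \<not> semipartial_geometry (C i))"
proof -
  \<comment> \<open>Any solid and any point off it will do.\<close>
  obtain H where H: "H \<in> G 4" using ex_between[of Z E 4] Z_least by auto
  then have "\<not> E \<subseteq> H" using rk_mono[of E H] by (auto simp: G_iff)
  then obtain P0 where P0: "P0 \<in> G 1" "\<not> P0 \<subseteq> H"
    using ex_point_avoiding[OF E_Sub G_Sub[OF H]] by blast
  interpret subspace_lattice_antiflag Sub rk join Z E q H P0
    by unfold_locales (use H P0 in auto)
  define C where "C = (\<lambda>i. [C0, C1, C2, C3] ! i)"
  have C: "C 0 = C0" "C 1 = C1" "C 2 = C2" "C 3 = C3"
    by (simp_all add: C_def eval_nat_numeral)
  have less4: "i < 4 \<longleftrightarrow> i = 0 \<or> i = 1 \<or> i = 2 \<or> i = 3" for i :: nat by auto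
  have range: "i \<in> {1..<4} \<longleftrightarrow> i = 1 \<or> i = 2 \<or> i = 3" for i :: nat by auto
  have noniso: "\<not> isomorphic (C i) (C j)" if "i < j" "j < 4" for i j
  proof -
    have "(i = 0 \<and> j = 1) \<or> (i = 0 \<and> j = 2) \<or> (i = 0 \<and> j = 3) \<or>
        (i = 1 \<and> j = 2) \<or> (i = 1 \<and> j = 3) \<or> (i = 2 \<and> j = 3)"
      using that by presburger
    then show ?thesis
      by (elim disjE conjE) (simp_all only: C pairwise_non_isomorphic not_False_eq_True)
  qed
  show ?thesis
  proof (intro exI[of _ C] conjI allI ballI impI)
    fix i :: nat assume "i < 4"
    then show "strongly_regular_configuration (C i) v_par k_par lam_par mu_par"
      unfolding less4 using C C0_strongly_regular C1_strongly_regular C2_strongly_regular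
        C3_strongly_regular by auto
    fix j :: nat assume "j < 4" "i \<noteq> j"
    then show "\<not> isomorphic (C i) (C j)"
      using noniso[of i j] noniso[of j i] isomorphic_sym[of "C i" "C j"] \<open>i < 4\<close>
      by (metis linorder_neqE_nat)
  next
    fix i :: nat assume "i \<in> {1..<4}"
    then show "\<not> semipartial_geometry (C i)"
      unfolding range using C not_semipartial_geometry by auto
  qed (simp_all add: C C0_semipartial_geometry)
qed

end

section \<open>Subspaces of a finite vector space\<close>

lemma gauss_geometric: "gauss q n * (q - 1) = q ^ n - 1"
proof (cases q)
  case (Suc p)
  have "gauss q n * p + 1 = q ^ n"
    by (induction n) (simp_all add: gauss_Suc Suc algebra_simps)
  then show ?thesis using Suc by simp
qed (cases n, simp_all)

context vectorspace
begin

lemma subspace_inter: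
  assumes "subspace K U V" "subspace K W V"
  shows "subspace K (U \<inter> W) V"
proof -
  have U: "submodule K U V" and W: "submodule K W V" using assms by auto
  have "submodule K (U \<inter> W) V"
    using U W unfolding submodule_def by auto
  then show ?thesis using assms(1) by (simp add: subspace_def)
qed

lemma subspace_subset: "subspace K U V \<Longrightarrow> U \<subseteq> carrier V"
  using is_module submodule.subset by blast

lemma card_eq_power_dim:
  assumes "finite (carrier V)"
  shows "card (carrier V) = card (carrier K) ^ dim"
proof -
  \<comment> \<open>A finite space spans itself, so it has a finite basis; coordinates with respect
    to it give the count.\<close>
  have "span (carrier V) = carrier V"
    using in_own_span[of "carrier V"] span_is_subset2[of "carrier V"] by auto
  then have fin_dim using assms by (auto simp: fin_dim_def)
  then obtain B where B: "finite B" "basis B" using finite_basis_exists by blast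
  then have BV: "B \<subseteq> carrier V" by (simp add: basis_def)
  have ex1: "\<forall>v. v \<in> carrier V \<longrightarrow> (\<exists>!a. a \<in> B \<rightarrow>\<^sub>E carrier K \<and> lincomb a B = v)"
    using basis_criterion[OF B(1) BV] B(2) by blast
  have closed: "lincomb a B \<in> carrier V" if "a \<in> B \<rightarrow>\<^sub>E carrier K" for a
    using that BV by (intro lincomb_closed) auto
  have "bij_betw (\<lambda>a. lincomb a B) (B \<rightarrow>\<^sub>E carrier K) (carrier V)"
    unfolding bij_betw_def inj_on_def
  proof (intro conjI ballI impI)
    fix a b assume "a \<in> B \<rightarrow>\<^sub>E carrier K" "b \<in> B \<rightarrow>\<^sub>E carrier K" "lincomb a B = lincomb b B"
    then show "a = b" using ex1 closed by metis
  next
    show "(\<lambda>a. lincomb a B) ` (B \<rightarrow>\<^sub>E carrier K) = carrier V"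
    proof (intro equalityI subsetI)
      fix v assume "v \<in> carrier V"
      then obtain a where "a \<in> B \<rightarrow>\<^sub>E carrier K" "lincomb a B = v" using ex1 by blast
      then show "v \<in> (\<lambda>a. lincomb a B) ` (B \<rightarrow>\<^sub>E carrier K)" by blast
    qed (use closed in blast)
  qed
  then have "card (carrier V) = card (B \<rightarrow>\<^sub>E carrier K)"
    by (simp add: bij_betw_same_card)
  then show ?thesis using B dim_basis[OF B] by (simp add: card_PiE)
qed

lemma card_subspace:
  assumes "finite (carrier V)" "subspace K W V"
  shows "card W = card (carrier K) ^ vectorspace.dim K (vs W)"
  using vectorspace.card_eq_power_dim[OF subspace_is_vs[OF assms(2)]]
    finite_subset[OF subspace_subset[OF assms(2)] assms(1)] by simp

lemma subspace_sum_eq: "subspace_sum U W = (\<lambda>(u, w). u \<oplus>\<^bsub>V\<^esub> w) ` (U \<times> W)"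
  unfolding submodule_sum_def by (rule arg_cong[of _ _ "image _"]) auto

text \<open>The fibres of addition from U x W onto U + W are translates of the set of pairs (t, -t)
  with t in the intersection. Comparing exponents of q turns this into the modular law for
  dimensions.\<close>

lemma card_subspace_sum:
  assumes fin: "finite (carrier V)" and U: "subspace K U V" and W: "subspace K W V"
  shows "card (subspace_sum U W) * card (U \<inter> W) = card U * card W"
proof -
  interpret U: submodule K U V using U by simp
  interpret W: submodule K W V using W by simp
  have finU: "finite U" and finW: "finite W"
    using fin U.subset W.subset by (auto intro: finite_subset)
  have neg: "\<ominus>\<^bsub>V\<^esub> v \<in> N" if "submodule K N V" "v \<in> N" for v N
  proof -
    interpret N: submodule K N V by fact
    have "(\<ominus>\<^bsub>K\<^esub> \<one>\<^bsub>K\<^esub>) \<odot>\<^bsub>V\<^esub> v \<in> N" using that by auto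
    moreover have "v \<in> carrier V" using N.subset that(2) by blast
    ultimately show ?thesis using smult_minus_1[of v] by simp
  qed
  have fibre: "card {x \<in> U \<times> W. (case x of (u, w) \<Rightarrow> u \<oplus>\<^bsub>V\<^esub> w) = s} = card (U \<inter> W)"
    if s: "s \<in> subspace_sum U W" for s
  proof -
    obtain u w where uw: "u \<in> U" "w \<in> W" "s = u \<oplus>\<^bsub>V\<^esub> w"
      using s by (auto simp: subspace_sum_eq)
    have c [simp]: "u \<in> carrier V" "w \<in> carrier V" using uw U.subset W.subset by auto
    have sub: "\<And>t. t \<in> U \<Longrightarrow> t \<in> carrier V" "\<And>t. t \<in> W \<Longrightarrow> t \<in> carrier V"
      using U.subset W.subset by auto
    \<comment> \<open>If x + y = u + w, then x - u = w - y. The left side is in \<open>U\<close> and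
      the right side in \<open>W\<close>, which locates the parameter t in the intersection.\<close>
    have shift: "\<ominus>\<^bsub>V\<^esub> u \<oplus>\<^bsub>V\<^esub> x = w \<oplus>\<^bsub>V\<^esub> \<ominus>\<^bsub>V\<^esub> y"
      if c': "x \<in> carrier V" "y \<in> carrier V" and "x \<oplus>\<^bsub>V\<^esub> y = s" for x y
    proof -
      have "\<ominus>\<^bsub>V\<^esub> u \<oplus>\<^bsub>V\<^esub> x = \<ominus>\<^bsub>V\<^esub> u \<oplus>\<^bsub>V\<^esub> ((x \<oplus>\<^bsub>V\<^esub> y) \<oplus>\<^bsub>V\<^esub> \<ominus>\<^bsub>V\<^esub> y)"
        using c' by (simp add: M.a_assoc M.r_neg)
      also have "\<dots> = \<ominus>\<^bsub>V\<^esub> u \<oplus>\<^bsub>V\<^esub> (u \<oplus>\<^bsub>V\<^esub> (w \<oplus>\<^bsub>V\<^esub> \<ominus>\<^bsub>V\<^esub> y))"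
        using that uw(3) by (simp add: M.a_assoc)
      also have "\<dots> = w \<oplus>\<^bsub>V\<^esub> \<ominus>\<^bsub>V\<^esub> y"
        using c' by (simp add: M.r_neg1)
      finally show ?thesis .
    qed
    have "bij_betw (\<lambda>t. (u \<oplus>\<^bsub>V\<^esub> t, w \<oplus>\<^bsub>V\<^esub> (\<ominus>\<^bsub>V\<^esub> t))) (U \<inter> W)
        {x \<in> U \<times> W. (case x of (u, w) \<Rightarrow> u \<oplus>\<^bsub>V\<^esub> w) = s}"
    proof (rule bij_betw_byWitness[where f' = "\<lambda>(x, y). (\<ominus>\<^bsub>V\<^esub> u) \<oplus>\<^bsub>V\<^esub> x"])
      show "\<forall>t\<in>U \<inter> W. (case (u \<oplus>\<^bsub>V\<^esub> t, w \<oplus>\<^bsub>V\<^esub> \<ominus>\<^bsub>V\<^esub> t) of (x, y) \<Rightarrow> \<ominus>\<^bsub>V\<^esub> u \<oplus>\<^bsub>V\<^esub> x) = t"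
        using sub by (auto simp: M.r_neg1)
      show "\<forall>a'\<in>{x \<in> U \<times> W. (case x of (u, w) \<Rightarrow> u \<oplus>\<^bsub>V\<^esub> w) = s}.
          (u \<oplus>\<^bsub>V\<^esub> (case a' of (x, y) \<Rightarrow> \<ominus>\<^bsub>V\<^esub> u \<oplus>\<^bsub>V\<^esub> x), w \<oplus>\<^bsub>V\<^esub> \<ominus>\<^bsub>V\<^esub> (case a' of (x, y) \<Rightarrow> \<ominus>\<^bsub>V\<^esub> u \<oplus>\<^bsub>V\<^esub> x)) = a'"
      proof
        fix z assume "z \<in> {x \<in> U \<times> W. (case x of (u, w) \<Rightarrow> u \<oplus>\<^bsub>V\<^esub> w) = s}"
        then obtain x y where z: "z = (x, y)" and xy: "x \<in> U" "y \<in> W" "x \<oplus>\<^bsub>V\<^esub> y = s"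
          by auto
        have c: "x \<in> carrier V" "y \<in> carrier V" using xy sub by auto
        have "u \<oplus>\<^bsub>V\<^esub> (\<ominus>\<^bsub>V\<^esub> u \<oplus>\<^bsub>V\<^esub> x) = x" using c by (simp add: M.r_neg2)
        moreover have "w \<oplus>\<^bsub>V\<^esub> \<ominus>\<^bsub>V\<^esub> (\<ominus>\<^bsub>V\<^esub> u \<oplus>\<^bsub>V\<^esub> x) = y"
          using c shift[OF c xy(3)] by (simp add: M.minus_add M.r_neg2)
        ultimately show "(u \<oplus>\<^bsub>V\<^esub> (case z of (x, y) \<Rightarrow> \<ominus>\<^bsub>V\<^esub> u \<oplus>\<^bsub>V\<^esub> x),
            w \<oplus>\<^bsub>V\<^esub> \<ominus>\<^bsub>V\<^esub> (case z of (x, y) \<Rightarrow> \<ominus>\<^bsub>V\<^esub> u \<oplus>\<^bsub>V\<^esub> x)) = z"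
          by (simp add: z)
      qed
      show "(\<lambda>t. (u \<oplus>\<^bsub>V\<^esub> t, w \<oplus>\<^bsub>V\<^esub> \<ominus>\<^bsub>V\<^esub> t)) ` (U \<inter> W) \<subseteq> {x \<in> U \<times> W. (case x of (u, w) \<Rightarrow> u \<oplus>\<^bsub>V\<^esub> w) = s}"
      proof (intro image_subsetI)
        fix t assume "t \<in> U \<inter> W"
        then have t: "t \<in> U" "t \<in> W" by auto
        have c: "t \<in> carrier V" using t sub by auto
        have "u \<oplus>\<^bsub>V\<^esub> t \<in> U" "w \<oplus>\<^bsub>V\<^esub> \<ominus>\<^bsub>V\<^esub> t \<in> W" using t uw neg W.submodule_axioms by auto
        moreover have "u \<oplus>\<^bsub>V\<^esub> t \<oplus>\<^bsub>V\<^esub> (w \<oplus>\<^bsub>V\<^esub> \<ominus>\<^bsub>V\<^esub> t) = (u \<oplus>\<^bsub>V\<^esub> w) \<oplus>\<^bsub>V\<^esub> (t \<oplus>\<^bsub>V\<^esub> \<ominus>\<^bsub>V\<^esub> t)"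
          using c by (simp add: M.a_ac)
        ultimately show "(u \<oplus>\<^bsub>V\<^esub> t, w \<oplus>\<^bsub>V\<^esub> \<ominus>\<^bsub>V\<^esub> t) \<in> {x \<in> U \<times> W. (case x of (u, w) \<Rightarrow> u \<oplus>\<^bsub>V\<^esub> w) = s}"
          using c uw(3) by (simp add: M.r_neg)
      qed
      show "(\<lambda>(x, y). \<ominus>\<^bsub>V\<^esub> u \<oplus>\<^bsub>V\<^esub> x) ` {x \<in> U \<times> W. (case x of (u, w) \<Rightarrow> u \<oplus>\<^bsub>V\<^esub> w) = s} \<subseteq> U \<inter> W"
      proof (intro image_subsetI)
        fix z assume "z \<in> {x \<in> U \<times> W. (case x of (u, w) \<Rightarrow> u \<oplus>\<^bsub>V\<^esub> w) = s}"
        then obtain x y where z: "z = (x, y)" and xy: "x \<in> U" "y \<in> W" "x \<oplus>\<^bsub>V\<^esub> y = s"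
          by auto
        have c: "x \<in> carrier V" "y \<in> carrier V" using xy sub by auto
        have "\<ominus>\<^bsub>V\<^esub> u \<oplus>\<^bsub>V\<^esub> x \<in> U" using xy uw neg U.submodule_axioms by auto
        moreover have "\<ominus>\<^bsub>V\<^esub> u \<oplus>\<^bsub>V\<^esub> x \<in> W"
          unfolding shift[OF c xy(3)] using xy uw neg W.submodule_axioms by auto
        ultimately show "(case z of (x, y) \<Rightarrow> \<ominus>\<^bsub>V\<^esub> u \<oplus>\<^bsub>V\<^esub> x) \<in> U \<inter> W"
          by (simp add: z)
      qed
    qed
    then show ?thesis by (simp add: bij_betw_same_card)
  qed
  have "card U * card W = card (U \<times> W)" by (simp add: card_cartesian_product)
  also have "\<dots> = (\<Sum>s\<in>subspace_sum U W. card {x \<in> U \<times> W. (case x of (u, w) \<Rightarrow> u \<oplus>\<^bsub>V\<^esub> w) = s})"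
    unfolding subspace_sum_eq card_eq_sum
    by (rule sum.image_gen) (use finU finW in simp)
  also have "\<dots> = card (subspace_sum U W) * card (U \<inter> W)"
    using fibre by simp
  finally show ?thesis by simp
qed

lemma order_ge_2:
  assumes "finite (carrier K)"
  shows "card (carrier K) \<ge> 2"
  using card_mono[OF assms, of "{\<zero>\<^bsub>K\<^esub>, \<one>\<^bsub>K\<^esub>}"] by simp

end

text \<open>Over a finite field a subspace of dimension d has q^d elements, so inequalities and
  identities between dimensions are derived from cardinalities instead of extending bases.\<close>

locale finite_vectorspace = vectorspace +
  assumes finite_V: "finite (carrier V)" and finite_K: "finite (carrier K)"
begin

abbreviation q where "q \<equiv> card (carrier K)"
abbreviation sdim where "sdim W \<equiv> vectorspace.dim K (vs W)"

lemmas q_ge_2 = order_ge_2[OF finite_K]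

lemma finite_subspace: "subspace K W V \<Longrightarrow> finite W"
  using subspace_subset finite_V finite_subset by blast

lemma card_subspace_eq: "subspace K W V \<Longrightarrow> card W = q ^ sdim W"
  by (rule card_subspace[OF finite_V])

lemma sdim_le_iff:
  "subspace K U V \<Longrightarrow> subspace K W V \<Longrightarrow> sdim U \<le> sdim W \<longleftrightarrow> card U \<le> card W"
  using q_ge_2 by (simp add: card_subspace_eq)

lemma sdim_mono:
  assumes "subspace K U V" "subspace K W V" "U \<subseteq> W"
  shows "sdim U \<le> sdim W"
  using assms sdim_le_iff card_mono finite_subspace by blast

lemma sdim_eq:
  assumes "subspace K U V" "subspace K W V" "U \<subseteq> W" "sdim W \<le> sdim U"
  shows "U = W"
  using assms sdim_le_iff card_seteq finite_subspace by metis

lemma sdim_modular: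
  assumes "subspace K U V" "subspace K W V"
  shows "sdim (subspace_sum U W) + sdim (U \<inter> W) = sdim U + sdim W"
proof -
  have "q ^ (sdim (subspace_sum U W) + sdim (U \<inter> W)) = q ^ (sdim U + sdim W)"
    using card_subspace_sum[OF finite_V assms] sum_is_subspace[OF assms] subspace_inter[OF assms] assms
    by (simp add: card_subspace_eq power_add)
  then show ?thesis using q_ge_2 by simp
qed

lemma subspace_zero: "subspace K {\<zero>\<^bsub>V\<^esub>} V" and sdim_zero: "sdim {\<zero>\<^bsub>V\<^esub>} = 0"
proof -
  show *: "subspace K {\<zero>\<^bsub>V\<^esub>} V" using span_is_subspace[of "{}"] by (simp add: span_empty)
  have "q ^ sdim {\<zero>\<^bsub>V\<^esub>} = 1" using card_subspace_eq[OF *] by simp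
  then show "sdim {\<zero>\<^bsub>V\<^esub>} = 0" using q_ge_2 by simp
qed

lemma zero_subset: "subspace K W V \<Longrightarrow> {\<zero>\<^bsub>V\<^esub>} \<subseteq> W"
  using is_module submodule.zero_closed by blast

lemma subspace_carrier: "subspace K (carrier V) V"
proof -
  have "span (carrier V) = carrier V"
    using in_own_span[of "carrier V"] span_is_subset2[of "carrier V"] by auto
  then show ?thesis using span_is_subspace[of "carrier V"] by simp
qed

lemma span_singleton:
  assumes v: "v \<in> carrier V" "v \<noteq> \<zero>\<^bsub>V\<^esub>"
  shows "subspace K (span {v}) V" "v \<in> span {v}" "sdim (span {v}) = 1"
proof -
  show sub: "subspace K (span {v}) V" using v by (intro span_is_subspace) simp
  show mem: "v \<in> span {v}" using in_own_span[of "{v}"] v by simp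
  have "span {v} \<subseteq> (\<lambda>c. c \<odot>\<^bsub>V\<^esub> v) ` carrier K"
  proof
    fix w assume "w \<in> span {v}"
    then obtain a where "a \<in> {v} \<rightarrow> carrier K" "lincomb a {v} = w"
      using finite_in_span[of "{v}" w] v by auto
    then have "w = a v \<odot>\<^bsub>V\<^esub> v" "a v \<in> carrier K"
      using v by (auto simp: lincomb_def)
    then show "w \<in> (\<lambda>c. c \<odot>\<^bsub>V\<^esub> v) ` carrier K" by blast
  qed
  then have "card (span {v}) \<le> q"
    by (meson card_image_le card_mono finite_K finite_imageI le_trans)
  then have "q ^ sdim (span {v}) \<le> q ^ 1" using card_subspace_eq[OF sub] by simp
  then have "sdim (span {v}) \<le> 1" using q_ge_2 by (subst (asm) power_increasing_iff) auto
  moreover have "sdim (span {v}) \<noteq> 0"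
  proof
    assume "sdim (span {v}) = 0"
    then have "{\<zero>\<^bsub>V\<^esub>} = span {v}"
      using sdim_eq[OF subspace_zero sub zero_subset[OF sub]] by simp
    then show False using mem v by auto
  qed
  ultimately show "sdim (span {v}) = 1" by simp
qed

lemma sdim_sum_span:
  assumes U: "subspace K U V" and v: "v \<in> carrier V" "v \<notin> U"
  shows "sdim (subspace_sum U (span {v})) = Suc (sdim U)"
proof -
  have v0: "v \<noteq> \<zero>\<^bsub>V\<^esub>" using v zero_subset[OF U] by auto
  note sp = span_singleton[OF v(1) v0]
  have "sdim (U \<inter> span {v}) \<noteq> 1"
  proof
    assume "sdim (U \<inter> span {v}) = 1"
    then have "U \<inter> span {v} = span {v}"
      using sp by (intro sdim_eq subspace_inter U) auto
    then show False using sp(2) v by auto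
  qed
  moreover have "sdim (U \<inter> span {v}) \<le> 1"
    using sdim_mono[OF subspace_inter[OF U sp(1)] sp(1)] sp(3) by simp
  ultimately show ?thesis using sdim_modular[OF U sp(1)] sp(3) by simp
qed

text \<open>Pairs of a cover \<open>S\<close> of \<open>U\<close> inside \<open>W\<close> and a
  vector v of \<open>S\<close> outside \<open>U\<close> are counted twice: v determines
  \<open>S\<close> as the sum of \<open>U\<close> and its span, and each \<open>S\<close> has
  q^(d+1) - q^d such vectors, d being the dimension of \<open>U\<close>. Cancelling q^d (q - 1)
  leaves the geometric sum.\<close>

lemma card_subspaces_above:
  assumes U: "subspace K U V" and W: "subspace K W V" and UW: "U \<subseteq> W"
  shows "card {S. subspace K S V \<and> U \<subseteq> S \<and> S \<subseteq> W \<and> sdim S = Suc (sdim U)} = gauss q (sdim W - sdim U)"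
proof -
  let ?A = "{S. subspace K S V \<and> U \<subseteq> S \<and> S \<subseteq> W \<and> sdim S = Suc (sdim U)}"
  let ?d = "sdim U" and ?e = "sdim W"
  have finA: "finite ?A"
    by (rule finite_subset[of _ "Pow (carrier V)"]) (use subspace_subset finite_V in auto)
  have "card ?A * (q ^ Suc ?d - q ^ ?d) = card (W - U) * 1"
  proof (rule double_counting[where R = "\<lambda>S v. v \<in> S"])
    fix S assume "S \<in> ?A"
    then have S: "subspace K S V" "U \<subseteq> S" "S \<subseteq> W" "sdim S = Suc ?d" by auto
    have "{v \<in> W - U. v \<in> S} = S - U" using S by auto
    also have "card \<dots> = card S - card U"
      using S finite_subspace[OF U] by (intro card_Diff_subset) auto
    finally show "card {v \<in> W - U. v \<in> S} = q ^ Suc ?d - q ^ ?d"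
      using card_subspace_eq[OF S(1)] card_subspace_eq[OF U] S(4) by simp
  next
    fix v assume v: "v \<in> W - U"
    then have vV: "v \<in> carrier V" "v \<notin> U" using subspace_subset[OF W] by auto
    have v0: "v \<noteq> \<zero>\<^bsub>V\<^esub>" using vV zero_subset[OF U] by auto
    note sp = span_singleton[OF vV(1) v0]
    let ?S = "subspace_sum U (span {v})"
    have S: "subspace K ?S V" by (rule sum_is_subspace[OF U sp(1)])
    have "v \<in> ?S" using in_sum_vs[OF sp(1) U] vsum_comm[OF U sp(1)] sp(2) by auto
    have span_sub: "span {v} \<subseteq> T" if "subspace K T V" "v \<in> T" for T
      using that span_is_subset[of "{v}" T] by auto
    have "{S \<in> ?A. v \<in> S} = {?S}"
    proof (intro equalityI subsetI)
      fix T assume "T \<in> {S \<in> ?A. v \<in> S}"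
      then have T: "subspace K T V" "U \<subseteq> T" "sdim T = Suc ?d" "v \<in> T" by auto
      then have "?S \<subseteq> T" using vsum_is_minimal[OF U sp(1) T(1)] span_sub by simp
      then have "?S = T" using sdim_eq[OF S T(1)] sdim_sum_span[OF U vV] T by simp
      then show "T \<in> {?S}" by simp
    next
      fix T assume "T \<in> {?S}"
      moreover have "?S \<subseteq> W" using vsum_is_minimal[OF U sp(1) W] UW span_sub[OF W] v by simp
      ultimately show "T \<in> {S \<in> ?A. v \<in> S}"
        using S \<open>v \<in> ?S\<close> in_sum_vs[OF U sp(1)] sdim_sum_span[OF U vV] by simp
    qed
    then show "card {S \<in> ?A. v \<in> S} = 1" by simp
  qed (use finA finite_subspace[OF W] in auto)
  also have "card (W - U) = q ^ ?e - q ^ ?d"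
    using card_Diff_subset[OF finite_subspace[OF U] UW] card_subspace_eq[OF U] card_subspace_eq[OF W] by simp
  finally have "card ?A * (q ^ Suc ?d - q ^ ?d) = q ^ ?e - q ^ ?d" by simp
  moreover have "q ^ Suc ?d - q ^ ?d = q ^ ?d * (q - 1)"
    by (simp add: algebra_simps diff_mult_distrib2)
  moreover have "q ^ ?e - q ^ ?d = q ^ ?d * (gauss q (?e - ?d) * (q - 1))"
  proof -
    have "q ^ ?d * q ^ (?e - ?d) = q ^ ?e"
      using sdim_mono[OF U W UW] by (simp flip: power_add)
    then show ?thesis unfolding gauss_geometric by (simp only: diff_mult_distrib2 mult_1_right)
  qed
  ultimately have "(q ^ ?d * (q - 1)) * card ?A = (q ^ ?d * (q - 1)) * gauss q (?e - ?d)"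
    by (simp only: ac_simps)
  then show ?thesis using q_ge_2 by simp
qed

end

text \<open>The index set \<open>{..4}\<close> has five elements, which is where rank 5 comes
  from.\<close>

lemma projective_4_space_lattice:
  fixes F :: "('a, 'm) ring_scheme"
  assumes "field F" and q: "order F = q" and "q > 0"
  defines "V \<equiv> ring.func_space F {..4::nat}"
  shows "subspace_lattice {W. VectorSpace.subspace F W V} (\<lambda>W. vectorspace.dim F (V\<lparr>carrier := W\<rparr>))
    (module.submodule_sum V) {\<zero>\<^bsub>V\<^esub>} (carrier V) q"
proof -
  interpret F: field F by fact
  \<comment> \<open>The order is a cardinality, hence 0 for an infinite carrier; positivity of
    \<open>q\<close> therefore gives finiteness.\<close>
  have finF: "finite (carrier F)" using q \<open>q > 0\<close> card_ge_0_finite by (auto simp: Coset.order_def)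
  have carV: "carrier V = {..4} \<rightarrow>\<^sub>E carrier F" by (simp add: V_def F.func_space_def)
  have "module F V" unfolding V_def by (rule F.func_space_is_module)
  then interpret V: finite_vectorspace F V
    by (intro finite_vectorspace.intro vectorspace.intro finite_vectorspace_axioms.intro)
      (use finF assms(1) in \<open>auto simp: carV intro: finite_PiE\<close>)
  have card: "V.q = q" using q by (simp add: Coset.order_def)
  have "q ^ V.sdim (carrier V) = q ^ 5"
    using V.card_subspace_eq[OF V.subspace_carrier] card by (simp add: carV card_PiE)
  then have dim5: "V.sdim (carrier V) = 5" using V.q_ge_2 card by simp
  show ?thesis
  proof
    show "finite {W. VectorSpace.subspace F W V}"
      by (rule finite_subset[of _ "Pow (carrier V)"]) (use V.subspace_subset V.finite_V in auto)
  next
    fix U W assume UW: "U \<in> {W. VectorSpace.subspace F W V}" "W \<in> {W. VectorSpace.subspace F W V}"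
    then have UW': "VectorSpace.subspace F U V" "VectorSpace.subspace F W V" by auto
    show "U \<subseteq> W \<Longrightarrow> card {S \<in> {W. VectorSpace.subspace F W V}. U \<subseteq> S \<and> S \<subseteq> W \<and> V.sdim S = Suc (V.sdim U)} =
        gauss q (V.sdim W - V.sdim U)"
      using V.card_subspaces_above[OF UW'] by (simp add: card)
    show "W \<subseteq> V.subspace_sum U W"
      using V.in_sum_vs[OF UW'(2,1)] V.vsum_comm[OF UW'] by simp
    show "U \<inter> W \<in> {W. VectorSpace.subspace F W V}" using V.subspace_inter[OF UW'] by simp
    show "V.subspace_sum U W \<in> {W. VectorSpace.subspace F W V}" using V.sum_is_subspace[OF UW'] by simp
    show "U \<subseteq> V.subspace_sum U W" by (rule V.in_sum_vs[OF UW'])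
    show "V.sdim (V.subspace_sum U W) + V.sdim (U \<inter> W) = V.sdim U + V.sdim W"
      by (rule V.sdim_modular[OF UW'])
    show "U \<subseteq> W \<Longrightarrow> V.sdim U \<le> V.sdim W" by (rule V.sdim_mono[OF UW'])
    show "U \<subseteq> W \<Longrightarrow> V.sdim W \<le> V.sdim U \<Longrightarrow> U = W" by (rule V.sdim_eq[OF UW'])
    fix S assume "S \<in> {W. VectorSpace.subspace F W V}" "U \<subseteq> S" "W \<subseteq> S"
    then show "V.subspace_sum U W \<subseteq> S" using V.vsum_is_minimal[OF UW', of S] by simp
  next
    fix U assume "U \<in> {W. VectorSpace.subspace F W V}"
    then have U: "VectorSpace.subspace F U V" by simp
    show "{\<zero>\<^bsub>V\<^esub>} \<subseteq> U" by (rule V.zero_subset[OF U])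
    show "U \<subseteq> carrier V" by (rule V.subspace_subset[OF U])
  next
    show "2 \<le> q" using V.q_ge_2 card by simp
    show "{\<zero>\<^bsub>V\<^esub>} \<in> {W. VectorSpace.subspace F W V}" "carrier V \<in> {W. VectorSpace.subspace F W V}"
      using V.subspace_zero V.subspace_carrier by simp_all
  qed (rule V.sdim_zero dim5)+
qed

section \<open>Existence of finite fields\<close>

lemma (in cring) binomial_expansion:
  assumes x: "x \<in> carrier R" and y: "y \<in> carrier R"
  shows "(x \<oplus> y) [^] (n::nat) = (\<Oplus>k\<in>{..n}. add_pow R (n choose k) (x [^] k \<otimes> y [^] (n - k)))"
proof (induction n)
  case 0
  then show ?case by simp
next
  case (Suc n)
  let ?b = "\<lambda>k. add_pow R (n choose k) (x [^] k \<otimes> y [^] (n - k))"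
  let ?c = "\<lambda>k. add_pow R (n choose k) (x [^] k \<otimes> y [^] (Suc n - k))"
  let ?d = "\<lambda>k. add_pow R (Suc n choose k) (x [^] k \<otimes> y [^] (Suc n - k))"
  have cl: "\<And>m i j. add_pow R (m::nat) (x [^] (i::nat) \<otimes> y [^] (j::nat)) \<in> carrier R"
    using x y by simp
  have "y \<otimes> (\<Oplus>k\<in>{..n}. ?b k) = (\<Oplus>k\<in>{..n}. y \<otimes> ?b k)"
    using x y by (intro finsum_rdistr) auto
  also have "\<dots> = (\<Oplus>k\<in>{..n}. ?c k)"
  proof (rule add.finprod_cong')
    fix k assume "k \<in> {..n}"
    then have "Suc n - k = Suc (n - k)" by auto
    then show "y \<otimes> ?b k = ?c k"
      using x y by (simp add: add_pow_rdistr m_ac)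
  qed (use cl in auto)
  \<comment> \<open>The added term k = Suc n has coefficient \<open>n choose Suc n\<close>, which is
    0. Splitting off k = 0 instead aligns the sums for Pascal's rule.\<close>
  also have "\<dots> = (\<Oplus>k\<in>{..Suc n}. ?c k)"
    using cl finsum_closed[of ?c "{..n}"] by (subst finsum_Suc) (auto simp: add.nat_pow_0 binomial_eq_0)
  also have "\<dots> = (\<Oplus>k\<in>{..n}. ?c (Suc k)) \<oplus> ?c 0"
    using cl by (subst finsum_Suc2) auto
  finally have yS: "y \<otimes> (\<Oplus>k\<in>{..n}. ?b k) = (\<Oplus>k\<in>{..n}. ?c (Suc k)) \<oplus> ?c 0" .
  have xS: "x \<otimes> (\<Oplus>k\<in>{..n}. ?b k) = (\<Oplus>k\<in>{..n}. x \<otimes> ?b k)"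
    using x y by (intro finsum_rdistr) auto
  have "(\<Oplus>k\<in>{..Suc n}. ?d k) = (\<Oplus>k\<in>{..n}. ?d (Suc k)) \<oplus> ?d 0"
    using cl by (subst finsum_Suc2) auto
  also have "(\<Oplus>k\<in>{..n}. ?d (Suc k)) = (\<Oplus>k\<in>{..n}. x \<otimes> ?b k \<oplus> ?c (Suc k))"
  proof (rule add.finprod_cong')
    fix k assume "k \<in> {..n}"
    show "?d (Suc k) = x \<otimes> ?b k \<oplus> ?c (Suc k)"
      using x y by (simp add: add_pow_rdistr m_ac flip: add.nat_pow_mult)
  qed (use x y cl in auto)
  also have "\<dots> = (\<Oplus>k\<in>{..n}. x \<otimes> ?b k) \<oplus> (\<Oplus>k\<in>{..n}. ?c (Suc k))"
    using x y cl by (intro finsum_addf) auto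
  finally have "(\<Oplus>k\<in>{..Suc n}. ?d k) = x \<otimes> (\<Oplus>k\<in>{..n}. ?b k) \<oplus> y \<otimes> (\<Oplus>k\<in>{..n}. ?b k)"
    unfolding yS xS using cl x y by (simp add: a_assoc finsum_closed)
  also have "\<dots> = (x \<oplus> y) \<otimes> (\<Oplus>k\<in>{..n}. ?b k)"
    using x y cl by (intro l_distr[symmetric] finsum_closed) auto
  also have "\<dots> = (x \<oplus> y) [^] Suc n"
    unfolding Suc.IH[symmetric] using x y by (simp add: m_comm)
  finally show ?case by simp
qed

lemma (in cring) freshmans_dream:
  assumes p: "prime (p::nat)" and char: "add_pow R (p) \<one> = \<zero>"
    and x: "x \<in> carrier R" and y: "y \<in> carrier R"
  shows "(x \<oplus> y) [^] p = x [^] p \<oplus> y [^] p"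
proof -
  let ?d = "\<lambda>k. add_pow R (p choose k) (x [^] k \<otimes> y [^] (p - k))"
  have cl: "?d k \<in> carrier R" for k using x y by simp
  have pz: "add_pow R (p) z = \<zero>" if "z \<in> carrier R" for z
    using add_pow_ldistr[of \<one> z p] that char by simp
  have "add_pow R (p choose k) z = \<zero>" if k: "0 < k" "k < p" "z \<in> carrier R" for k z
  proof -
    obtain m where "p choose k = p * m" using dvd_choose_prime[of k p] k p by auto
    then show ?thesis using pz[of "add_pow R (m) z"] k by (simp add: add.nat_pow_pow mult.commute)
  qed
  then have zero: "?d k = \<zero>" if "k \<in> {0<..<p}" for k using that x y by simp
  obtain n where n: "p = Suc n" using p prime_gt_0_nat[of p] gr0_implies_Suc by blast
  have "(x \<oplus> y) [^] p = (\<Oplus>k\<in>{..p}. ?d k)" by (rule binomial_expansion[OF x y])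
  also have "\<dots> = ?d p \<oplus> (\<Oplus>k\<in>{..n}. ?d k)"
    unfolding n using x y by (intro finsum_Suc) auto
  also have "(\<Oplus>k\<in>{..n}. ?d k) = (\<Oplus>k\<in>{..n}. if k = 0 then y [^] p else \<zero>)"
    using zero x y n by (intro add.finprod_cong') auto
  also have "\<dots> = y [^] p"
    using add.finprod_singleton[of 0 "{..n}" "\<lambda>_. y [^] p"] y by (simp add: eq_commute)
  finally show ?thesis using x y by simp
qed

lemma (in cring) freshmans_dream_power:
  assumes "prime (p::nat)" "add_pow R (p) \<one> = \<zero>" "x \<in> carrier R" "y \<in> carrier R"
  shows "(x \<oplus> y) [^] (p ^ n) = x [^] (p ^ n) \<oplus> y [^] (p ^ n)"
proof (induction n)
  case (Suc n)
  have "(x \<oplus> y) [^] (p ^ Suc n) = ((x \<oplus> y) [^] (p ^ n)) [^] p"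
    using assms by (simp add: nat_pow_pow mult.commute)
  also have "\<dots> = (x [^] (p ^ n)) [^] p \<oplus> (y [^] (p ^ n)) [^] p"
    unfolding Suc using assms by (intro freshmans_dream) auto
  finally show ?case using assms by (simp add: nat_pow_pow mult.commute)
qed (use assms in simp)

lemma (in ring_hom_ring) hom_add_pow_nat:
  assumes "x \<in> carrier R"
  shows "h (add_pow R (n::nat) x) = add_pow S n (h x)"
  using assms by (induction n) (simp_all add: R.add.nat_pow_Suc S.add.nat_pow_Suc)

lemma (in residues) add_pow_one: "add_pow R (n::nat) \<one> = int n mod m"
proof (induction n)
  case (Suc n)
  then show ?case by (simp add: add.nat_pow_Suc res_add_eq res_one_eq mod_simps add.commute)
qed (simp add: res_zero_eq)

section \<open>Solutions of x^q = x in an algebraically closed field of characteristic p\<close>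

locale algebraically_closed_char = algebraically_closed +
  fixes p :: nat
  assumes prime_p: "prime p" and char: "add_pow L p \<one> = \<zero>"
begin

text \<open>If \<open>a [^] q = a\<close>, then with \<open>D = X - a\<close> the polynomial \<open>X [^] q - X\<close> equals \<open>D [^] q - D\<close>,
  which is not divisible by \<open>D [^] 2\<close>.\<close>

lemma card_fixed_points:
  assumes q: "q = p ^ n" and n: "n > 0"
  shows "card {a \<in> carrier L. a [^] q = a} = q"
proof -
  interpret UP: domain "poly_ring L" using univ_poly_is_domain[OF carrier_is_subring] .
  let ?UP = "poly_ring L"
  interpret const: ring_hom_ring L ?UP poly_of_const
    using canonical_embedding_ring_hom[OF carrier_is_subring] by simp
  have charUP: "add_pow ?UP p \<one>\<^bsub>?UP\<^esub> = \<zero>\<^bsub>?UP\<^esub>"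
    using const.hom_add_pow_nat[OF one_closed, of p] char by simp
  have q1: "q > 1" using prime_p n q prime_gt_1_nat one_less_power by blast
  define P where "P = X [^]\<^bsub>?UP\<^esub> q \<ominus>\<^bsub>?UP\<^esub> X"
  have X: "X \<in> carrier ?UP" by (rule var_closed(1)[OF carrier_is_subring])
  have P: "P \<in> carrier ?UP" using X by (simp add: P_def)
  have eval: "eval P a = a [^] q \<ominus> a" if a: "a \<in> carrier L" for a
  proof -
    interpret ev: ring_hom_ring ?UP L "\<lambda>f. eval f a" by (rule eval_ring_hom[OF carrier_is_subring a])
    show ?thesis using X a by (simp add: P_def a_minus_def eval_var ev.hom_nat_pow)
  qed
  have degree: "degree P = q"
  proof -
    have mq: "degree (X [^]\<^bsub>?UP\<^esub> q) = q"
      unfolding unitary_monom_eq_var_pow[OF carrier_is_subring, symmetric] by (simp add: monom_def)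
    have inv: "degree (\<ominus>\<^bsub>?UP\<^esub> X) = 1"
      using univ_poly_a_inv_degree[OF carrier_is_subring X] by (simp add: var_def)
    have "degree P = max (degree (X [^]\<^bsub>?UP\<^esub> q)) (degree (\<ominus>\<^bsub>?UP\<^esub> X))"
      unfolding P_def a_minus_def univ_poly_add
      using X mq inv q1
      by (intro poly_add_degree_eq[OF carrier_is_subring]) (auto simp: univ_poly_carrier)
    then show ?thesis using mq inv q1 by simp
  qed
  then have P0: "P \<noteq> []" using q1 by auto
  have root: "is_root P a \<longleftrightarrow> a \<in> carrier L \<and> a [^] q = a" for a
    using eval P0 by (auto simp: is_root_def)
  have mult1: "alg_mult P a \<le> 1" if "is_root P a" for a
  proof (rule ccontr)
    assume "\<not> alg_mult P a \<le> 1"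
    have a: "a \<in> carrier L" "a [^] q = a" using that root by auto
    define D C where "D = [\<one>, \<ominus> a]" and "C = poly_of_const a"
    have D: "D \<in> carrier ?UP" using a unfolding D_def univ_poly_carrier[symmetric] polynomial_def by auto
    have C: "C \<in> carrier ?UP" unfolding C_def using a by simp
    have "X = D \<oplus>\<^bsub>?UP\<^esub> C"
      using a unfolding D_def C_def var_def poly_of_const_def univ_poly_add by (auto simp: l_neg)
    then have "D = X \<ominus>\<^bsub>?UP\<^esub> C" using D C X by (simp add: UP.minus_eq UP.a_assoc UP.r_neg)
    have Cq: "C [^]\<^bsub>?UP\<^esub> q = C" unfolding C_def using a by (simp flip: const.hom_nat_pow)
    have "X [^]\<^bsub>?UP\<^esub> q = D [^]\<^bsub>?UP\<^esub> q \<oplus>\<^bsub>?UP\<^esub> C"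
      unfolding \<open>X = D \<oplus>\<^bsub>?UP\<^esub> C\<close> q using UP.freshmans_dream_power[OF prime_p charUP D C, of n] Cq q by simp
    then have "P = (D [^]\<^bsub>?UP\<^esub> q \<oplus>\<^bsub>?UP\<^esub> C) \<ominus>\<^bsub>?UP\<^esub> (D \<oplus>\<^bsub>?UP\<^esub> C)"
      using \<open>X = D \<oplus>\<^bsub>?UP\<^esub> C\<close> by (simp add: P_def)
    also have "\<dots> = D [^]\<^bsub>?UP\<^esub> q \<ominus>\<^bsub>?UP\<^esub> D"
      using D C by (simp add: UP.minus_eq UP.minus_add UP.a_ac UP.r_neg UP.r_neg1 UP.r_neg2)
    also have "\<dots> = D \<otimes>\<^bsub>?UP\<^esub> (D [^]\<^bsub>?UP\<^esub> (q - 1) \<ominus>\<^bsub>?UP\<^esub> \<one>\<^bsub>?UP\<^esub>)"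
    proof -
      have "D [^]\<^bsub>?UP\<^esub> q = D \<otimes>\<^bsub>?UP\<^esub> D [^]\<^bsub>?UP\<^esub> (q - 1)"
        using q1 D UP.nat_pow_Suc2[OF D, of "q - 1"] by simp
      then show ?thesis using D by (simp add: UP.minus_eq UP.r_distr UP.r_minus)
    qed
    finally have PD: "P = D \<otimes>\<^bsub>?UP\<^esub> (D [^]\<^bsub>?UP\<^esub> (q - 1) \<ominus>\<^bsub>?UP\<^esub> \<one>\<^bsub>?UP\<^esub>)" .
    have "(D [^]\<^bsub>?UP\<^esub> (2::nat)) pdivides P"
      using le_alg_mult_imp_pdivides[OF a(1) P, of 2] \<open>\<not> alg_mult P a \<le> 1\<close> by (simp add: D_def)
    then obtain h where h: "h \<in> carrier ?UP" "P = D [^]\<^bsub>?UP\<^esub> (2::nat) \<otimes>\<^bsub>?UP\<^esub> h"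
      unfolding pdivides_def factor_def by blast
    \<comment> \<open>If the square of \<open>D\<close> divided \<open>P\<close>, one factor
      \<open>D\<close> could be cancelled. Evaluating the rest at \<open>a\<close>, where
      \<open>D\<close> vanishes, yields 0 = -1, because q - 1 > 0.\<close>
    have "D \<otimes>\<^bsub>?UP\<^esub> (D \<otimes>\<^bsub>?UP\<^esub> h) = D \<otimes>\<^bsub>?UP\<^esub> (D [^]\<^bsub>?UP\<^esub> (q - 1) \<ominus>\<^bsub>?UP\<^esub> \<one>\<^bsub>?UP\<^esub>)"
      using PD h D by (simp add: numeral_2_eq_2 UP.m_assoc)
    moreover have "D \<noteq> \<zero>\<^bsub>?UP\<^esub>" by (simp add: D_def univ_poly_zero)
    ultimately have eq: "D \<otimes>\<^bsub>?UP\<^esub> h = D [^]\<^bsub>?UP\<^esub> (q - 1) \<ominus>\<^bsub>?UP\<^esub> \<one>\<^bsub>?UP\<^esub>"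
      using D h by (simp add: UP.m_lcancel)
    interpret ev: ring_hom_ring ?UP L "\<lambda>f. eval f a" by (rule eval_ring_hom[OF carrier_is_subring a(1)])
    have "eval D a = \<zero>" using a by (simp add: D_def r_neg)
    moreover have "eval h a \<in> carrier L" using h by simp
    ultimately have "\<zero> = \<zero> [^] (q - 1) \<ominus> \<one>"
      using arg_cong[OF eq, of "\<lambda>f. eval f a"] D h by (simp add: a_minus_def ev.hom_nat_pow)
    also have "\<zero> [^] (q - 1) = \<zero>" using q1 by (simp add: nat_pow_zero)
    finally have "\<ominus> \<one> = \<zero>" by (simp add: a_minus_def)
    then have "\<one> = \<zero>" using minus_minus[OF one_closed] minus_zero by simp
    then show False by simp
  qed
  \<comment> \<open>Without repeated roots, the number of distinct roots is the size of the root
    multiset. This equals the degree q since \<open>P\<close> splits over an algebraically closed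
    field.\<close>
  have "roots P = mset_set {a. is_root P a}"
  proof (rule multiset_eqI)
    fix a
    have "count (roots P) a = alg_mult P a" using alg_mult_eq_count_roots[OF P] by simp
    moreover have "alg_mult P a = (if is_root P a then 1 else 0)"
      using mult1[of a] alg_mult_gt_zero_iff_is_root[OF P, of a] by (cases "is_root P a") auto
    ultimately show "count (roots P) a = count (mset_set {a. is_root P a}) a"
      using finite_number_of_roots[OF P] P0 by simp
  qed
  then have "card {a. is_root P a} = size (roots P)" by simp
  also have "\<dots> = q" using roots_over_carrier[OF P] degree by (simp add: splitted_def)
  finally show ?thesis by (simp add: root)
qed

lemma subfield_fixed_points:
  assumes q: "q = p ^ n" and n: "n > 0"
  shows "subfield {a \<in> carrier L. a [^] q = a} L"
proof (rule subfieldI')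
  have q0: "q > 0" using q prime_p prime_gt_0_nat by simp
  have frob: "(x \<oplus> y) [^] q = x [^] q \<oplus> y [^] q" if "x \<in> carrier L" "y \<in> carrier L" for x y
    unfolding q by (rule freshmans_dream_power[OF prime_p char that])
  show "subring {a \<in> carrier L. a [^] q = a} L"
  proof (rule subringI)
    fix x assume "x \<in> {a \<in> carrier L. a [^] q = a}"
    then have x: "x \<in> carrier L" "x [^] q = x" by auto
    \<comment> \<open>Frobenius applied to x + (-x) = 0 gives closure under negation without
      determining (-1)^q, uniformly for p = 2 and odd p.\<close>
    have "x \<oplus> (\<ominus> x) [^] q = \<zero>"
      using frob[of x "\<ominus> x"] x q0 by (simp add: r_neg nat_pow_zero)
    then have "\<ominus> x = (\<ominus> x) [^] q"
      using x by (intro minus_equality) (simp_all add: a_comm)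
    then show "\<ominus> x \<in> {a \<in> carrier L. a [^] q = a}" using x by (auto dest: sym)
  qed (use frob in \<open>auto simp: nat_pow_distrib\<close>)
next
  fix x assume "x \<in> {a \<in> carrier L. a [^] q = a} - {\<zero>}"
  then have x: "x \<in> Units L" "x \<in> carrier L" "x [^] q = x" by (auto simp: field_Units)
  have "(x \<otimes> inv x) [^] q = x [^] q \<otimes> (inv x) [^] q"
    using x by (intro nat_pow_distrib) auto
  then have "x \<otimes> (inv x) [^] q = \<one>" using x by simp
  then have "inv x = (inv x) [^] q" using x by (intro comm_inv_char) simp_all
  then show "inv x \<in> {a \<in> carrier L. a [^] q = a}" using x by (auto dest: sym)
qed

end

text \<open>The elements fixed by the q-th power map in an algebraic closure of the integers modulo
  p form a subfield with q elements.\<close>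

theorem finite_field_exists:
  assumes "primepow q"
  shows "\<exists>K :: nat ring. field K \<and> Coset.order K = q"
proof -
  obtain p n where p: "prime p" and n: "n > 0" and q: "q = p ^ n"
    using assms by (auto simp: primepow_def)
  interpret R: residues_prime p "residue_ring (int p)"
    by (rule residues_prime.intro[OF p]) simp
  define L where "L = R.alg_closure"
  interpret algebraic_closure L "R.indexed_const ` carrier (residue_ring (int p))"
    unfolding L_def by (rule R.alg_closureE(1))
  interpret h: ring_hom_ring "residue_ring (int p)" L R.indexed_const
    unfolding L_def
    by (rule ring_hom_ringI2[OF R.ring_axioms _ R.alg_closureE(2)])
      (rule ring_axioms[unfolded L_def])
  have "add_pow (residue_ring (int p)) p \<one>\<^bsub>residue_ring (int p)\<^esub> = \<zero>\<^bsub>residue_ring (int p)\<^esub>"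
    by (simp add: R.add_pow_one R.res_zero_eq)
  then have "add_pow L p \<one>\<^bsub>L\<^esub> = \<zero>\<^bsub>L\<^esub>"
    using h.hom_add_pow_nat[of "\<one>\<^bsub>residue_ring (int p)\<^esub>" p] by simp
  then interpret algebraically_closed_char L p
    by unfold_locales (use p in auto)
  let ?K = "{a \<in> carrier L. a [^]\<^bsub>L\<^esub> q = a}"
  interpret K: field "L\<lparr>carrier := ?K\<rparr>"
    by (rule subfield_iff(2)[OF subfield_fixed_points[OF q n]])
  have card: "card ?K = q" by (rule card_fixed_points[OF q n])
  have "q > 0" using p q prime_gt_0_nat by simp
  then have "finite ?K" by (intro card_ge_0_finite) (simp only: card)
  \<comment> \<open>The subfield lives in the type of the algebraic closure; being finite, it can be
    carried over to the natural numbers by an injection.\<close>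
  then obtain f :: "_ \<Rightarrow> nat" where "inj_on f ?K" using finite_imp_inj_to_nat_seg by blast
  then have "field (image_ring f (L\<lparr>carrier := ?K\<rparr>))" "Coset.order (image_ring f (L\<lparr>carrier := ?K\<rparr>)) = q"
    using K.inj_imp_image_ring_is_field[of f] card
    by (simp_all add: Coset.order_def image_ring_carrier card_image)
  then show ?thesis by blast
qed

theorem theorem10:
  fixes q :: nat
  assumes "primepow q"
  shows "(\<exists>K :: nat ring. field K \<and> order K = q) \<and>
    (\<forall>F :: 'a ring. field F \<and> order F = q \<longrightarrow>
      (\<exists>C :: nat \<Rightarrow> ((nat \<Rightarrow> 'a) set, (nat \<Rightarrow> 'a) set) incidence_structure.
         C 0 = LP 4 F \<and>
         (\<forall>i<4. strongly_regular_configuration (C i)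
            ((q^2 + 1) * (q^4 + q^3 + q^2 + q + 1)) (q^2 + q + 1)
            (q^3 + 2 * q^2 + q - 1) ((q + 1)^2)) \<and>
         (\<forall>i<4. \<forall>j<4. i \<noteq> j \<longrightarrow> \<not> isomorphic (C i) (C j)) \<and>
         semipartial_geometry (C 0) \<and>
         (\<forall>i\<in>{1..<4}. \<not> semipartial_geometry (C i))))"
proof (intro conjI allI impI)
  show "\<exists>K :: nat ring. field K \<and> order K = q"
    by (rule finite_field_exists[OF assms])
next
  fix F :: "'a ring" assume F: "field F \<and> order F = q"
  have "q > 0" using assms primepow_gt_0_nat by blast
  then interpret subspace_lattice
    "{W. VectorSpace.subspace F W (ring.func_space F {..4::nat})}"
    "\<lambda>W. vectorspace.dim F ((ring.func_space F {..4::nat})\<lparr>carrier := W\<rparr>)"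
    "module.submodule_sum (ring.func_space F {..4::nat})"
    "{\<zero>\<^bsub>ring.func_space F {..4::nat}\<^esub>}" "carrier (ring.func_space F {..4::nat})" q
    using F by (intro projective_4_space_lattice) auto
  \<comment> \<open>Projective dimension d means rank d + 1, so lines and planes of PG(4,q) are
    \<open>G 2\<close> and \<open>G 3\<close>.\<close>
  have "C0 = LP 4 F"
    by (simp add: C0_def LP_def PG_subspaces_def G_def Let_def numeral_2_eq_2 numeral_3_eq_3)
  then show "\<exists>C :: nat \<Rightarrow> ((nat \<Rightarrow> 'a) set, (nat \<Rightarrow> 'a) set) incidence_structure.
      C 0 = LP 4 F \<and>
      (\<forall>i<4. strongly_regular_configuration (C i)
         ((q^2 + 1) * (q^4 + q^3 + q^2 + q + 1)) (q^2 + q + 1)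
         (q^3 + 2 * q^2 + q - 1) ((q + 1)^2)) \<and>
      (\<forall>i<4. \<forall>j<4. i \<noteq> j \<longrightarrow> \<not> isomorphic (C i) (C j)) \<and>
      semipartial_geometry (C 0) \<and>
      (\<forall>i\<in>{1..<4}. \<not> semipartial_geometry (C i))"
    using four_configurations by simp
qed

end
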